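(* Let $n\in\mathbb{N}$ and let $$ B_n(a)=\tan\frac{\pi}{2(n+1)}\,\sqrt{a-a^2},\qquad a\in[0,1]. $$ The points of local maximum of the function $a\mapsto A_{n,n-1,\infty}(a)$ on $[0,1]$ are $$ a_j=\sin^2\frac{\pi j}{2(n+1)},\qquad j=1,2,\ldots,n, $$ and the values at these points are $$ A_{n,n-1,\infty}(a_j)=B_n(a_j),\qquad j=1,\ldots,n. $$ If $n-1$ is even, the point of global maximum of $A_{n,n-1,\infty}$ is $a=1/2$. If $n-1$ is odd, the points of global maximum of $A_{n,n-1,\infty}$ are the points of local maximum closest to $1/2$, which are equal to $\sin^2\frac{\pi n}{4(n+1)}$ and $\sin^2\frac{\pi(n+2)}{4(n+1)}$. Consequently, $$ \Lambda_{n,n-1,\infty,\infty}=\frac12\tan\frac{\pi}{2(n+1)}\quad\text{if } n \text{ is odd}, $$ $$ \Lambda_{n,n-1,\infty,\infty}=\frac12\tan\frac{\pi}{2(n+1)}\,\sin\frac{\pi n}{2(n+1)}\quad\text{if } n \text{ is even}. $$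
   Context: $\mathring{W}^n_\infty[0,1]$ is the Sobolev space of real-valued functions $y$ on $[0,1]$ whose derivatives up to order $n-1$ are absolutely continuous, with $y^{(n)}\in L_\infty[0,1]$, and with $y^{(j)}(0)=y^{(j)}(1)=0$ for $j=0,1,\ldots,n-1$; its norm is $\|y^{(n)}\|_{L_\infty[0,1]}=\operatorname{ess\,sup}_{x\in[0,1]}|y^{(n)}(x)|$. For $a\in[0,1]$, $A_{n,n-1,\infty}(a)$ is the sharp (smallest possible) constant in the inequality $|y^{(n-1)}(a)|\le A_{n,n-1,\infty}(a)\,\|y^{(n)}\|_{L_\infty[0,1]}$ for all $y\in\mathring{W}^n_\infty[0,1]$, i.e. $A_{n,n-1,\infty}(a)=\sup\{|y^{(n-1)}(a)| : y\in\mathring{W}^n_\infty[0,1],\ \|y^{(n)}\|_{L_\infty[0,1]}=1\}$. $\Lambda_{n,n-1,\infty,\infty}=\sup\{\|y^{(n-1)}\|_{L_\infty[0,1]} : y\in\mathring{W}^n_\infty[0,1],\ \|y^{(n)}\|_{L_\infty[0,1]}=1\}=\sup_{a\in[0,1]}A_{n,n-1,\infty}(a)$ is the sharp embedding constant. *)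

theory Defs
  imports "HOL-Analysis.Analysis" "HOL-Probability.Essential_Supremum"
begin

definition absolutely_continuous_on :: "real set \<Rightarrow> (real \<Rightarrow> real) \<Rightarrow> bool" where
  "absolutely_continuous_on S f \<longleftrightarrow>
     (\<forall>\<epsilon>>0. \<exists>\<delta>>0. \<forall>(m::nat) u v.
        (\<forall>i<m. u i \<le> v i \<and> {u i..v i} \<subseteq> S) \<longrightarrow>
        disjoint_family_on (\<lambda>i. {u i<..<v i}) {..<m} \<longrightarrow>
        (\<Sum>i<m. v i - u i) < \<delta> \<longrightarrow>
        (\<Sum>i<m. \<bar>f (v i) - f (u i)\<bar>) < \<epsilon>)"

(* The derivative of order j on [0,1], one-sided at the endpoints, so that it depends only
   on the restriction of y to [0,1]. Its value is meaningful only where the derivative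
   exists; existence is required separately in sobolev0. *)
definition der :: "nat \<Rightarrow> (real \<Rightarrow> real) \<Rightarrow> real \<Rightarrow> real" where
  "der j = (\<lambda>f x. vector_derivative f (at x within {0..1})) ^^ j"

definition Linf_norm :: "(real \<Rightarrow> real) \<Rightarrow> ereal" where
  "Linf_norm f = esssup (lebesgue_on {0..1}) (\<lambda>x. ereal \<bar>f x\<bar>)"

(* The derivatives of orders 1, ..., n-1 exist everywhere on [0,1], the one of order n almost
   everywhere; on the exceptional null set der n y has an irrelevant value. *)
definition sobolev0 :: "nat \<Rightarrow> (real \<Rightarrow> real) set" where
  "sobolev0 n = {y.
     (\<forall>j. Suc j < n \<longrightarrow> der j y differentiable_on {0..1}) \<and>
     (\<forall>j<n. absolutely_continuous_on {0..1} (der j y)) \<and>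
     (AE x in lebesgue_on {0..1}. der (n - 1) y differentiable (at x within {0..1})) \<and>
     der n y \<in> borel_measurable (lebesgue_on {0..1}) \<and> Linf_norm (der n y) < \<infinity> \<and>
     (\<forall>j<n. der j y 0 = 0 \<and> der j y 1 = 0)}"

(* Suprema are taken in the extended reals, so that no boundedness is presupposed. *)
definition sharp_const :: "nat \<Rightarrow> nat \<Rightarrow> real \<Rightarrow> ereal" where
  "sharp_const n k a =
     (SUP y\<in>{y \<in> sobolev0 n. Linf_norm (der n y) = 1}. ereal \<bar>der k y a\<bar>)"

definition embedding_const :: "nat \<Rightarrow> nat \<Rightarrow> ereal" where
  "embedding_const n k =
     (SUP y\<in>{y \<in> sobolev0 n. Linf_norm (der n y) = 1}. Linf_norm (der k y))"

definition local_max_points :: "real set \<Rightarrow> (real \<Rightarrow> ereal) \<Rightarrow> real set" where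
  "local_max_points S f = {a \<in> S. \<forall>\<^sub>F x in at a within S. f x \<le> f a}"

definition global_max_points :: "real set \<Rightarrow> (real \<Rightarrow> ereal) \<Rightarrow> real set" where
  "global_max_points S f = {a. is_arg_max f (\<lambda>x. x \<in> S) a}"

definition B :: "nat \<Rightarrow> real \<Rightarrow> real" where
  "B n a = tan (pi / (2 * (real n + 1))) * sqrt (a - a\<^sup>2)"

definition node :: "nat \<Rightarrow> nat \<Rightarrow> real" where
  "node n j = (sin (pi * real j / (2 * (real n + 1))))\<^sup>2"

end

theory Submission
  imports Defs
begin

text \<open>
  Write \<open>g = y\<^sup>(\<^sup>n\<^sup>)\<close>. A function \<open>g\<close> is the \<open>n\<close>-th derivative of a member of the space iff it is bounded and
  orthogonal on \<open>[0,1]\<close> to all polynomials of degree below \<open>n\<close>, and then \<open>y\<^sup>(\<^sup>n\<^sup>-\<^sup>1\<^sup>)(a)\<close> is the integral of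
  \<open>g\<close> over \<open>[0,a]\<close>. So the sharp constant \<open>A(a)\<close> is the \<open>L\<^sub>1\<close>-distance of the indicator of \<open>[0,a]\<close> from
  the polynomials of degree below \<open>n\<close>, and an optimal \<open>g\<close> is a sign function.

  For every \<open>t > 0\<close> there are points \<open>0 < x\<^sub>0(t) < \<dots> < x\<^sub>n(t) < 1\<close> (the knots) at which an
  orthogonal sign function changes sign. As \<open>t\<close> runs from \<open>0\<close> to infinity, \<open>x\<^sub>i\<close> increases from the
  node \<open>a\<^sub>i\<close> to the node \<open>a\<^sub>i\<^sub>+\<^sub>1\<close> (with \<open>a\<^sub>0 = 0\<close> and \<open>a\<^sub>n\<^sub>+\<^sub>1 = 1\<close>), so every point that
  is not a node is \<open>x\<^sub>k(t)\<close> for exactly one \<open>k\<close> and one \<open>t\<close>. The knots are the roots of a polynomial \<open>W\<close> of degree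
  \<open>n+1\<close>, and they move with velocity \<open>v\<^sub>i = (-1)\<^sup>i / W'(x\<^sub>i)\<close>. Hence the alternating sum of
  \<open>v\<^sub>i q(x\<^sub>i)\<close> is a divided difference of \<open>q\<close> and vanishes for \<open>deg q < n\<close> (\<open>knot_weights\<close>). This makes the
  moments of the sign function constant in \<open>t\<close>; as its limits for \<open>t \<rightarrow> 0\<close> and \<open>t \<rightarrow> \<infinity>\<close> are negatives of each
  other, they are zero (\<open>knot_orthogonal\<close>). The polynomial \<open>p\<close> equal to \<open>1\<close> at the knots before
  \<open>x\<^sub>k\<close> and to \<open>0\<close> at those after it differs from the indicator of \<open>[0,x\<^sub>k]\<close> by a function that has, up to zeros, the signs of the
  optimal sign function (\<open>knot_certificate\<close>), and duality gives
  \<open>A(x\<^sub>k(t)) = peak n k t\<close>, an explicit alternating sum of knots (\<open>sharp_val_knot\<close>).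

  The rest is calculus in \<open>t\<close>. Near each end of a gap between nodes the derivative of \<open>peak\<close>, suitably scaled, has a limit
  whose sign makes the adjacent interior node a local maximum (\<open>node_local_max\<close>), and the value there is the limit of \<open>peak\<close>, a sum
  that telescopes to \<open>B n\<close> (\<open>alt_nodes_B\<close>). At a critical point inside a gap the interpolant satisfies
  \<open>p(x\<^sub>k) = 1/2\<close>, and the second derivative of \<open>peak\<close> is a negative multiple of the sum of
  \<open>(-1)\<^sup>k\<^sup>+\<^sup>i p'(x\<^sub>i) v\<^sub>i\<^sup>2\<close>. Since \<open>v\<^sub>i = 2 x\<^sub>i (1 - x\<^sub>i) / l(x\<^sub>i)\<close> with \<open>l\<close> affine, this is a divided difference of a
  rational function with at most one pole, outside \<open>[0,1]\<close>, and its sign can be read off (\<open>critical_curvature\<close>): such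
  a point is a strict local minimum. So the local maxima are exactly the interior nodes; by continuity the
  global maximum is attained, hence at a node, and \<open>B n\<close> decreases with the distance from \<open>1/2\<close>.
\<close>

section \<open>Absolutely continuous functions\<close>

text \<open>The finite families of intervals over which absolute continuity controls the increments.\<close>

definition short_family :: "real set \<Rightarrow> real \<Rightarrow> nat \<Rightarrow> (nat \<Rightarrow> real) \<Rightarrow> (nat \<Rightarrow> real) \<Rightarrow> bool" where
  "short_family S d m u v \<longleftrightarrow> (\<forall>i<m. u i \<le> v i \<and> {u i..v i} \<subseteq> S) \<and>
     disjoint_family_on (\<lambda>i. {u i<..<v i}) {..<m} \<and> (\<Sum>i<m. v i - u i) < d"

lemma ac_iff: "absolutely_continuous_on S f \<longleftrightarrow>
    (\<forall>e>0. \<exists>d>0. \<forall>m u v. short_family S d m u v \<longrightarrow> (\<Sum>i<m. \<bar>f (v i) - f (u i)\<bar>) < e)"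
  unfolding absolutely_continuous_on_def short_family_def imp_conjL by (rule refl)

lemma ac_obtain:
  assumes "absolutely_continuous_on S f" "e > 0"
  obtains d where "d > 0" "\<And>m u v. short_family S d m u v \<Longrightarrow> (\<Sum>i<m. \<bar>f (v i) - f (u i)\<bar>) < e"
  using assms unfolding ac_iff by blast

text \<open>A Henstock gauge argument. Tags outside the exceptional null set are controlled by differentiability
  as in the classical proof. Around tags in the null set the gauge is an open superset of small
  measure, so absolute continuity makes the increments of \<open>f\<close> over the corresponding intervals small.\<close>

lemma ac_fundamental_theorem:
  fixes f g :: "real \<Rightarrow> real"
  assumes ab: "a \<le> b" and sub: "{a..b} \<subseteq> S" and ac: "absolutely_continuous_on S f"
    and neg: "negligible N"
    and der: "\<And>x. x \<in> {a..b} - N \<Longrightarrow> (f has_vector_derivative g x) (at x within {a..b})"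
  shows "(g has_integral (f b - f a)) {a..b}"
proof -
  define g' where "g' x = (if x \<in> N then 0 else g x)" for x
  have ih: "(g' has_integral (f b - f a)) {a..b}"
    unfolding box_real(2)[symmetric] has_integral
  proof (intro allI impI)
    fix e :: real assume "e > 0"
    define e1 where "e1 = e / (2 * (b - a + 1))"
    have e1: "e1 > 0" using \<open>e > 0\<close> ab by (simp add: e1_def)
    have e1': "e1 * (b - a) < e / 2"
      using \<open>e > 0\<close> ab by (simp add: e1_def field_simps)
    obtain \<delta> where \<delta>: "\<delta> > 0" and ac\<delta>: "\<And>m u v. short_family S \<delta> m u v \<Longrightarrow> (\<Sum>i<m. \<bar>f (v i) - f (u i)\<bar>) < e / 2"
      using ac_obtain[OF ac, of "e / 2"] \<open>e > 0\<close> by auto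
    have Nl: "N \<in> sets lebesgue" and N0: "emeasure lebesgue N = 0"
      using neg by (auto simp: negligible_iff_null_sets)
    obtain U where U: "open U" "N \<subseteq> U" "emeasure lebesgue (U - N) < ennreal \<delta>"
      using sets_lebesgue_outer_open[OF Nl \<delta>] by metis
    have Ul: "U \<in> sets lebesgue" using U(1) by simp
    have mU: "emeasure lebesgue U < ennreal \<delta>"
    proof -
      have "emeasure lebesgue U \<le> emeasure lebesgue (U - N) + emeasure lebesgue N"
        by (metis Diff_partition Nl U(2) Ul emeasure_subadditive add.commute sets.Diff)
      with U(3) N0 show ?thesis by simp
    qed
    have "\<forall>x. \<exists>d>0. x \<in> {a..b} - N \<longrightarrow>
         (\<forall>y\<in>{a..b}. norm (y-x) < d \<longrightarrow> norm (f y - f x - (y-x) *\<^sub>R g x) \<le> e1 * norm (y-x))"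
      using der[unfolded has_vector_derivative_def has_derivative_within_alt] e1 by blast
    then obtain d where d: "\<And>x. 0 < d x"
       "\<And>x y. \<lbrakk>x \<in> {a..b} - N; y \<in> {a..b}; norm (y-x) < d x\<rbrakk>
           \<Longrightarrow> norm (f y - f x - (y-x) *\<^sub>R g x) \<le> e1 * norm (y-x)"
      by metis
    \<comment> \<open>The gauge is small at ordinary tags and stays inside the open set \<open>U\<close> at exceptional ones.\<close>
    define \<gamma> where "\<gamma> x = (if x \<in> N then U else ball x (d x))" for x
    have "gauge \<gamma>" using U d(1) by (auto simp: gauge_def \<gamma>_def)
    moreover have main: "norm ((\<Sum>(x, k)\<in>p. measure lborel k *\<^sub>R g' x) - (f b - f a)) < e"
      if ptag: "p tagged_division_of cbox a b" and fine: "\<gamma> fine p" for p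
    proof -
      have finp: "finite p" using ptag by blast
      have fab: "f b - f a = (\<Sum>(x,K)\<in>p. f (Sup K) - f (Inf K))"
        and ba: "b - a = (\<Sum>(x,K)\<in>p. Sup K - Inf K)"
        using additive_tagged_division_1[where f= f] additive_tagged_division_1[where f="\<lambda>x. x"]
          \<open>a \<le> b\<close> ptag by auto
      have K: "\<exists>u v. K = {u..v} \<and> u \<le> v \<and> Inf K = u \<and> Sup K = v \<and> x \<in> K \<and> K \<subseteq> {a..b} \<and> K \<subseteq> \<gamma> x \<and> measure lborel K = v - u"
        if xKp: "(x, K) \<in> p" for x K
      proof -
        obtain u v where k: "K = cbox u v" using tagged_division_ofD(4)[OF ptag xKp] by blast
        have "x \<in> K" "K \<subseteq> cbox a b" using ptag xKp by blast+
        moreover have "u \<le> v" using k \<open>x \<in> K\<close> by auto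
        moreover have "K \<subseteq> \<gamma> x" using fine xKp by (auto simp: fine_def)
        ultimately show ?thesis using k by (intro exI[of _ u] exI[of _ v]) auto
      qed
      define P1 where "P1 = {z \<in> p. fst z \<notin> N}"
      define P2 where "P2 = {z \<in> p. fst z \<in> N}"
      have P: "p = P1 \<union> P2" "P1 \<inter> P2 = {}" "finite P1" "finite P2"
        using finp by (auto simp: P1_def P2_def)
      let ?t = "\<lambda>(x,K). measure lborel K *\<^sub>R g' x - (f (Sup K) - f (Inf K))"
      have s: "(\<Sum>(x, k)\<in>p. measure lborel k *\<^sub>R g' x) - (f b - f a) = sum ?t P1 + sum ?t P2"
        unfolding fab sum_subtractf[symmetric] P(1)
        by (subst sum.union_disjoint[symmetric]) (use P in \<open>auto intro!: sum.cong\<close>)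
      have "norm (sum ?t P1) \<le> (\<Sum>(x,K)\<in>P1. e1 * (Sup K - Inf K))"
      proof (rule sum_norm_le, safe)
        fix x K assume xK: "(x, K) \<in> P1"
        then have xp: "(x,K) \<in> p" and xN: "x \<notin> N" by (auto simp: P1_def)
        obtain u v where uv: "K = {u..v}" "u \<le> v" "Inf K = u" "Sup K = v" "x \<in> K" "K \<subseteq> {a..b}" "K \<subseteq> \<gamma> x" "measure lborel K = v - u"
          using K[OF xp] by blast
        have b: "K \<subseteq> ball x (d x)" using uv xN by (simp add: \<gamma>_def)
        have x: "x \<in> {a..b} - N" using uv xN by auto
        have ub: "u \<in> ball x (d x)" "v \<in> ball x (d x)" "u \<in> {a..b}" "v \<in> {a..b}"
          using b uv by (auto simp del: mem_ball)
        have 1: "norm (f v - f x - (v-x) *\<^sub>R g x) \<le> e1 * norm (v-x)"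
          using d(2)[OF x, of v] ub by (simp add: dist_norm norm_minus_commute)
        have 2: "norm (f u - f x - (u-x) *\<^sub>R g x) \<le> e1 * norm (u-x)"
          using d(2)[OF x, of u] ub by (simp add: dist_norm norm_minus_commute)
        have "measure lborel K *\<^sub>R g' x - (f (Sup K) - f (Inf K)) = (f u - f x - (u-x) *\<^sub>R g x) - (f v - f x - (v-x) *\<^sub>R g x)"
          using uv xN by (simp add: g'_def algebra_simps)
        then have "norm (measure lborel K *\<^sub>R g' x - (f (Sup K) - f (Inf K))) \<le> e1 * norm (u-x) + e1 * norm (v-x)"
          using 1 2 norm_triangle_ineq4 by (smt (verit))
        also have "\<dots> = e1 * (v - u)" using uv by (simp add: algebra_simps)
        finally show "norm (measure lborel K *\<^sub>R g' x - (f (Sup K) - f (Inf K))) \<le> e1 * (Sup K - Inf K)" using uv by simp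
      qed
      also have "\<dots> \<le> (\<Sum>(x,K)\<in>p. e1 * (Sup K - Inf K))"
      proof (rule sum_mono2[OF finp])
        show "P1 \<subseteq> p" using P by auto
        fix z assume "z \<in> p - P1"
        obtain x K' where z: "z = (x, K')" by (cases z)
        show "0 \<le> (case z of (x, K) \<Rightarrow> e1 * (Sup K - Inf K))"
          using K[of x K'] e1 z \<open>z \<in> p - P1\<close> by auto
      qed
      also have "\<dots> = e1 * (b - a)" unfolding ba sum_distrib_left by (auto intro!: sum.cong)
      finally have n1: "norm (sum ?t P1) < e / 2" using e1' by linarith
      obtain h where h: "bij_betw h {..<card P2} P2"
        using ex_bij_betw_nat_finite[OF P(4)] by (auto simp: atLeast0LessThan)
      define u where "u i = Inf (snd (h i))" for i
      define v where "v i = Sup (snd (h i))" for i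
      have hi: "h i \<in> p" "fst (h i) \<in> N" if "i < card P2" for i
        using h that by (auto simp: bij_betw_def P2_def)
      have huv: "u i \<le> v i \<and> snd (h i) = {u i..v i} \<and> snd (h i) \<subseteq> {a..b} \<and> snd (h i) \<subseteq> U" if "i < card P2" for i
        using K[of "fst (h i)" "snd (h i)"] hi[OF that] by (auto simp: u_def v_def \<gamma>_def)
      have disj: "disjoint_family_on (\<lambda>i. {u i<..<v i}) {..<card P2}"
        unfolding disjoint_family_on_def
      proof safe
        fix i j y assume ij: "i < card P2" "j < card P2" "i \<noteq> j"
          and y: "y \<in> {u i<..<v i}" "y \<in> {u j<..<v j}"
        have "h i \<noteq> h j" using h ij by (auto simp: bij_betw_def inj_on_def)
        then have "interior (snd (h i)) \<inter> interior (snd (h j)) = {}"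
          using tagged_division_ofD(5)[OF ptag, of "fst (h i)" "snd (h i)" "fst (h j)" "snd (h j)"] hi ij by auto
        then show "y \<in> {}" using y huv[OF ij(1)] huv[OF ij(2)] by (auto simp: interior_atLeastAtMost_real)
      qed
      have "(\<Sum>i<card P2. v i - u i) < \<delta>"
      proof -
        have "ennreal (\<Sum>i<card P2. v i - u i) = (\<Sum>i<card P2. emeasure lebesgue {u i<..<v i})"
          by (subst sum_ennreal[symmetric]) (use huv in \<open>auto intro!: sum.cong\<close>)
        also have "\<dots> = emeasure lebesgue (\<Union>i<card P2. {u i<..<v i})"
          by (rule sum_emeasure) (use disj in auto)
        also have "\<dots> \<le> emeasure lebesgue U"
          by (rule emeasure_mono) (use huv Ul in fastforce)+
        finally have "ennreal (\<Sum>i<card P2. v i - u i) < ennreal \<delta>" using mU by simp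
        moreover have "0 \<le> (\<Sum>i<card P2. v i - u i)" by (rule sum_nonneg) (use huv in auto)
        ultimately show ?thesis by (simp only: ennreal_less_iff)
      qed
      then have "(\<Sum>i<card P2. \<bar>f (v i) - f (u i)\<bar>) < e / 2"
      proof (intro ac\<delta>)
        have "u i \<le> v i \<and> {u i..v i} \<subseteq> S" if "i < card P2" for i using huv[OF that] sub by blast
        then show "short_family S \<delta> (card P2) u v"
          using disj \<open>(\<Sum>i<card P2. v i - u i) < \<delta>\<close> by (simp add: short_family_def)
      qed
      moreover have "norm (sum ?t P2) \<le> (\<Sum>z\<in>P2. \<bar>f (Sup (snd z)) - f (Inf (snd z))\<bar>)"
        by (rule sum_norm_le) (auto simp: P2_def g'_def)
      moreover have "(\<Sum>z\<in>P2. \<bar>f (Sup (snd z)) - f (Inf (snd z))\<bar>) = (\<Sum>i<card P2. \<bar>f (v i) - f (u i)\<bar>)"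
        unfolding u_def v_def by (rule sum.reindex_bij_betw[OF h, symmetric])
      ultimately have "norm (sum ?t P2) < e / 2" by linarith
      then show ?thesis unfolding s using n1 norm_triangle_ineq[of "sum ?t P1" "sum ?t P2"] by linarith
    qed
    ultimately show "\<exists>\<gamma>. gauge \<gamma> \<and> (\<forall>\<D>. \<D> tagged_division_of cbox a b \<and> \<gamma> fine \<D> \<longrightarrow>
       norm ((\<Sum>(x, k)\<in>\<D>. measure lborel k *\<^sub>R g' x) - (f b - f a)) < e)"
      by (intro exI[of _ \<gamma>] conjI allI impI) (use main in simp_all)
  qed
  have sp: "g x = g' x" if "x \<in> {a..b} - N" for x using that by (simp add: g'_def)
  show ?thesis
    by (rule has_integral_spike[OF neg sp ih])
qed

lemma ac_imp_continuous_on: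
  assumes "absolutely_continuous_on {a..b} f"
  shows "continuous_on {a..b} f"
  unfolding continuous_on_iff
proof (intro ballI allI impI)
  fix x e :: real assume x: "x \<in> {a..b}" and e: "e > 0"
  obtain \<delta> where \<delta>: "\<delta> > 0" and ac: "\<And>m u v. short_family {a..b} \<delta> m u v \<Longrightarrow> (\<Sum>i<m. \<bar>f (v i) - f (u i)\<bar>) < e"
    using ac_obtain[OF assms e] by blast
  have "dist (f y) (f x) < e" if "y \<in> {a..b}" "dist y x < \<delta>" for y
    using ac[of 1 "\<lambda>_. min x y" "\<lambda>_. max x y"] x that
    by (cases "x \<le> y") (auto simp: short_family_def disjoint_family_on_def dist_real_def abs_minus_commute)
  then show "\<exists>d>0. \<forall>x'\<in>{a..b}. dist x' x < d \<longrightarrow> dist (f x') (f x) < e" using \<delta> by blast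
qed

lemma ac_dominated:
  assumes f: "absolutely_continuous_on S f" and g: "absolutely_continuous_on S g" and K: "K > 0"
    and dom: "\<And>x y. x \<in> S \<Longrightarrow> y \<in> S \<Longrightarrow> \<bar>h x - h y\<bar> \<le> K * \<bar>f x - f y\<bar> + K * \<bar>g x - g y\<bar>"
  shows "absolutely_continuous_on S h"
  unfolding ac_iff
proof (intro allI impI)
  fix e :: real assume e: "e > 0"
  then have eK: "e / (2 * K) > 0" using K by simp
  obtain d1 where d1: "d1 > 0" "\<And>m u v. short_family S d1 m u v \<Longrightarrow> (\<Sum>i<m. \<bar>f (v i) - f (u i)\<bar>) < e / (2 * K)"
    using ac_obtain[OF f, of "e / (2 * K)"] eK by auto
  obtain d2 where d2: "d2 > 0" "\<And>m u v. short_family S d2 m u v \<Longrightarrow> (\<Sum>i<m. \<bar>g (v i) - g (u i)\<bar>) < e / (2 * K)"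
    using ac_obtain[OF g, of "e / (2 * K)"] eK by auto
  have "(\<Sum>i<m. \<bar>h (v i) - h (u i)\<bar>) < e"
    if A: "short_family S (min d1 d2) m u v" for m u v
  proof -
    have "(\<Sum>i<m. \<bar>h (v i) - h (u i)\<bar>) \<le> (\<Sum>i<m. K * \<bar>f (v i) - f (u i)\<bar> + K * \<bar>g (v i) - g (u i)\<bar>)"
    proof (rule sum_mono)
      fix i assume "i \<in> {..<m}"
      then have "u i \<le> v i" "{u i..v i} \<subseteq> S" using A by (auto simp: short_family_def)
      then have "u i \<in> S" "v i \<in> S" by (auto simp: subset_iff)
      then show "\<bar>h (v i) - h (u i)\<bar> \<le> K * \<bar>f (v i) - f (u i)\<bar> + K * \<bar>g (v i) - g (u i)\<bar>"
        by (intro dom)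
    qed
    also have "\<dots> = K * (\<Sum>i<m. \<bar>f (v i) - f (u i)\<bar>) + K * (\<Sum>i<m. \<bar>g (v i) - g (u i)\<bar>)"
      by (simp add: sum.distrib sum_distrib_left)
    also have "\<dots> < K * (e / (2 * K)) + K * (e / (2 * K))"
      using A K by (intro add_strict_mono mult_strict_left_mono d1(2) d2(2)) (auto simp: short_family_def)
    also have "\<dots> = e" using K by simp
    finally show ?thesis .
  qed
  then show "\<exists>d>0. \<forall>m u v. short_family S d m u v \<longrightarrow> (\<Sum>i<m. \<bar>h (v i) - h (u i)\<bar>) < e"
    using d1(1) d2(1) by (intro exI[of _ "min d1 d2"]) auto
qed

lemma ac_ident: "absolutely_continuous_on S (\<lambda>x. x)"
  unfolding ac_iff
proof (intro allI impI)
  fix e :: real assume e: "e > 0"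
  have "(\<Sum>i<m. \<bar>v i - u i\<bar>) = (\<Sum>i<m. v i - u i)"
    if "short_family S e m u v" for m u v
    by (rule sum.cong) (use that in \<open>auto simp: short_family_def\<close>)
  then show "\<exists>d>0. \<forall>m u v. short_family S d m u v \<longrightarrow> (\<Sum>i<m. \<bar>v i - u i\<bar>) < e"
    using e by (intro exI[of _ e]) (auto simp: short_family_def)
qed

lemma lipschitz_imp_ac:
  assumes L: "\<And>x y. x \<in> S \<Longrightarrow> y \<in> S \<Longrightarrow> \<bar>f x - f y\<bar> \<le> L * \<bar>x - y\<bar>"
  shows "absolutely_continuous_on S f"
proof (rule ac_dominated[OF ac_ident ac_ident])
  show "\<bar>L\<bar> + 1 > 0" by simp
  fix x y assume "x \<in> S" "y \<in> S"
  then have "\<bar>f x - f y\<bar> \<le> L * \<bar>x - y\<bar>" by (rule L)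
  also have "\<dots> \<le> (\<bar>L\<bar> + 1) * \<bar>x - y\<bar>" by (rule mult_right_mono) auto
  also have "\<dots> \<le> (\<bar>L\<bar> + 1) * \<bar>x - y\<bar> + (\<bar>L\<bar> + 1) * \<bar>x - y\<bar>" by simp
  finally show "\<bar>f x - f y\<bar> \<le> (\<bar>L\<bar> + 1) * \<bar>x - y\<bar> + (\<bar>L\<bar> + 1) * \<bar>x - y\<bar>" .
qed

lemma ac_add:
  assumes "absolutely_continuous_on S f" "absolutely_continuous_on S g"
  shows "absolutely_continuous_on S (\<lambda>x. f x + g x)"
  by (rule ac_dominated[OF assms, of 1]) auto

lemma ac_mult:
  assumes f: "absolutely_continuous_on {a..b} f" and g: "absolutely_continuous_on {a..b} g"
  shows "absolutely_continuous_on {a..b} (\<lambda>x. f x * g x)"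
proof -
  have "bounded (f ` {a..b})" "bounded (g ` {a..b})"
    using f g by (auto intro!: compact_imp_bounded compact_continuous_image ac_imp_continuous_on)
  then obtain B1 B2 where bd: "\<forall>x\<in>{a..b}. \<bar>f x\<bar> \<le> B1" "\<forall>x\<in>{a..b}. \<bar>g x\<bar> \<le> B2"
    unfolding bounded_iff by auto
  define M where "M = max 1 (max B1 B2)"
  have M: "M > 0" "\<And>x. x \<in> {a..b} \<Longrightarrow> \<bar>f x\<bar> \<le> M" "\<And>x. x \<in> {a..b} \<Longrightarrow> \<bar>g x\<bar> \<le> M"
    using bd by (auto simp: M_def le_max_iff_disj)
  show ?thesis
  proof (rule ac_dominated[OF f g M(1)])
    fix x y assume xy: "x \<in> {a..b}" "y \<in> {a..b}"
    have "f x * g x - f y * g y = g x * (f x - f y) + f y * (g x - g y)" by (simp add: algebra_simps)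
    then have "\<bar>f x * g x - f y * g y\<bar> \<le> \<bar>g x\<bar> * \<bar>f x - f y\<bar> + \<bar>f y\<bar> * \<bar>g x - g y\<bar>"
      by (metis abs_mult abs_triangle_ineq)
    also have "\<dots> \<le> M * \<bar>f x - f y\<bar> + M * \<bar>g x - g y\<bar>"
      by (intro add_mono mult_right_mono M xy) auto
    finally show "\<bar>f x * g x - f y * g y\<bar> \<le> M * \<bar>f x - f y\<bar> + M * \<bar>g x - g y\<bar>" .
  qed
qed

section \<open>Derivatives and moments of functions in the Sobolev space\<close>

lemma ac_poly: "absolutely_continuous_on {a..b} (poly p)"
proof (induction p)
  case 0
  show ?case by (rule lipschitz_imp_ac[of _ _ 0]) simp
next
  case (pCons c p)
  have 1: "absolutely_continuous_on {a..b} (\<lambda>x. x)" by (rule lipschitz_imp_ac[of _ _ 1]) simp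
  have 2: "absolutely_continuous_on {a..b} (\<lambda>x. c)" by (rule lipschitz_imp_ac[of _ _ 0]) simp
  have "absolutely_continuous_on {a..b} (\<lambda>x. c + x * poly p x)"
    by (rule ac_add[OF 2 ac_mult[OF 1 pCons.IH]])
  moreover have "poly (pCons c p) = (\<lambda>x. c + x * poly p x)" by auto
  ultimately show ?case by simp
qed

lemma AE_unit_interval_negligible:
  assumes "AE x in lebesgue_on {0..1::real}. P x"
  obtains N where "negligible N" "\<And>x. x \<in> {0..1} - N \<Longrightarrow> P x"
proof -
  have "AE x in lebesgue. x \<in> {0..1} \<longrightarrow> P x"
    using assms by (simp add: AE_restrict_space_iff)
  then obtain N where "N \<in> null_sets lebesgue" "{x \<in> space lebesgue. \<not> (x \<in> {0..1} \<longrightarrow> P x)} \<subseteq> N"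
    by (auto simp: eventually_ae_filter)
  then show thesis by (intro that[of N]) (auto simp: negligible_iff_null_sets)
qed

lemma Linf_norm_le_negligible:
  assumes "Linf_norm g \<le> ereal c"
  obtains N where "negligible N" "\<And>x. x \<in> {0..1} - N \<Longrightarrow> \<bar>g x\<bar> \<le> c"
proof -
  have "AE x in lebesgue_on {0..1}. ereal \<bar>g x\<bar> \<le> Linf_norm g"
    unfolding Linf_norm_def by (rule esssup_AE)
  then have "AE x in lebesgue_on {0..1}. \<bar>g x\<bar> \<le> c"
    by (rule AE_mp) (use assms in \<open>auto intro!: AE_I2 dest: order_trans\<close>)
  then show thesis using AE_unit_interval_negligible that by blast
qed

lemma der_Suc: "der (Suc j) y x = vector_derivative (der j y) (at x within {0..1})"
  by (simp add: der_def)

lemma sobolev0_der_negligible: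
  assumes y: "y \<in> sobolev0 n" and j: "j < n"
  obtains N where "negligible N"
    "\<And>x. x \<in> {0..1} - N \<Longrightarrow> (der j y has_vector_derivative der (Suc j) y x) (at x within {0..1})"
proof (cases "Suc j < n")
  case True
  then have "der j y differentiable_on {0..1}" using y by (auto simp: sobolev0_def)
  then have "(der j y has_vector_derivative der (Suc j) y x) (at x within {0..1})" if "x \<in> {0..1}" for x
    using that unfolding der_Suc by (simp add: differentiable_on_def vector_derivative_works)
  then show thesis using that[of "{}"] by auto
next
  case False
  then have "n - 1 = j" using j by simp
  then have "AE x in lebesgue_on {0..1}. der j y differentiable (at x within {0..1})"
    using y by (auto simp: sobolev0_def)
  then obtain N where "negligible N" "\<And>x. x \<in> {0..1} - N \<Longrightarrow> der j y differentiable (at x within {0..1})"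
    using AE_unit_interval_negligible by blast
  then show thesis using that[of N] unfolding der_Suc by (simp add: vector_derivative_works)
qed

lemma sobolev0_has_integral:
  assumes y: "y \<in> sobolev0 n" and j: "j < n" and ab: "0 \<le> a" "a \<le> b" "b \<le> 1"
  shows "(der (Suc j) y has_integral (der j y b - der j y a)) {a..b}"
proof -
  obtain N where N: "negligible N"
    "\<And>x. x \<in> {0..1} - N \<Longrightarrow> (der j y has_vector_derivative der (Suc j) y x) (at x within {0..1})"
    using sobolev0_der_negligible[OF y j] by blast
  have sub: "{a..b} \<subseteq> {0..1}" using ab by auto
  have ac: "absolutely_continuous_on {0..1} (der j y)" using y j by (auto simp: sobolev0_def)
  show ?thesis
  proof (rule ac_fundamental_theorem[OF ab(2) sub ac N(1)])
    fix x assume "x \<in> {a..b} - N"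
    then have "x \<in> {0..1} - N" using ab by auto
    then show "(der j y has_vector_derivative der (Suc j) y x) (at x within {a..b})"
      using has_vector_derivative_within_subset[OF N(2) sub] by blast
  qed
qed

text \<open>Integration by parts, once for each derivative: the boundary terms vanish, and each step lowers the
  degree of \<open>q\<close> by one.\<close>

lemma sobolev0_orthogonal:
  assumes y: "y \<in> sobolev0 n" and m: "m \<le> n" and q: "degree q < m"
  shows "((\<lambda>x. der m y x * poly q x) has_integral 0) {0..1}"
  using m q
proof (induction m arbitrary: q)
  case (Suc m)
  then have m: "m < n" by simp
  obtain N where N: "negligible N"
    "\<And>x. x \<in> {0..1} - N \<Longrightarrow> (der m y has_vector_derivative der (Suc m) y x) (at x within {0..1})"
    using sobolev0_der_negligible[OF y m] by blast
  have ac: "absolutely_continuous_on {0..1} (der m y)" and z: "der m y 0 = 0" "der m y 1 = 0"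
    using y m by (auto simp: sobolev0_def)
  have I1: "((\<lambda>x. der (Suc m) y x * poly q x + der m y x * poly (pderiv q) x) has_integral
     (der m y 1 * poly q 1 - der m y 0 * poly q 0)) {0..1}"
  proof (rule ac_fundamental_theorem[OF _ order_refl ac_mult[OF ac ac_poly] N(1)])
    fix x assume x: "x \<in> {0..1} - N"
    have "(poly q has_vector_derivative poly (pderiv q) x) (at x within {0..1})"
      by (meson poly_DERIV has_field_derivative_at_within has_real_derivative_iff_has_vector_derivative)
    then show "((\<lambda>x. der m y x * poly q x) has_vector_derivative
       der (Suc m) y x * poly q x + der m y x * poly (pderiv q) x) (at x within {0..1})"
      using has_vector_derivative_mult[OF N(2)[OF x]] by (simp add: add.commute)
  qed simp
  have I2: "((\<lambda>x. der m y x * poly (pderiv q) x) has_integral 0) {0..1}"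
  proof (cases "degree q = 0")
    case True
    then have "pderiv q = 0" by (simp add: pderiv_eq_0_iff)
    then show ?thesis by simp
  next
    case False
    then have "degree (pderiv q) < m" using Suc.prems by (simp add: degree_pderiv)
    then show ?thesis using Suc by simp
  qed
  show ?case using has_integral_diff[OF I1 I2] z by simp
qed simp

section \<open>Divided differences and polynomials interpolating a step\<close>

lemma prod_diff_swap: "(\<Prod>i\<in>I. a - f i) = (-1) ^ card I * (\<Prod>i\<in>I. f i - (a::real))"
proof -
  have "(\<Prod>i\<in>I. a - f i) = (\<Prod>i\<in>I. (-1) * (f i - a))" by simp
  then show ?thesis unfolding prod.distrib by simp
qed

lemma interpolation_exists:
  fixes v :: "real \<Rightarrow> real"
  assumes "finite S"
  obtains p where "degree p \<le> card S - 1" "\<And>x. x \<in> S \<Longrightarrow> poly p x = v x"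
proof -
  have "\<exists>p. degree p \<le> card S - 1 \<and> (\<forall>x\<in>S. poly p x = v x)" using assms
  proof (induction S)
    case empty show ?case by (intro exI[of _ 0]) auto
  next
    case (insert a S)
    then obtain p where p: "degree p \<le> card S - 1" "\<forall>x\<in>S. poly p x = v x" by blast
    define M where "M = (\<Prod>x\<in>S. [:-x, 1:])"
    have M0: "poly M x = 0" if "x \<in> S" for x using that insert(1) by (auto simp: M_def poly_prod)
    have Ma: "poly M a \<noteq> 0" using insert(1,2) by (auto simp: M_def poly_prod)
    have dM: "degree M = card S" unfolding M_def by (subst degree_prod_eq_sum_degree) auto
    \<comment> \<open>Newton's step: correct the value at the new point without changing the old ones.\<close>
  define p' where "p' = p + smult ((v a - poly p a) / poly M a) M"
    have "degree p' \<le> card S" unfolding p'_def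
      by (rule degree_add_le) (use p dM degree_smult_le[of _ M] in auto)
    moreover have "\<forall>x\<in>insert a S. poly p' x = v x" using M0 Ma p by (auto simp: p'_def)
    ultimately show ?case using insert by auto
  qed
  then show thesis using that by blast
qed

lemma poly_eq_prod_roots:
  fixes W :: "real poly"
  assumes S: "finite S" and d: "degree W \<le> card S" and W0: "\<And>x. x \<in> S \<Longrightarrow> poly W x = 0"
  shows "W = smult (coeff W (card S)) (\<Prod>x\<in>S. [:-x, 1:])"
proof -
  define M where "M = (\<Prod>x\<in>S. [:-x, 1::real:])"
  have dM: "degree M = card S" unfolding M_def by (subst degree_prod_eq_sum_degree) auto
  have lM: "coeff M (card S) = 1" unfolding dM[symmetric]
    by (simp add: M_def lead_coeff_prod)
  define R where "R = W - smult (coeff W (card S)) M"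
  have dR: "degree R \<le> card S" unfolding R_def
    by (rule degree_diff_le) (use d dM degree_smult_le[of _ M] in auto)
  have cR: "coeff R (card S) = 0" by (simp add: R_def lM)
  have "R = 0"
  proof (rule ccontr)
    assume "R \<noteq> 0"
    then have "degree R < card S" using dR cR by (metis leading_coeff_0_iff le_neq_implies_less)
    moreover have "S \<subseteq> {x. poly R x = 0}" using S W0 by (auto simp: R_def M_def poly_prod)
    then have "card S \<le> card {x. poly R x = 0}" by (intro card_mono poly_roots_finite \<open>R \<noteq> 0\<close>)
    ultimately show False using card_poly_roots_bound[OF \<open>R \<noteq> 0\<close>] by linarith
  qed
  then show ?thesis by (simp add: R_def M_def)
qed

lemma pderiv_at_root:
  fixes W :: "real poly"
  assumes S: "finite S" "card S = Suc m" and W: "degree W \<le> Suc m" "\<And>x. x \<in> S \<Longrightarrow> poly W x = 0"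
    and x: "x \<in> S"
  shows "poly (pderiv W) x = coeff W (Suc m) * (\<Prod>y\<in>S-{x}. x - y)"
proof -
  have "W = smult (coeff W (Suc m)) (\<Prod>x\<in>S. [:-x, 1:])"
    using poly_eq_prod_roots[OF S(1)] W S(2) by metis
  also have "(\<Prod>x\<in>S. [:-x, 1:]) = [:-x, 1:] * (\<Prod>y\<in>S-{x}. [:-y, 1:])"
    using S(1) x by (rule prod.remove)
  finally have "pderiv W = smult (coeff W (Suc m)) (pderiv ([:-x, 1:] * (\<Prod>y\<in>S-{x}. [:-y, 1:])))"
    by (metis pderiv_smult)
  then have "poly (pderiv W) x = coeff W (Suc m) * (poly [:-x, 1:] x * poly (pderiv (\<Prod>y\<in>S-{x}. [:-y, 1:])) x
      + poly (\<Prod>y\<in>S-{x}. [:-y, 1:]) x * poly (pderiv [:-x, 1:]) x)"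
    by (simp only: poly_smult pderiv_mult poly_add poly_mult)
  then show ?thesis by (simp add: pderiv_pCons poly_prod)
qed

text \<open>Up to the factor \<open>coeff W (Suc m)\<close> the left-hand side is the divided difference of \<open>q\<close> at the points of \<open>S\<close>: compare
  the coefficients of degree \<open>m\<close> in Lagrange's interpolation formula.\<close>

lemma sum_over_roots:
  fixes W q :: "real poly"
  assumes S: "finite S" "card S = Suc m" and W: "degree W \<le> Suc m" "\<And>x. x \<in> S \<Longrightarrow> poly W x = 0"
    and W0: "coeff W (Suc m) \<noteq> 0" and q: "degree q \<le> m"
  shows "(\<Sum>x\<in>S. poly q x / poly (pderiv W) x) = coeff q m / coeff W (Suc m)"
proof -
  define c where "c = coeff W (Suc m)"
  define M where "M x = (\<Prod>y\<in>S-{x}. [:-y, 1::real:])" for x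
  have dM: "degree (M x) = m" if "x \<in> S" for x
    unfolding M_def by (subst degree_prod_eq_sum_degree) (use S that in auto)
  have lM: "coeff (M x) m = 1" if "x \<in> S" for x
    unfolding dM[OF that, symmetric] by (simp add: M_def lead_coeff_prod)
  have M0: "poly (M x) y = 0" if "x \<in> S" "y \<in> S" "y \<noteq> x" for x y
    using that S(1) by (auto simp: M_def poly_prod)
  have Mx: "poly (M x) x \<noteq> 0" "poly (pderiv W) x = c * poly (M x) x" if "x \<in> S" for x
    using pderiv_at_root[OF S W that] S(1) by (auto simp: M_def poly_prod c_def)
  define L where "L = (\<Sum>x\<in>S. smult (poly q x / poly (M x) x) (M x))"
  have "q - L = 0"
  proof (rule ccontr)
    assume nz: "q - L \<noteq> 0"
    have "degree L \<le> m" unfolding L_def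
      by (rule degree_sum_le[OF S(1)]) (use dM degree_smult_le[of _ "M _"] in auto)
    then have "degree (q - L) \<le> m" using q by (intro degree_diff_le)
    moreover have "poly (q - L) x = 0" if "x \<in> S" for x
    proof -
      have "poly L x = (\<Sum>y\<in>S. if y = x then poly q x else 0)"
        unfolding L_def poly_sum by (rule sum.cong) (use M0 Mx that in auto)
      then show ?thesis using S(1) that by simp
    qed
    then have "card S \<le> card {x. poly (q - L) x = 0}"
      by (intro card_mono poly_roots_finite nz) auto
    ultimately show False using card_poly_roots_bound[OF nz] S(2) by linarith
  qed
  then have "coeff q m = coeff L m" by simp
  also have "\<dots> = (\<Sum>x\<in>S. poly q x / poly (M x) x)"
    unfolding L_def coeff_sum by (rule sum.cong) (use lM in auto)
  also have "\<dots> = c * (\<Sum>x\<in>S. poly q x / poly (pderiv W) x)"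
    unfolding sum_distrib_left by (rule sum.cong) (use Mx W0 in \<open>auto simp: c_def\<close>)
  finally show ?thesis using W0 by (simp add: c_def)
qed

text \<open>Rolle's theorem in each gap between neighbouring points, in a form suited to counting roots.\<close>

lemma rolle_roots:
  fixes p :: "real poly"
  assumes "finite S" "\<And>x. x \<in> S \<Longrightarrow> poly p x = v"
  obtains Z where "finite Z" "card Z = card S - 1"
    "\<And>z. z \<in> Z \<Longrightarrow> poly (pderiv p) z = 0 \<and> z \<notin> S \<and> (\<exists>a\<in>S. \<exists>b\<in>S. a < z \<and> z < b)"
proof -
  have "\<exists>Z. finite Z \<and> card Z = card S - 1 \<and>
    (\<forall>z\<in>Z. poly (pderiv p) z = 0 \<and> z \<notin> S \<and> (\<exists>a\<in>S. \<exists>b\<in>S. a < z \<and> z < b))"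
    using assms
  proof (induction S rule: finite_linorder_max_induct)
    case empty
    show ?case by (intro exI[of _ "{}"]) auto
  next
    case (insert b S)
    show ?case
    proof (cases "S = {}")
      case True
      show ?thesis by (intro exI[of _ "{}"]) (use True in auto)
    next
      case False
      obtain Z where Z: "finite Z" "card Z = card S - 1"
        "\<forall>z\<in>Z. poly (pderiv p) z = 0 \<and> z \<notin> S \<and> (\<exists>a\<in>S. \<exists>b\<in>S. a < z \<and> z < b)"
        using insert by auto
      define a where "a = Max S"
      have a: "a \<in> S" "a < b" "\<And>x. x \<in> S \<Longrightarrow> x \<le> a" using insert False by (auto simp: a_def)
      obtain z where z: "a < z" "z < b" "poly (pderiv p) z = 0"
      proof -
        obtain z where "a < z" "z < b" "poly p b - poly p a = (b - a) * poly (pderiv p) z"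
          using poly_MVT[OF \<open>a < b\<close>] by blast
        then show thesis using insert.prems a that by auto
      qed
      have "z \<notin> Z" "b \<notin> Z" using Z(3) a(3) z(1) a(2) by force+
      moreover have "z \<notin> S" "b \<notin> S" using a z by force+
      moreover have "card S > 0" using False insert(1) by auto
      ultimately show ?thesis
        by (intro exI[of _ "insert z Z"]) (use Z z a insert(1) in auto)
    qed
  qed
  then show thesis using that by blast
qed

lemma factor_out_roots:
  fixes f :: "real poly"
  assumes "finite S" "\<And>x. x \<in> S \<Longrightarrow> poly f x = 0"
  obtains s where "f = (\<Prod>x\<in>S. [:-x, 1:]) * s"
proof -
  have "(\<Prod>x\<in>S. [:-x, 1:]) dvd f" using assms
  proof (induction S)
    case (insert a S)
    then obtain s where s: "f = (\<Prod>x\<in>S. [:-x, 1:]) * s" by (auto elim: dvdE)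
    have "poly f a = 0" using insert by simp
    then have "poly s a = 0" using insert(1,2) by (auto simp: s poly_prod)
    then obtain r where r: "s = [:-a, 1:] * r" unfolding poly_eq_0_iff_dvd by (elim dvdE)
    have "f = ([:-a, 1:] * (\<Prod>x\<in>S. [:-x, 1:])) * r" unfolding s r by (simp only: mult_ac)
    then show ?case unfolding prod.insert[OF insert(1,2)] by (simp only: dvd_triv_left)
  qed simp
  then show thesis using that by (auto elim: dvdE)
qed

lemma rolle_roots_two:
  fixes p :: "real poly"
  assumes fin: "finite A" "finite C" and less: "\<And>a c. a \<in> A \<Longrightarrow> c \<in> C \<Longrightarrow> a < c"
    and p: "\<And>a. a \<in> A \<Longrightarrow> poly p a = v" "\<And>c. c \<in> C \<Longrightarrow> poly p c = w"
  obtains Z where "finite Z" "card Z = (card A - 1) + (card C - 1)"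
    "\<And>z. z \<in> Z \<Longrightarrow> poly (pderiv p) z = 0 \<and> z \<notin> A \<and> z \<notin> C \<and>
       ((\<exists>a\<in>A. \<exists>b\<in>A. a < z \<and> z < b) \<or> (\<exists>a\<in>C. \<exists>b\<in>C. a < z \<and> z < b))"
proof -
  obtain ZA where ZA: "finite ZA" "card ZA = card A - 1"
    "\<And>z. z \<in> ZA \<Longrightarrow> poly (pderiv p) z = 0 \<and> z \<notin> A \<and> (\<exists>a\<in>A. \<exists>b\<in>A. a < z \<and> z < b)"
    using rolle_roots[OF fin(1) p(1)] by blast
  obtain ZC where ZC: "finite ZC" "card ZC = card C - 1"
    "\<And>z. z \<in> ZC \<Longrightarrow> poly (pderiv p) z = 0 \<and> z \<notin> C \<and> (\<exists>a\<in>C. \<exists>b\<in>C. a < z \<and> z < b)"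
    using rolle_roots[OF fin(2) p(2)] by blast
  have sep: "z \<notin> C \<and> z \<notin> ZC" if z: "z \<in> ZA" for z
  proof -
    obtain a where a: "a \<in> A" "z < a" using ZA(3)[OF z] by blast
    show ?thesis using less[OF a(1)] a(2) ZC(3)[of z] by (meson less_asym less_trans)
  qed
  have sep': "z \<notin> A" if z: "z \<in> ZC" for z
  proof
    assume "z \<in> A"
    obtain c where "c \<in> C" "c < z" using ZC(3)[OF z] by blast
    then show False using less[OF \<open>z \<in> A\<close>, of c] by linarith
  qed
  show thesis
  proof (rule that[of "ZA \<union> ZC"])
    show "card (ZA \<union> ZC) = (card A - 1) + (card C - 1)"
      using sep ZA(1,2) ZC(1,2) by (subst card_Un_disjoint) auto
  qed (use ZA(1,3) ZC(1,3) sep sep' in auto)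
qed

text \<open>The interpolant of a downward step from \<open>1\<close> on \<open>A\<close> to \<open>0\<close> on \<open>C\<close>. Its derivative has degree at most
  \<open>card A + card C - 2\<close>, and Rolle's theorem already produces that many roots inside the hulls of
  \<open>A\<close> and \<open>C\<close>. So there are no others, which forces all the sign patterns below.\<close>

locale step_interpolant =
  fixes A C :: "real set" and p :: "real poly"
  assumes fin: "finite A" "finite C" and ne: "A \<noteq> {}" "C \<noteq> {}"
    and less: "\<And>a b. a \<in> A \<Longrightarrow> b \<in> C \<Longrightarrow> a < b"
    and pA: "\<And>a. a \<in> A \<Longrightarrow> poly p a = 1" and pB: "\<And>b. b \<in> C \<Longrightarrow> poly p b = 0"
    and deg: "degree p \<le> card A + card C - 1"
begin

lemma pderiv_nz: "pderiv p \<noteq> 0"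
proof
  assume "pderiv p = 0"
  then have "degree p = 0" by (simp add: pderiv_eq_0_iff)
  then obtain c where "p = [:c:]" by (auto elim: degree_eq_zeroE)
  then show False using ne pA pB by auto
qed

lemma no_more_roots:
  assumes "finite Z" "\<And>z. z \<in> Z \<Longrightarrow> poly (pderiv p) z = 0"
  shows "card Z \<le> card A + card C - 2"
proof -
  have "card Z \<le> card {x. poly (pderiv p) x = 0}"
    using assms by (intro card_mono poly_roots_finite pderiv_nz) auto
  also have "\<dots> \<le> degree (pderiv p)" by (rule card_poly_roots_bound[OF pderiv_nz])
  finally show ?thesis using deg by (simp add: degree_pderiv)
qed

lemma card_pos: "card A > 0" "card C > 0" using fin ne by auto

lemma pderiv_root:
  assumes z: "poly (pderiv p) z = 0"
  shows "z \<notin> A \<and> z \<notin> C \<and> ((\<exists>a\<in>A. \<exists>b\<in>A. a < z \<and> z < b) \<or> (\<exists>a\<in>C. \<exists>b\<in>C. a < z \<and> z < b))"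
proof -
  obtain Z where Z: "finite Z" "card Z = (card A - 1) + (card C - 1)"
    "\<And>z. z \<in> Z \<Longrightarrow> poly (pderiv p) z = 0 \<and> z \<notin> A \<and> z \<notin> C \<and>
       ((\<exists>a\<in>A. \<exists>b\<in>A. a < z \<and> z < b) \<or> (\<exists>a\<in>C. \<exists>b\<in>C. a < z \<and> z < b))"
    using rolle_roots_two[OF fin less pA pB] by blast
  have "z \<in> Z"
  proof (rule ccontr)
    assume "z \<notin> Z"
    then have "card (insert z Z) = card A + card C - 1" using Z(1,2) card_pos by simp
    moreover have "card (insert z Z) \<le> card A + card C - 2"
      by (rule no_more_roots) (use z Z in auto)
    ultimately show False using card_pos by linarith
  qed
  then show ?thesis using Z(3) by blast
qed

text \<open>A further point with value \<open>1\<close> would give the derivative one root too many.\<close>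

lemma value_one_imp_mem:
  assumes x: "poly p x = 1" "\<And>b. b \<in> C \<Longrightarrow> x \<le> b"
  shows "x \<in> A"
proof (rule ccontr)
  assume xA: "x \<notin> A"
  have "x < b" if "b \<in> C" for b using x(2)[OF that] pB[OF that] x(1) by (cases "x = b") auto
  then have less': "a < b" if "a \<in> insert x A" "b \<in> C" for a b using less that by auto
  have p1: "poly p a = 1" if "a \<in> insert x A" for a using that x(1) pA by auto
  obtain Z where Z: "finite Z" "card Z = (card (insert x A) - 1) + (card C - 1)"
    "\<And>z. z \<in> Z \<Longrightarrow> poly (pderiv p) z = 0"
    by (rule rolle_roots_two[OF finite.insertI[OF fin(1)] fin(2) less' p1 pB])
       (assumption | rule that | blast)+
  have "card Z = card A + card C - 1" using Z(2) xA fin card_pos by simp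
  moreover have "card Z \<le> card A + card C - 2" by (rule no_more_roots[OF Z(1,3)])
  ultimately show False using card_pos by linarith
qed

text \<open>The quotient of \<open>1 - p\<close> by the linear factors of \<open>A\<close> has no root to the left of \<open>C\<close>: a root outside \<open>A\<close> contradicts
  \<open>value_one_imp_mem\<close>, and a root in \<open>A\<close> would be a double root of \<open>1 - p\<close>. So its sign is the one at \<open>Min C\<close>.\<close>

lemma left_sign:
  assumes x: "\<And>b. b \<in> C \<Longrightarrow> x \<le> b"
  shows "(1 - poly p x) * (\<Prod>a\<in>A. x - a) \<ge> 0"
proof -
  obtain s where s: "1 - p = (\<Prod>a\<in>A. [:-a, 1:]) * s"
    using factor_out_roots[OF fin(1), of "1 - p"] pA by auto
  have sx: "1 - poly p y = (\<Prod>a\<in>A. y - a) * poly s y" for y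
    using arg_cong[OF s, of "\<lambda>q. poly q y"] by (simp add: poly_prod)
  have nz: "poly s y \<noteq> 0" if y: "\<And>b. b \<in> C \<Longrightarrow> y \<le> b" for y
  proof
    assume s0: "poly s y = 0"
    then have yA: "y \<in> A" using value_one_imp_mem[of y] sx[of y] y by simp
    have "pderiv (1 - p) = pderiv ((\<Prod>a\<in>A. [:-a, 1:]) * s)" using s by simp
    then have "poly (pderiv (1 - p)) y = 0" using s0 yA fin(1)
      by (auto simp: pderiv_mult poly_prod)
    then have "poly (pderiv p) y = 0" by (simp add: pderiv_diff)
    then show False using pderiv_root yA by blast
  qed
  define c where "c = Min C"
  have c: "c \<in> C" "\<And>b. b \<in> C \<Longrightarrow> c \<le> b" using fin ne by (auto simp: c_def)
  have "(\<Prod>a\<in>A. c - a) * poly s c = 1" using sx[of c] pB[OF c(1)] by simp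
  moreover have "(\<Prod>a\<in>A. c - a) > 0" by (rule prod_pos) (use less c in auto)
  ultimately have sc: "poly s c > 0" by (metis zero_less_mult_pos zero_less_one)
  have "poly s x > 0"
  proof (rule ccontr)
    assume "\<not> poly s x > 0"
    then have neg: "poly s x < 0" using nz[OF x] by force
    have "x \<noteq> c" using neg sc by auto
    then have "x < c" using x[OF c(1)] by simp
    then obtain y where "x < y" "y < c" "poly s y = 0"
      using poly_IVT_pos[OF _ neg sc] by blast
    then show False using nz[of y] c(2) by force
  qed
  then show ?thesis unfolding sx by (simp add: mult_ac)
qed

text \<open>The derivative has no root here, so its sign is constant; it must agree with the sign of \<open>1 - p\<close> to the
  left of \<open>Min A\<close>, where \<open>p = 1\<close>.\<close>

lemma left_pderiv_sign:
  assumes x: "\<And>a. a \<in> A \<Longrightarrow> x \<le> a"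
  shows "(-1) ^ card A * poly (pderiv p) x > 0"
proof -
  define a where "a = Min A"
  have a: "a \<in> A" "\<And>b. b \<in> A \<Longrightarrow> a \<le> b" using fin ne by (auto simp: a_def)
  define r where "r = smult ((-1) ^ card A) p"
  have nz: "poly (pderiv r) y \<noteq> 0" if "y \<le> a" for y
  proof
    assume "poly (pderiv r) y = 0"
    then have "poly (pderiv p) y = 0" by (auto simp: r_def pderiv_smult)
    then obtain z where "z \<in> A \<union> C" "z < y" using pderiv_root[of y] by blast
    then have "z < a" "z \<in> A \<union> C" using that by auto
    then show False using a less[of a z] by force
  qed
  have "poly (pderiv r) x > 0"
  proof (rule ccontr)
    assume "\<not> poly (pderiv r) x > 0"
    then have neg: "poly (pderiv r) x < 0" using nz[of x] x a by force
    have negall: "poly (pderiv r) y < 0" if "y \<le> a" for y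
    proof (rule ccontr)
      assume "\<not> poly (pderiv r) y < 0"
      then have pos: "poly (pderiv r) y > 0" using nz[OF that] by force
      consider "x < y" | "y < x" using pos neg by (cases x y rule: linorder_cases) auto
      then obtain z where "z < max x y" "poly (pderiv r) z = 0"
        using poly_IVT_pos[OF _ neg pos] poly_IVT_neg[OF _ pos neg] by cases force+
      then show False using nz[of z] that x[OF a(1)] by auto
    qed
    obtain z where z: "a - 1 < z" "z < a" "poly r a - poly r (a - 1) = (a - (a - 1)) * poly (pderiv r) z"
      using poly_MVT[of "a - 1" a r] by auto
    then have "poly r a < poly r (a - 1)" using negall[of z] by simp
    then have 1: "(-1) ^ card A * (1 - poly p (a - 1)) < 0"
      using pA[OF a(1)] by (simp add: r_def algebra_simps)
    have "(1 - poly p (a - 1)) * (\<Prod>b\<in>A. (a - 1) - b) \<ge> 0"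
      by (rule left_sign) (use a less in force)
    moreover note prod_diff_swap[of "a - 1" "\<lambda>b. b" A]
    moreover have "(\<Prod>b\<in>A. b - (a - 1)) > 0" by (rule prod_pos) (use a in force)
    ultimately have "(-1) ^ card A * (1 - poly p (a - 1)) * (\<Prod>b\<in>A. b - (a - 1)) \<ge> 0"
      by (simp add: mult_ac)
    then show False using mult_neg_pos[OF 1 \<open>(\<Prod>b\<in>A. b - (a - 1)) > 0\<close>] by linarith
  qed
  then show ?thesis by (simp add: r_def pderiv_smult)
qed

end

text \<open>Reflection at the origin exchanges the two sides of the step, and with them the statements
  about the left and the right.\<close>

lemma step_interpolant_reflect:
  assumes "step_interpolant A C p"
  shows "step_interpolant (uminus ` C) (uminus ` A) (1 - pcompose p [:0, -1:])"
proof -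
  interpret step_interpolant A C p by fact
  have "degree (1 - pcompose p [:0, -1:]) \<le> degree p"
    by (rule degree_diff_le) (auto simp: degree_pcompose)
  moreover have "card (uminus ` A) = card A" "card (uminus ` C) = card C"
    by (auto intro!: card_image simp: inj_on_def)
  ultimately show ?thesis
    by unfold_locales (use fin ne less pA pB deg in \<open>auto simp: poly_pcompose\<close>)
qed

context step_interpolant begin

lemma right_sign:
  assumes x: "\<And>a. a \<in> A \<Longrightarrow> a \<le> x"
  shows "poly p x * (\<Prod>b\<in>C. b - x) \<ge> 0"
proof -
  interpret r: step_interpolant "uminus ` C" "uminus ` A" "1 - pcompose p [:0, -1:]"
    by (rule step_interpolant_reflect) unfold_locales
  have "(\<Prod>a\<in>uminus ` C. -x - a) = (\<Prod>b\<in>C. b - x)"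
    by (subst prod.reindex) (auto simp: inj_on_def intro!: prod.cong)
  moreover have "-x \<le> b" if "b \<in> uminus ` A" for b using x that by auto
  ultimately show ?thesis using r.left_sign[of "-x"] by (simp add: poly_pcompose)
qed

lemma right_pderiv_sign:
  assumes x: "\<And>b. b \<in> C \<Longrightarrow> b \<le> x"
  shows "(-1) ^ card C * poly (pderiv p) x > 0"
proof -
  interpret r: step_interpolant "uminus ` C" "uminus ` A" "1 - pcompose p [:0, -1:]"
    by (rule step_interpolant_reflect) unfold_locales
  have "card (uminus ` C) = card C" by (auto intro!: card_image simp: inj_on_def)
  moreover have "pderiv [:0, -1::real:] = [:-1:]" by (simp add: pderiv_pCons)
  moreover have "-x \<le> b" if "b \<in> uminus ` C" for b using x that by auto
  ultimately show ?thesis using r.left_pderiv_sign[of "-x"]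
    by (simp add: poly_pcompose pderiv_diff pderiv_pcompose)
qed

lemma lead_coeff_sign: "(-1) ^ card C * coeff (pderiv p) (card A + card C - 2) > 0"
proof -
  obtain Z where Z: "card Z = (card A - 1) + (card C - 1)" "\<And>z. z \<in> Z \<Longrightarrow> poly (pderiv p) z = 0"
    by (rule rolle_roots_two[OF fin less pA pB]) (assumption | rule that | blast)+
  have "Z \<subseteq> {x. poly (pderiv p) x = 0}" using Z(2) by blast
  then have "card Z \<le> degree (pderiv p)"
    by (rule order_trans[OF card_mono[OF poly_roots_finite[OF pderiv_nz]] card_poly_roots_bound[OF pderiv_nz]])
  moreover have "card Z = card A + card C - 2" using Z(1) card_pos by simp
  moreover have "degree (pderiv p) \<le> card A + card C - 2" using deg by (simp add: degree_pderiv)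
  ultimately have d: "degree (pderiv p) = card A + card C - 2" by simp
  define r where "r = smult ((-1) ^ card C) (pderiv p)"
  have lr: "lead_coeff r = (-1) ^ card C * coeff (pderiv p) (card A + card C - 2)"
    by (simp add: r_def d[symmetric])
  have "lead_coeff r > 0"
  proof (rule ccontr)
    assume "\<not> lead_coeff r > 0"
    moreover have "lead_coeff r \<noteq> 0" using pderiv_nz by (simp add: r_def)
    ultimately have "lead_coeff r < 0" by linarith
    then have "lead_coeff (- r) > 0" by simp
    then obtain m where m: "\<And>x. x \<ge> m \<Longrightarrow> poly (- r) x \<ge> lead_coeff (- r)" using poly_pinfty_gt_lc by blast
    have "poly (- r) (max m (Max C)) > 0" using m[of "max m (Max C)"] \<open>lead_coeff (- r) > 0\<close> by simp
    moreover have "poly r (max m (Max C)) > 0"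
      unfolding r_def using right_pderiv_sign[of "max m (Max C)"] fin by (simp add: le_max_iff_disj)
    ultimately show False by simp
  qed
  then show ?thesis using lr by simp
qed

end

section \<open>A one-parameter family of knots\<close>

definition phase :: "nat \<Rightarrow> nat \<Rightarrow> real \<Rightarrow> real" where
  "phase n i u = (real n + 1) * u - real i * (pi / 2)"

definition gap :: "nat \<Rightarrow> nat \<Rightarrow> real set" where
  "gap n i = {u. 0 < phase n i u \<and> phase n i u < pi / 2}"

text \<open>The substitution \<open>x = (sin u)\<^sup>2\<close> maps \<open>[0, \<pi>/2]\<close> to \<open>[0,1]\<close>. With \<open>z = exp (2 \<i> u)\<close> and
  \<open>r = (1 - t) / (1 + t)\<close> the solutions of \<open>level n i u = t\<close> are the points where
  \<open>z\<^sup>n\<^sup>+\<^sup>1 (z - r) / (1 - r z) = (-1)\<^sup>i\<^sup>+\<^sup>1\<close>, so its imaginary part changes sign at the knots; \<open>r = 1\<close> and \<open>r = -1\<close> give the zeros of the Chebyshev polynomial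
  of the second kind, which are the nodes.\<close>

definition level :: "nat \<Rightarrow> nat \<Rightarrow> real \<Rightarrow> real" where
  "level n i u = tan u * tan (phase n i u)"

definition angle :: "nat \<Rightarrow> nat \<Rightarrow> real \<Rightarrow> real" where
  "angle n i t = (THE u. u \<in> gap n i \<and> level n i u = t)"

definition knot :: "nat \<Rightarrow> nat \<Rightarrow> real \<Rightarrow> real" where
  "knot n i t = (sin (angle n i t))\<^sup>2"

text \<open>The velocity of a knot at \<open>x\<close> at time \<open>t\<close> is \<open>vel n t x\<close>. That its denominator is affine in \<open>x\<close> is what
  makes the curvature computation below possible.\<close>

definition vden :: "nat \<Rightarrow> real \<Rightarrow> real \<Rightarrow> real" where
  "vden n t x = t + (real n + 1) * (x + t\<^sup>2 * (1 - x))"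

definition vel :: "nat \<Rightarrow> real \<Rightarrow> real \<Rightarrow> real" where
  "vel n t x = 2 * x * (1 - x) / vden n t x"

lemma gap_iff: "u \<in> gap n i \<longleftrightarrow>
    pi * real i / (2 * (real n + 1)) < u \<and> u < pi * real (Suc i) / (2 * (real n + 1))"
  by (auto simp: gap_def phase_def field_simps)

lemma gap_range:
  assumes "u \<in> gap n i" "i \<le> n"
  shows "0 < u" "u < pi / 2"
proof -
  have "0 \<le> pi * real i / (2 * (real n + 1))" by simp
  then show "0 < u" using assms(1) unfolding gap_iff by linarith
  have "pi * real (Suc i) / (2 * (real n + 1)) \<le> pi / 2"
    using assms(2) mult_left_mono[of "real (Suc i)" "real n + 1" pi] by (simp add: field_simps)
  then show "u < pi / 2" using assms(1) unfolding gap_iff by linarith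
qed

lemma level_strict_mono:
  assumes "u \<in> gap n i" "u' \<in> gap n i" "i \<le> n" "u < u'"
  shows "level n i u < level n i u'"
proof -
  have p: "phase n i u < phase n i u'" using assms(4) by (simp add: phase_def)
  have "0 < tan u" "tan u < tan u'"
    using tan_gt_zero[of u] tan_monotone[of u u'] gap_range[OF assms(1,3)] gap_range[OF assms(2,3)] assms(4)
    by linarith+
  moreover have "0 < tan (phase n i u)" "tan (phase n i u) < tan (phase n i u')"
    using assms(1,2) p tan_gt_zero[of "phase n i u"] tan_monotone[of "phase n i u" "phase n i u'"]
    unfolding gap_def mem_Collect_eq by linarith+
  ultimately show ?thesis unfolding level_def by (intro mult_strict_mono) auto
qed

lemma level_less_iff:
  assumes "u \<in> gap n i" "u' \<in> gap n i" "i \<le> n"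
  shows "level n i u < level n i u' \<longleftrightarrow> u < u'"
  using level_strict_mono[OF assms] level_strict_mono[OF assms(2,1,3)]
  by (cases u u' rule: linorder_cases) auto

lemma level_pos: "u \<in> gap n i \<Longrightarrow> i \<le> n \<Longrightarrow> level n i u > 0"
  unfolding level_def using gap_range[of u n i] by (intro mult_pos_pos tan_gt_zero) (simp_all add: gap_def)

lemma level_DERIV:
  assumes "u \<in> gap n i" "i \<le> n"
  shows "DERIV (level n i) u :> (1 + (tan u)\<^sup>2) * tan (phase n i u)
     + (real n + 1) * tan u * (1 + (tan (phase n i u))\<^sup>2)"
    and "(1 + (tan u)\<^sup>2) * tan (phase n i u)
     + (real n + 1) * tan u * (1 + (tan (phase n i u))\<^sup>2) > 0"
proof -
  have u: "0 < u" "u < pi / 2" and v: "0 < phase n i u" "phase n i u < pi / 2"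
    using gap_range[OF assms] assms(1) by (simp_all add: gap_def)
  have c: "cos u \<noteq> 0" "cos (phase n i u) \<noteq> 0"
    using u v cos_gt_zero[of u] cos_gt_zero[of "phase n i u"] by auto
  have sec: "inverse ((cos x)\<^sup>2) = 1 + (tan x)\<^sup>2" if "cos x \<noteq> 0" for x :: real
    using tan_sec[OF that] by (simp add: power_inverse)
  have ph: "DERIV (phase n i) u :> real n + 1"
    unfolding phase_def by (auto intro!: derivative_eq_intros)
  have "DERIV (\<lambda>u. tan u * tan (phase n i u)) u :>
     inverse ((cos u)\<^sup>2) * tan (phase n i u) + inverse ((cos (phase n i u))\<^sup>2) * (real n + 1) * tan u"
    by (rule DERIV_mult[OF DERIV_tan[OF c(1)] DERIV_chain2[OF DERIV_tan[OF c(2)] ph]])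
  then show "DERIV (level n i) u :> (1 + (tan u)\<^sup>2) * tan (phase n i u)
     + (real n + 1) * tan u * (1 + (tan (phase n i u))\<^sup>2)"
    unfolding level_def[abs_def] sec[OF c(1)] sec[OF c(2)] by (simp add: mult_ac)
  have "0 < tan u" "0 < tan (phase n i u)" using u v tan_gt_zero by blast+
  then show "(1 + (tan u)\<^sup>2) * tan (phase n i u)
     + (real n + 1) * tan u * (1 + (tan (phase n i u))\<^sup>2) > 0"
    by (intro add_pos_pos[OF mult_pos_pos mult_pos_pos[OF mult_pos_pos]])
      (simp_all add: add_pos_nonneg)
qed

lemma level_surj:
  assumes "t > 0" "i \<le> n"
  obtains u where "u \<in> gap n i" "level n i u = t"
proof -
  define an where "an w = (arctan w + real i * (pi / 2)) / (real n + 1)" for w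
  have ph: "phase n i (an w) = arctan w" for w by (simp add: an_def phase_def)
  have atg: "an w \<in> gap n i" if "w > 0" for w
    using that arctan_ubound[of w] by (simp add: gap_def ph)
  have lv: "level n i (an w) = tan (an w) * w" for w
    by (simp add: level_def ph tan_arctan)
  have mono: "an w \<le> an w'" if "w \<le> w'" for w w'
    using that by (auto simp: an_def arctan_le_iff intro!: divide_right_mono)
  have tmono: "tan (an w) \<le> tan (an w')" if "0 < w" "w \<le> w'" for w w'
  proof -
    have "0 < an w" "an w' < pi / 2" using gap_range[OF atg assms(2)] that by auto
    then show ?thesis using tan_mono_le[of "an w" "an w'"] mono[OF that(2)] by simp
  qed
  define tm where "tm = tan (an 1)"
  have tm: "tm > 0" using gap_range[OF atg assms(2), of 1] tan_gt_zero by (simp add: tm_def)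
  define w1 where "w1 = min 1 (t / tm)"
  define w2 where "w2 = max 1 (t / tm)"
  have w: "w1 > 0" "w2 > 0" "w1 \<le> 1" "1 \<le> w2" "w1 \<le> t / tm" "t / tm \<le> w2"
    using assms tm by (auto simp: w1_def w2_def)
  have "level n i (an w1) \<le> tm * w1" unfolding lv tm_def using tmono[OF w(1,3)] w by (intro mult_right_mono) auto
  also have "\<dots> \<le> tm * (t / tm)" using w tm by (intro mult_left_mono) auto
  finally have 1: "level n i (an w1) \<le> t" using tm by simp
  have "tm * (t / tm) \<le> tm * w2" using w tm by (intro mult_left_mono) auto
  also have "\<dots> \<le> level n i (an w2)" unfolding lv tm_def using tmono[of 1 w2] w by (intro mult_right_mono) auto
  finally have 2: "t \<le> level n i (an w2)" using tm by simp
  have sub: "u \<in> gap n i" if "an w1 \<le> u" "u \<le> an w2" for u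
    using that atg[OF w(1)] atg[OF w(2)] unfolding gap_iff by linarith
  have "\<forall>u. an w1 \<le> u \<and> u \<le> an w2 \<longrightarrow> isCont (level n i) u"
    using level_DERIV(1)[OF sub assms(2)] DERIV_isCont by blast
  then obtain u where "an w1 \<le> u" "u \<le> an w2" "level n i u = t"
    using IVT[of "level n i" "an w1" t "an w2"] 1 2 mono w by force
  then show thesis using that sub by blast
qed

lemma angle_props:
  assumes "t > 0" "i \<le> n"
  shows "angle n i t \<in> gap n i" "level n i (angle n i t) = t"
proof -
  have "\<exists>!u. u \<in> gap n i \<and> level n i u = t"
    using level_surj[OF assms] level_less_iff[OF _ _ assms(2)]
    by (metis less_irrefl linorder_less_linear)
  then have "angle n i t \<in> gap n i \<and> level n i (angle n i t) = t"
    unfolding angle_def by (rule theI')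
  then show "angle n i t \<in> gap n i" "level n i (angle n i t) = t" by auto
qed

lemma angle_level: "u \<in> gap n i \<Longrightarrow> i \<le> n \<Longrightarrow> angle n i (level n i u) = u"
  using angle_props[of "level n i u" i n] level_pos level_less_iff
  by (metis less_irrefl linorder_less_linear)

lemma less_angle_iff: "t > 0 \<Longrightarrow> i \<le> n \<Longrightarrow> u \<in> gap n i \<Longrightarrow> u < angle n i t \<longleftrightarrow> level n i u < t"
  using angle_props[of t i n] level_less_iff by metis

lemma angle_less_iff: "t > 0 \<Longrightarrow> i \<le> n \<Longrightarrow> u \<in> gap n i \<Longrightarrow> angle n i t < u \<longleftrightarrow> t < level n i u"
  using angle_props[of t i n] level_less_iff by metis

lemma angle_tendsto:
  assumes i: "i \<le> n" and F: "\<forall>\<^sub>F t in F. t > 0"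
    and lo: "\<And>u. u \<in> gap n i \<Longrightarrow> u < l \<Longrightarrow> \<forall>\<^sub>F t in F. level n i u < t"
    and hi: "\<And>u. u \<in> gap n i \<Longrightarrow> l < u \<Longrightarrow> \<forall>\<^sub>F t in F. t < level n i u"
    and l: "pi * real i / (2 * (real n + 1)) \<le> l" "l \<le> pi * real (Suc i) / (2 * (real n + 1))"
  shows "(angle n i \<longlongrightarrow> l) F"
proof (rule order_tendstoI)
  fix a assume a: "a < l"
  show "\<forall>\<^sub>F t in F. a < angle n i t"
  proof (cases "a \<in> gap n i")
    case True
    show ?thesis using F lo[OF True a] by eventually_elim (simp add: less_angle_iff i True)
  next
    case False
    show ?thesis using F
    proof eventually_elim
      case (elim t)
      then show ?case using angle_props(1)[OF elim i] False a l unfolding gap_iff by linarith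
    qed
  qed
next
  fix a assume a: "l < a"
  show "\<forall>\<^sub>F t in F. angle n i t < a"
  proof (cases "a \<in> gap n i")
    case True
    show ?thesis using F hi[OF True a] by eventually_elim (simp add: angle_less_iff i True)
  next
    case False
    show ?thesis using F
    proof eventually_elim
      case (elim t)
      then show ?case using angle_props(1)[OF elim i] False a l unfolding gap_iff by linarith
    qed
  qed
qed

lemma gap_ends: "pi * real i / (2 * (real n + 1)) \<le> pi * real (Suc i) / (2 * (real n + 1))"
  by (intro divide_right_mono) auto

lemma angle_at_0:
  assumes i: "i \<le> n"
  shows "(angle n i \<longlongrightarrow> pi * real i / (2 * (real n + 1))) (at_right 0)"
proof (rule angle_tendsto[OF i])
  show "\<forall>\<^sub>F t in at_right 0. (t::real) > 0" by (simp add: eventually_at_right_less)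
  fix u assume u: "u \<in> gap n i"
  show "\<forall>\<^sub>F t in at_right 0. t < level n i u"
    using level_pos[OF u i] eventually_at_right by blast
qed (use gap_ends in \<open>auto simp: gap_iff\<close>)

lemma angle_at_top:
  assumes i: "i \<le> n"
  shows "(angle n i \<longlongrightarrow> pi * real (Suc i) / (2 * (real n + 1))) at_top"
proof (rule angle_tendsto[OF i])
  show "\<forall>\<^sub>F t in at_top. (t::real) > 0" by (rule eventually_gt_at_top)
  fix u assume u: "u \<in> gap n i"
  show "\<forall>\<^sub>F t in at_top. level n i u < t" by (rule eventually_gt_at_top)
qed (use gap_ends in \<open>auto simp: gap_iff\<close>)

lemma angle_isCont:
  assumes i: "i \<le> n" and t: "t > 0"
  shows "isCont (angle n i) t"
  unfolding isCont_def
proof (rule angle_tendsto[OF i])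
  have nh: "(\<lambda>t. t) \<midarrow>t\<rightarrow> t" by (rule tendsto_ident_at)
  show "\<forall>\<^sub>F t in at t. t > 0" using order_tendstoD(1)[OF nh t] .
  fix u assume u: "u \<in> gap n i"
  show "\<forall>\<^sub>F s in at t. level n i u < s" if "u < angle n i t"
    using that less_angle_iff[OF t i u] order_tendstoD(1)[OF nh] by blast
  show "\<forall>\<^sub>F s in at t. s < level n i u" if "angle n i t < u"
    using that angle_less_iff[OF t i u] order_tendstoD(2)[OF nh] by blast
qed (use angle_props(1)[OF t i] in \<open>auto simp: gap_iff\<close>)

lemma knot_at_0: "i \<le> n \<Longrightarrow> (knot n i \<longlongrightarrow> node n i) (at_right 0)"
  unfolding knot_def[abs_def] node_def by (intro tendsto_intros angle_at_0)

lemma knot_at_top: "i \<le> n \<Longrightarrow> (knot n i \<longlongrightarrow> node n (Suc i)) at_top"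
  unfolding knot_def[abs_def] node_def by (intro tendsto_intros angle_at_top)

lemma knot_range:
  assumes "t > 0" "i \<le> n" shows "0 < knot n i t" "knot n i t < 1"
proof -
  note u = gap_range[OF angle_props(1)[OF assms] assms(2)]
  have s: "sin (angle n i t) > 0" "cos (angle n i t) > 0" using u sin_gt_zero2 cos_gt_zero by blast+
  then show "0 < knot n i t" by (simp add: knot_def)
  have "0 < (cos (angle n i t))\<^sup>2" using s by simp
  then show "knot n i t < 1" unfolding knot_def by (simp add: cos_squared_eq)
qed

lemma sin_sq_less:
  assumes "0 \<le> u" "u < v" "v \<le> pi / 2" shows "(sin u)\<^sup>2 < (sin v :: real)\<^sup>2"
proof -
  have "sin u < sin v" using assms by (intro sin_monotone_2pi) auto
  moreover have "0 \<le> sin u" using assms by (intro sin_ge_zero) auto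
  ultimately show ?thesis by (intro power_strict_mono) auto
qed

lemma node_angle_range: "j \<le> Suc n \<Longrightarrow> 0 \<le> pi * real j / (2 * (real n + 1)) \<and> pi * real j / (2 * (real n + 1)) \<le> pi / 2"
  using mult_left_mono[of "real j" "real n + 1" pi] by (simp add: field_simps)

lemma node_strict_mono: "i < j \<Longrightarrow> j \<le> Suc n \<Longrightarrow> node n i < node n j"
  unfolding node_def using node_angle_range[of j n] node_angle_range[of i n]
  by (intro sin_sq_less divide_strict_right_mono mult_strict_left_mono) auto

lemma knot_between_nodes:
  assumes "t > 0" "i \<le> n" shows "node n i < knot n i t" "knot n i t < node n (Suc i)"
  using angle_props(1)[OF assms] gap_range[OF angle_props(1)[OF assms] assms(2)]
    node_angle_range[of i n] node_angle_range[of "Suc i" n] assms(2)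
  unfolding knot_def node_def gap_iff by (auto intro!: sin_sq_less)

lemma knot_strict_mono:
  assumes "t > 0" "i < j" "j \<le> n" shows "knot n i t < knot n j t"
proof -
  have "knot n i t < node n (Suc i)" using knot_between_nodes[of t i n] assms by simp
  also have "\<dots> \<le> node n j" using node_strict_mono[of "Suc i" j n] assms by (cases "Suc i = j") auto
  also have "\<dots> < knot n j t" using knot_between_nodes[of t j n] assms by simp
  finally show ?thesis .
qed

text \<open>Together with \<open>knot_between_nodes\<close>: the knots of index \<open>i\<close> sweep the whole open gap between two nodes.\<close>

lemma knot_surj:
  assumes i: "i \<le> n" and a: "node n i < a" "a < node n (Suc i)"
  obtains t where "t > 0" "knot n i t = a"
proof -
  have "0 \<le> node n i" "node n (Suc i) \<le> 1" by (simp_all add: node_def abs_square_le_1)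
  then have a01: "0 \<le> a" "a \<le> 1" using a by linarith+
  define u where "u = arcsin (sqrt a)"
  have u: "0 \<le> u" "u \<le> pi / 2" "(sin u)\<^sup>2 = a"
    using a01 arcsin[of "sqrt a"] arcsin_nonneg[of "sqrt a"] order_trans[of "-1" 0 "sqrt a"]
    by (simp_all add: u_def)
  have "u \<in> gap n i" unfolding gap_iff
  proof
    show "pi * real i / (2 * (real n + 1)) < u"
      using a(1) sin_sq_less[of u "pi * real i / (2 * (real n + 1))"] u node_angle_range[of i n] i
      unfolding node_def by (smt (verit) le_SucI)
    show "u < pi * real (Suc i) / (2 * (real n + 1))"
      using a(2) sin_sq_less[of "pi * real (Suc i) / (2 * (real n + 1))" u] u node_angle_range[of "Suc i" n] i
      unfolding node_def by (smt (verit) Suc_le_mono)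
  qed
  then show thesis using that[of "level n i u"] level_pos i angle_level u(3) by (auto simp: knot_def)
qed

lemma vden_pos: "t > 0 \<Longrightarrow> 0 \<le> x \<Longrightarrow> x \<le> 1 \<Longrightarrow> vden n t x > 0"
  unfolding vden_def by (intro add_pos_nonneg mult_nonneg_nonneg add_nonneg_nonneg) auto

text \<open>All quantities at a knot in terms of four sines and cosines, which turns the trigonometric
  identities that follow into algebra.\<close>

lemma knot_relation:
  assumes t: "t > 0" and i: "i \<le> n"
  obtains s c S C where "s > 0" "c > 0" "S > 0" "C > 0" "s\<^sup>2 + c\<^sup>2 = 1" "S\<^sup>2 + C\<^sup>2 = 1"
    "s = sin (angle n i t)" "c = cos (angle n i t)"
    "S = sin (phase n i (angle n i t))" "C = cos (phase n i (angle n i t))"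
    "t = s * S / (c * C)" "knot n i t = s\<^sup>2"
    "vden n t (knot n i t) = s * (S * C + (real n + 1) * s * c) / (c * C\<^sup>2)"
proof -
  note u = gap_range[OF angle_props(1)[OF assms] assms(2)]
  define s c S C where sc: "s = sin (angle n i t)" "c = cos (angle n i t)"
    "S = sin (phase n i (angle n i t))" "C = cos (phase n i (angle n i t))"
  have v: "0 < phase n i (angle n i t)" "phase n i (angle n i t) < pi / 2"
    using angle_props(1)[OF assms] by (simp_all add: gap_def)
  have pos: "s > 0" "c > 0" "S > 0" "C > 0"
    unfolding sc using u v sin_gt_zero2 cos_gt_zero by blast+
  have one: "s\<^sup>2 + c\<^sup>2 = 1" "S\<^sup>2 + C\<^sup>2 = 1" by (auto simp: sc)
  have tt: "t = s * S / (c * C)"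
    using angle_props(2)[OF assms] by (simp add: level_def tan_def sc)
  have k: "knot n i t = s\<^sup>2" by (simp add: knot_def sc)
  have "s\<^sup>2 + t\<^sup>2 * (1 - s\<^sup>2) = s\<^sup>2 / C\<^sup>2"
  proof -
    have "1 - s\<^sup>2 = c\<^sup>2" using one by simp
    then have "s\<^sup>2 + t\<^sup>2 * (1 - s\<^sup>2) = s\<^sup>2 + (s * S / (c * C))\<^sup>2 * c\<^sup>2" using tt by simp
    also have "\<dots> = s\<^sup>2 * (C\<^sup>2 + S\<^sup>2) / C\<^sup>2" using pos by (simp add: field_simps)
    finally show ?thesis using one by (simp add: add.commute)
  qed
  then have "vden n t (knot n i t) = s * S / (c * C) + (real n + 1) * (s\<^sup>2 / C\<^sup>2)"
    unfolding vden_def k using tt by simp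
  also have "\<dots> = s * (S * C + (real n + 1) * s * c) / (c * C\<^sup>2)"
    using pos by (simp add: field_simps power2_eq_square)
  finally show thesis using that[OF pos one sc tt k] by simp
qed

lemma knot_DERIV:
  assumes t: "t > 0" and i: "i \<le> n"
  shows "DERIV (knot n i) t :> vel n t (knot n i t)"
proof -
  obtain s c S C where pos: "s > 0" "c > 0" "S > 0" "C > 0" and one: "s\<^sup>2 + c\<^sup>2 = 1" "S\<^sup>2 + C\<^sup>2 = 1"
    and sc: "s = sin (angle n i t)" "c = cos (angle n i t)"
    "S = sin (phase n i (angle n i t))" "C = cos (phase n i (angle n i t))"
    and k: "t = s * S / (c * C)" "knot n i t = s\<^sup>2"
    "vden n t (knot n i t) = s * (S * C + (real n + 1) * s * c) / (c * C\<^sup>2)"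
    using knot_relation[OF assms] .
  note g = angle_props(1)[OF assms]
  define D where "D = (1 + (tan (angle n i t))\<^sup>2) * tan (phase n i (angle n i t))
     + (real n + 1) * tan (angle n i t) * (1 + (tan (phase n i (angle n i t)))\<^sup>2)"
  have D0: "D > 0" and DD: "DERIV (level n i) (angle n i t) :> D"
    unfolding D_def using level_DERIV[OF g i] by auto
  have "DERIV (angle n i) t :> inverse D"
    by (rule DERIV_inverse_function[where f = "level n i" and a = 0 and b = "t + 1"])
       (use DD D0 t angle_props(2)[OF _ i] angle_isCont[OF i t] in auto)
  then have "DERIV (knot n i) t :> 2 * s * c * inverse D"
    unfolding knot_def[abs_def] sc by (auto intro!: derivative_eq_intros)
  moreover have "2 * s * c * inverse D = vel n t (knot n i t)"
  proof -
    have "D = (1 + (s / c)\<^sup>2) * (S / C) + (real n + 1) * (s / c) * (1 + (S / C)\<^sup>2)"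
      unfolding D_def sc tan_def by simp
    also have "1 + (s / c)\<^sup>2 = 1 / c\<^sup>2" using pos one by (simp add: field_simps)
    also have "1 + (S / C)\<^sup>2 = 1 / C\<^sup>2" using pos one by (simp add: field_simps)
    finally have D: "D = (S * C + (real n + 1) * s * c) / (c\<^sup>2 * C\<^sup>2)"
      using pos by (simp add: field_simps power2_eq_square)
    have P: "S * C + (real n + 1) * s * c > 0" using pos by (simp add: add_pos_pos)
    have cancel: "2 * s\<^sup>2 * c\<^sup>2 / (s * P / (c * C\<^sup>2)) = 2 * s * c * inverse (P / (c\<^sup>2 * C\<^sup>2))" if "P > 0" for P
      using pos that by (simp add: field_simps power2_eq_square)
    have "1 - s\<^sup>2 = c\<^sup>2" using one by simp
    then have "vel n t (knot n i t) = 2 * s\<^sup>2 * c\<^sup>2 / (s * (S * C + (real n + 1) * s * c) / (c * C\<^sup>2))"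
      unfolding vel_def k(3) unfolding k(2) by simp
    then show ?thesis using cancel[OF P, folded D] by simp
  qed
  ultimately show ?thesis by simp
qed

section \<open>The knots as roots of a polynomial\<close>

text \<open>The Chebyshev polynomials of the first and second kind, transplanted to \<open>[0,1]\<close> by \<open>x = (sin u)\<^sup>2\<close>.\<close>

lemma multiple_angle_polys:
  obtains p q :: "real poly" where "degree p \<le> Suc m" "degree q \<le> m"
    "\<And>u. poly p ((sin u)\<^sup>2) = cos (2 * (real m + 1) * u)"
    "\<And>u. poly q ((sin u)\<^sup>2) * sin (2 * u) = sin (2 * (real m + 1) * u)"
proof -
  have "\<exists>p q :: real poly. degree p \<le> Suc m \<and> degree q \<le> m \<and>
    (\<forall>u. poly p ((sin u)\<^sup>2) = cos (2 * (real m + 1) * u)) \<and>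
    (\<forall>u. poly q ((sin u)\<^sup>2) * sin (2 * u) = sin (2 * (real m + 1) * u))"
  proof (induction m)
    case 0
    show ?case by (intro exI[of _ "[:1, -2:]"] exI[of _ "1"]) (simp add: cos_double_sin)
  next
    case (Suc m)
    then obtain p q :: "real poly" where d: "degree p \<le> Suc m" "degree q \<le> m"
      and p: "\<And>u. poly p ((sin u)\<^sup>2) = cos (2 * (real m + 1) * u)"
      and q: "\<And>u. poly q ((sin u)\<^sup>2) * sin (2 * u) = sin (2 * (real m + 1) * u)" by blast
    have a: "2 * (real (Suc m) + 1) * u = 2 * (real m + 1) * u + 2 * u" for u :: real
      by (simp add: algebra_simps)
    have c2: "cos (2 * u) = 1 - 2 * (sin u)\<^sup>2" for u :: real by (rule cos_double_sin)
    have s2: "(sin (2 * u))\<^sup>2 = 4 * (sin u)\<^sup>2 * (1 - (sin u)\<^sup>2)" for u :: real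
      by (simp add: sin_double power_mult_distrib cos_squared_eq)
    define p' where "p' = p * [:1, -2:] - q * [:0, 4, -4:]"
    define q' where "q' = p + q * [:1, -2:]"
    have "degree (p * [:1, -2:]) \<le> Suc (Suc m)"
      by (rule order_trans[OF degree_mult_le]) (use d in auto)
    moreover have "degree (q * [:0, 4, -4:]) \<le> Suc (Suc m)"
      by (rule order_trans[OF degree_mult_le]) (use d in auto)
    ultimately have 1: "degree p' \<le> Suc (Suc m)" unfolding p'_def by (rule degree_diff_le)
    have "degree (q * [:1, -2:]) \<le> Suc m"
      by (rule order_trans[OF degree_mult_le]) (use d in auto)
    then have 2: "degree q' \<le> Suc m" unfolding q'_def using d(1) by (intro degree_add_le)
    have 3: "poly p' ((sin u)\<^sup>2) = cos (2 * (real (Suc m) + 1) * u)" for u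
    proof -
      have "cos (2 * (real (Suc m) + 1) * u) = cos (2 * (real m + 1) * u) * cos (2 * u) - sin (2 * (real m + 1) * u) * sin (2 * u)"
        unfolding a by (rule cos_add)
      also have "\<dots> = poly p ((sin u)\<^sup>2) * (1 - 2 * (sin u)\<^sup>2) - poly q ((sin u)\<^sup>2) * (sin (2 * u))\<^sup>2"
        unfolding p[symmetric] q[symmetric] c2 by (simp add: power2_eq_square)
      also have "\<dots> = poly p' ((sin u)\<^sup>2)" unfolding s2 p'_def by (simp add: algebra_simps)
      finally show ?thesis ..
    qed
    have 4: "poly q' ((sin u)\<^sup>2) * sin (2 * u) = sin (2 * (real (Suc m) + 1) * u)" for u
    proof -
      have "sin (2 * (real (Suc m) + 1) * u) = sin (2 * (real m + 1) * u) * cos (2 * u) + cos (2 * (real m + 1) * u) * sin (2 * u)"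
        unfolding a by (rule sin_add)
      also have "\<dots> = poly q' ((sin u)\<^sup>2) * sin (2 * u)"
        unfolding p[symmetric] q[symmetric] c2 q'_def by (simp add: algebra_simps)
      finally show ?thesis ..
    qed
    show ?case using 1 2 3 4 by blast
  qed
  then show thesis using that by blast
qed

text \<open>In the notation of \<open>level\<close>, \<open>W\<close> is the imaginary part of \<open>z\<^sup>n\<^sup>+\<^sup>1 (z - r) / (1 - r z)\<close> up to factors that do not vanish
  in the open interval. Differentiating at a knot gives exactly the reciprocal of the velocity, with alternating sign.\<close>

lemma knot_polynomial:
  assumes t: "t > 0"
  obtains W :: "real poly" where "degree W \<le> Suc n"
    "\<And>i. i \<le> n \<Longrightarrow> poly W (knot n i t) = 0"
    "\<And>i. i \<le> n \<Longrightarrow> poly (pderiv W) (knot n i t) = (-1) ^ i / vel n t (knot n i t)"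
proof -
  obtain p q :: "real poly" where d: "degree p \<le> Suc n" "degree q \<le> n"
    and p: "\<And>u. poly p ((sin u)\<^sup>2) = cos (2 * (real n + 1) * u)"
    and q: "\<And>u. poly q ((sin u)\<^sup>2) * sin (2 * u) = sin (2 * (real n + 1) * u)"
    using multiple_angle_polys[where m = n] by blast
  define W where "W = q * [:- (t\<^sup>2), 1 + t\<^sup>2:] - smult t p"
  define N where "N = real n + 1"
  have N: "N > 0" by (simp add: N_def)
  have "degree (q * [:- (t\<^sup>2), 1 + t\<^sup>2:]) \<le> Suc n"
    by (rule order_trans[OF degree_mult_le]) (use d in auto)
  moreover have "degree (smult t p) \<le> Suc n" using d degree_smult_le order_trans by blast
  ultimately have dW: "degree W \<le> Suc n" unfolding W_def by (rule degree_diff_le)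
  define R where "R u = sin (2 * N * u) * ((1 + t\<^sup>2) * (sin u)\<^sup>2 - t\<^sup>2) - t * sin (2 * u) * cos (2 * N * u)" for u
  have W: "poly W ((sin u)\<^sup>2) * sin (2 * u) = R u" for u
    unfolding W_def R_def N_def p[symmetric] q[symmetric] by (simp add: algebra_simps)
  have "poly W (knot n i t) = 0 \<and> poly (pderiv W) (knot n i t) = (-1) ^ i / vel n t (knot n i t)"
    if i: "i \<le> n" for i
  proof -
    define u where "u = angle n i t"
    obtain s c S C where pos: "s > 0" "c > 0" "S > 0" "C > 0" and one: "s\<^sup>2 + c\<^sup>2 = 1" "S\<^sup>2 + C\<^sup>2 = 1"
    and sc: "s = sin u" "c = cos u" "S = sin (phase n i u)" "C = cos (phase n i u)"
    and k: "t = s * S / (c * C)" "knot n i t = s\<^sup>2"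
    "vden n t (knot n i t) = s * (S * C + (real n + 1) * s * c) / (c * C\<^sup>2)"
      using knot_relation[OF t i] unfolding u_def .
    have tcC: "t * c * C = s * S" using k(1) pos by simp
    have Nu: "2 * N * u = 2 * phase n i u + real i * pi" by (simp add: phase_def N_def algebra_simps)
    have sN: "sin (2 * N * u) = (-1) ^ i * (2 * S * C)"
      unfolding Nu by (simp add: sin_add sin_double sc mult_ac)
    have cN: "cos (2 * N * u) = (-1) ^ i * (C\<^sup>2 - S\<^sup>2)"
      unfolding Nu by (simp add: cos_add cos_double sc mult_ac)
    have s2: "sin (2 * u) = 2 * s * c" "cos (2 * u) = c\<^sup>2 - s\<^sup>2" by (simp_all add: sin_double cos_double sc)
    have t2: "(1 + t\<^sup>2) * s\<^sup>2 - t\<^sup>2 = s\<^sup>2 * (C\<^sup>2 - S\<^sup>2) / C\<^sup>2"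
    proof -
      have "(1 + t\<^sup>2) * s\<^sup>2 - t\<^sup>2 = s\<^sup>2 - t\<^sup>2 * (1 - s\<^sup>2)" by (simp add: algebra_simps)
      also have "1 - s\<^sup>2 = c\<^sup>2" using one by simp
      also have "s\<^sup>2 - t\<^sup>2 * c\<^sup>2 = s\<^sup>2 * (C\<^sup>2 - S\<^sup>2) / C\<^sup>2" unfolding k(1) using pos by (simp add: field_simps)
      finally show ?thesis .
    qed
    have R0: "R u = 0"
    proof -
      have "R u = (-1) ^ i * (2 * S * C * (s\<^sup>2 * (C\<^sup>2 - S\<^sup>2) / C\<^sup>2) - t * (2 * s * c) * (C\<^sup>2 - S\<^sup>2))"
        unfolding R_def sN cN s2 sc(1)[symmetric] t2 by (simp add: algebra_simps)
      also have "2 * S * C * (s\<^sup>2 * (C\<^sup>2 - S\<^sup>2) / C\<^sup>2) = t * (2 * s * c) * (C\<^sup>2 - S\<^sup>2)"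
        unfolding k(1) using pos by (simp add: field_simps power2_eq_square)
      finally show ?thesis by simp
    qed
    then have W0: "poly W (s\<^sup>2) = 0" using W[of u] s2 sc(1) pos by simp
    define r where "r = (1 + t\<^sup>2) * s\<^sup>2 - t\<^sup>2"
    have D1: "DERIV R u :> 2 * N * cos (2 * N * u) * ((1 + t\<^sup>2) * (sin u)\<^sup>2 - t\<^sup>2)
        + sin (2 * N * u) * ((1 + t\<^sup>2) * (2 * sin u * cos u))
        - t * (2 * cos (2 * u)) * cos (2 * N * u) + t * sin (2 * u) * (2 * N * sin (2 * N * u))"
      unfolding R_def by (rule derivative_eq_intros refl | simp add: algebra_simps)+
    have D2: "DERIV R u :> poly (pderiv W) ((sin u)\<^sup>2) * (2 * sin u * cos u) * sin (2 * u)
       + poly W ((sin u)\<^sup>2) * (2 * cos (2 * u))"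
      unfolding W[symmetric, abs_def]
      by (rule derivative_eq_intros refl poly_DERIV DERIV_chain2[where f = "poly W"] | simp add: algebra_simps)+
    have E: "poly (pderiv W) (s\<^sup>2) * (2 * s * c)\<^sup>2 = (-1) ^ i *
       (2 * N * (C\<^sup>2 - S\<^sup>2) * r
        + 2 * S * C * ((1 + t\<^sup>2) * (2 * s * c)) - t * (2 * (c\<^sup>2 - s\<^sup>2)) * (C\<^sup>2 - S\<^sup>2)
        + t * (2 * s * c) * (2 * N * (2 * S * C)))"
      using DERIV_unique[OF D2 D1] unfolding sN cN s2 sc(1,2)[symmetric] W0 r_def[symmetric]
      by (simp add: algebra_simps power2_eq_square)
    have n1: "2 * N * (C\<^sup>2 - S\<^sup>2) * (s\<^sup>2 * (C\<^sup>2 - S\<^sup>2) / C\<^sup>2) + t * (2 * s * c) * (2 * N * (2 * S * C)) = 2 * N * s\<^sup>2 / C\<^sup>2"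
    proof -
      have "t * (2 * s * c) * (2 * N * (2 * S * C)) = 2 * N * (s\<^sup>2 * (4 * S\<^sup>2 * C\<^sup>2) / C\<^sup>2)"
        unfolding k(1) using pos by (simp add: field_simps power2_eq_square)
      then have "2 * N * (C\<^sup>2 - S\<^sup>2) * (s\<^sup>2 * (C\<^sup>2 - S\<^sup>2) / C\<^sup>2) + t * (2 * s * c) * (2 * N * (2 * S * C))
          = 2 * N * s\<^sup>2 * ((C\<^sup>2 - S\<^sup>2)\<^sup>2 + 4 * S\<^sup>2 * C\<^sup>2) / C\<^sup>2"
        using pos by (simp add: field_simps power2_eq_square)
      also have "(C\<^sup>2 - S\<^sup>2)\<^sup>2 + 4 * S\<^sup>2 * C\<^sup>2 = (S\<^sup>2 + C\<^sup>2)\<^sup>2" by (simp add: power2_eq_square algebra_simps)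
      finally show ?thesis using one by simp
    qed
    have n2: "2 * S * C * ((1 + t\<^sup>2) * (2 * s * c)) - t * (2 * (c\<^sup>2 - s\<^sup>2)) * (C\<^sup>2 - S\<^sup>2) = 2 * t"
    proof -
      have h: "S * s * c * C = t * (c\<^sup>2 * C\<^sup>2)" using tcC by (simp add: power2_eq_square algebra_simps)
      have "2 * S * C * ((1 + t\<^sup>2) * (2 * s * c)) = 4 * (1 + t\<^sup>2) * (S * s * c * C)"
        by (simp add: algebra_simps)
      also have "\<dots> = 4 * t * (c\<^sup>2 * C\<^sup>2 + (t * c * C)\<^sup>2)"
        unfolding h by (simp add: power2_eq_square algebra_simps)
      also have "\<dots> = 4 * t * (c\<^sup>2 * C\<^sup>2 + s\<^sup>2 * S\<^sup>2)" unfolding tcC by (simp add: power_mult_distrib)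
      finally have "2 * S * C * ((1 + t\<^sup>2) * (2 * s * c)) - t * (2 * (c\<^sup>2 - s\<^sup>2)) * (C\<^sup>2 - S\<^sup>2)
         = 2 * t * ((s\<^sup>2 + c\<^sup>2) * (S\<^sup>2 + C\<^sup>2))" by (simp add: algebra_simps)
      then show ?thesis using one by simp
    qed
    have rearr: "w1 + w2 - w3 + w4 = (w1 + w4) + (w2 - w3)" for w1 w2 w3 w4 :: real by simp
    have v: "vden n t (knot n i t) = t + N * s\<^sup>2 / C\<^sup>2"
      unfolding k(3) N_def[symmetric] unfolding k(1) using pos by (simp add: field_simps power2_eq_square)
    then have vp: "vden n t (knot n i t) > 0" using pos N t by (auto intro!: add_pos_pos mult_pos_pos divide_pos_pos)
    have "poly (pderiv W) (s\<^sup>2) * (2 * s * c)\<^sup>2 = (-1) ^ i * (2 * vden n t (knot n i t))"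
      unfolding E r_def t2 v rearr n1 n2 by simp
    then have "poly (pderiv W) (s\<^sup>2) = (-1) ^ i * vden n t (knot n i t) / (2 * s\<^sup>2 * c\<^sup>2)"
      using pos by (simp add: field_simps power_mult_distrib)
    also have "2 * s\<^sup>2 * c\<^sup>2 = 2 * knot n i t * (1 - knot n i t)" using k(2) one by simp
    finally show ?thesis using W0 vp k(2) by (simp add: vel_def)
  qed
  then show thesis using that dW by blast
qed

lemma vel_pos: "t > 0 \<Longrightarrow> i \<le> n \<Longrightarrow> vel n t (knot n i t) > 0"
  unfolding vel_def using knot_range[of t i n] vden_pos[of t "knot n i t" n]
  by (intro divide_pos_pos mult_pos_pos) auto

lemma knot_inj: "t > 0 \<Longrightarrow> inj_on (\<lambda>i. knot n i t) {..n}"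
  by (rule linorder_inj_onI) (use knot_strict_mono in force)+

text \<open>The signed velocities are the weights of a divided difference at the knots.\<close>

lemma knot_weights:
  assumes t: "t > 0"
  obtains w where "(-1) ^ n * w > 0"
    "\<And>q. degree q \<le> n \<Longrightarrow>
       (\<Sum>i\<le>n. (-1) ^ i * vel n t (knot n i t) * poly q (knot n i t)) = coeff q n / w"
    "\<And>k. k \<le> n \<Longrightarrow> (-1) ^ k * vel n t (knot n k t) * (\<Prod>i\<in>{..n}-{k}. knot n k t - knot n i t) = 1 / w"
proof -
  obtain W :: "real poly" where dW: "degree W \<le> Suc n"
    and W0: "\<And>i. i \<le> n \<Longrightarrow> poly W (knot n i t) = 0"
    and W': "\<And>i. i \<le> n \<Longrightarrow> poly (pderiv W) (knot n i t) = (-1) ^ i / vel n t (knot n i t)"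
    using knot_polynomial[OF t, where n = n] by blast
  define S where "S = (\<lambda>i. knot n i t) ` {..n}"
  have S: "finite S" "card S = Suc n" using knot_inj[OF t] by (auto simp: S_def card_image)
  have WS: "poly W x = 0" if "x \<in> S" for x using W0 that by (auto simp: S_def)
  define w where "w = coeff W (Suc n)"
  have prod: "(-1) ^ k / vel n t (knot n k t) = w * (\<Prod>i\<in>{..n}-{k}. knot n k t - knot n i t)" if "k \<le> n" for k
  proof -
    have "poly (pderiv W) (knot n k t) = w * (\<Prod>y\<in>S - {knot n k t}. knot n k t - y)"
      unfolding w_def by (rule pderiv_at_root[OF S dW WS]) (use that in \<open>auto simp: S_def\<close>)
    also have "S - {knot n k t} = (\<lambda>i. knot n i t) ` ({..n} - {k})"
      using knot_inj[OF t, of n] that by (auto simp: S_def inj_on_def)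
    also have "(\<Prod>y\<in>(\<lambda>i. knot n i t) ` ({..n} - {k}). knot n k t - y) = (\<Prod>i\<in>{..n}-{k}. knot n k t - knot n i t)"
      using inj_on_subset[OF knot_inj[OF t, of n], of "{..n} - {k}"] by (subst prod.reindex) auto
    finally show ?thesis using W' that by simp
  qed
  have w0: "w \<noteq> 0" using prod[of 0] vel_pos[OF t, of 0 n] by auto
  show thesis
  proof
    have "0 < w * (\<Prod>i\<in>{..n}-{0}. knot n 0 t - knot n i t)"
      using prod[of 0] vel_pos[OF t, of 0 n] by (metis le0 power_0 zero_less_divide_1_iff)
    also have "(\<Prod>i\<in>{..n}-{0}. knot n 0 t - knot n i t) = (-1) ^ n * (\<Prod>i\<in>{..n}-{0}. knot n i t - knot n 0 t)"
      by (simp add: prod_diff_swap[of "knot n 0 t"])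
    finally have "0 < ((-1) ^ n * w) * (\<Prod>i\<in>{..n}-{0}. knot n i t - knot n 0 t)" by (simp add: mult_ac)
    moreover have "(\<Prod>i\<in>{..n}-{0}. knot n i t - knot n 0 t) > 0"
      by (rule prod_pos) (use knot_strict_mono[OF t, of 0 _ n] in auto)
    ultimately show "(-1) ^ n * w > 0" by (simp add: zero_less_mult_iff)
  next
    fix q :: "real poly" assume q: "degree q \<le> n"
    have "(\<Sum>i\<le>n. (-1) ^ i * vel n t (knot n i t) * poly q (knot n i t))
       = (\<Sum>i\<le>n. poly q (knot n i t) / poly (pderiv W) (knot n i t))"
      by (rule sum.cong) (use W' vel_pos[OF t, of _ n] in \<open>auto simp: field_simps\<close>)
    also have "\<dots> = (\<Sum>x\<in>S. poly q x / poly (pderiv W) x)"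
      unfolding S_def using knot_inj[OF t, of n] by (subst sum.reindex) auto
    also have "\<dots> = coeff q n / w" unfolding w_def
      by (rule sum_over_roots[OF S dW WS _ q]) (use w0 w_def in auto)
    finally show "(\<Sum>i\<le>n. (-1) ^ i * vel n t (knot n i t) * poly q (knot n i t)) = coeff q n / w" .
  next
    fix k assume "k \<le> n"
    have v: "vel n t (knot n k t) > 0" using vel_pos[OF t \<open>k \<le> n\<close>] .
    define P where "P = (\<Prod>i\<in>{..n}-{k}. knot n k t - knot n i t)"
    have "(-1) ^ k = vel n t (knot n k t) * (w * P)"
      using prod[OF \<open>k \<le> n\<close>] v unfolding P_def by (simp add: field_simps)
    then have "(-1) ^ k * (-1) ^ k = (-1) ^ k * vel n t (knot n k t) * P * w" by simp
    moreover have "(-1) ^ k * (-1) ^ k = (1::real)" by (simp flip: power_mult_distrib)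
    ultimately have "1 = (-1) ^ k * vel n t (knot n k t) * P * w" by simp
    then show "(-1) ^ k * vel n t (knot n k t) * (\<Prod>i\<in>{..n}-{k}. knot n k t - knot n i t) = 1 / w"
      using w0 unfolding P_def[symmetric] by (simp add: eq_divide_eq)
  qed
qed

section \<open>Orthogonality and perfect splines\<close>

lemma node_0 [simp]: "node n 0 = 0" by (simp add: node_def)

lemma node_last [simp]: "node n (Suc n) = 1"
proof -
  have e: "pi * real (Suc n) / (2 * (real n + 1)) = pi / 2" by (simp add: field_simps)
  show ?thesis unfolding node_def e by simp
qed

lemma alternating_telescope:
  fixes f :: "nat \<Rightarrow> real"
  shows "(\<Sum>i\<le>n. (-1) ^ i * f i) + (\<Sum>i\<le>n. (-1) ^ i * f (Suc i)) = f 0 + (-1) ^ n * f (Suc n)"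
  by (induction n) auto

lemma knot_weights_vanish:
  assumes t: "t > 0" and q: "degree q < n"
  shows "(\<Sum>i\<le>n. (-1) ^ i * vel n t (knot n i t) * poly q (knot n i t)) = 0"
proof (rule knot_weights[OF t, where n = n])
  fix w assume w: "\<And>q. degree q \<le> n \<Longrightarrow>
       (\<Sum>i\<le>n. (-1) ^ i * vel n t (knot n i t) * poly q (knot n i t)) = coeff q n / w"
  show ?thesis using w[of q] q by (simp add: coeff_eq_0)
qed

text \<open>This says that the sign function with sign changes at the knots is orthogonal to \<open>Q'\<close>. The alternating
  sum does not depend on \<open>t\<close>, because its derivative is a divided difference of order \<open>n\<close> of \<open>Q'\<close>. Its
  limits at \<open>0\<close> and at infinity are alternating sums over the nodes, shifted by one index against
  each other, so twice the constant telescopes.\<close>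

lemma knot_orthogonal:
  assumes t: "t > 0" and Q: "degree Q \<le> n"
  shows "2 * (\<Sum>i\<le>n. (-1) ^ i * poly Q (knot n i t)) = poly Q 0 + (-1) ^ n * poly Q 1"
proof -
  define F where "F t = (\<Sum>i\<le>n. (-1) ^ i * poly Q (knot n i t))" for t
  have D: "(F has_field_derivative 0) (at s within {0<..})" if "s \<in> {0<..}" for s
  proof -
    have s: "s > 0" using that by simp
    have "(\<Sum>i\<le>n. (-1) ^ i * vel n s (knot n i s) * poly (pderiv Q) (knot n i s)) = 0"
    proof (cases "degree Q = 0")
      case True then show ?thesis by (simp add: pderiv_eq_0_iff[THEN iffD2])
    next
      case False then show ?thesis using Q by (intro knot_weights_vanish s) (simp add: degree_pderiv)
    qed
    moreover have "DERIV F s :> (\<Sum>i\<le>n. (-1) ^ i * (poly (pderiv Q) (knot n i s) * vel n s (knot n i s)))"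
      unfolding F_def[abs_def]
      by (intro DERIV_sum DERIV_cmult DERIV_chain2[OF poly_DERIV] knot_DERIV[OF s]) auto
    ultimately show ?thesis by (simp add: mult_ac has_field_derivative_at_within)
  qed
  obtain c where c: "\<And>s. s \<in> {0<..} \<Longrightarrow> F s = c"
    using has_field_derivative_zero_constant[OF _ D] by auto
  have cont: "isCont (poly Q) x" for x by simp
  have "(F \<longlongrightarrow> (\<Sum>i\<le>n. (-1) ^ i * poly Q (node n i))) (at_right 0)"
    unfolding F_def[abs_def]
    by (intro tendsto_sum tendsto_mult tendsto_const isCont_tendsto_compose[OF cont] knot_at_0) auto
  moreover have "(F \<longlongrightarrow> c) (at_right 0)"
    by (rule tendsto_eventually) (use c in \<open>auto simp: eventually_at_filter\<close>)
  ultimately have c1: "c = (\<Sum>i\<le>n. (-1) ^ i * poly Q (node n i))"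
    using tendsto_unique[OF trivial_limit_at_right_real] by blast
  have "(F \<longlongrightarrow> (\<Sum>i\<le>n. (-1) ^ i * poly Q (node n (Suc i)))) at_top"
    unfolding F_def[abs_def]
    by (intro tendsto_sum tendsto_mult tendsto_const isCont_tendsto_compose[OF cont] knot_at_top) auto
  moreover have "(F \<longlongrightarrow> c) at_top"
    by (rule tendsto_eventually) (use eventually_gt_at_top[of 0] in eventually_elim, use c in auto)
  ultimately have c2: "c = (\<Sum>i\<le>n. (-1) ^ i * poly Q (node n (Suc i)))"
    using tendsto_unique[OF trivial_limit_at_top_linorder] by blast
  \<comment> \<open>The two expressions for \<open>c\<close> cancel except at the ends.\<close>
  have "2 * c = poly Q 0 + (-1) ^ n * poly Q 1"
    using c1 c2 alternating_telescope[of "\<lambda>i. poly Q (node n i)" n] by simp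
  then show ?thesis using c[of t] t by (simp add: F_def)
qed

lemma alternating_step:
  fixes X :: "nat \<Rightarrow> real"
  assumes "\<And>i j. i < j \<Longrightarrow> j < m \<Longrightarrow> X i < X j" and "\<And>i. i < m \<Longrightarrow> x \<noteq> X i"
  shows "1 + 2 * (\<Sum>i<m. (-1) ^ Suc i * of_bool (X i < x)) = (\<Prod>i<m. sgn (X i - x))"
  using assms
proof (induction m)
  case (Suc m)
  then have IH: "1 + 2 * (\<Sum>i<m. (-1) ^ Suc i * of_bool (X i < x)) = (\<Prod>i<m. sgn (X i - x))" by simp
  show ?case
  proof (cases "X m < x")
    case True
    have "(\<Prod>i<m. sgn (X i - x)) = (\<Prod>i<m. -1)"
      by (rule prod.cong) (use Suc.prems(1)[of _ m] True in force)+
    then have "(\<Prod>i<m. sgn (X i - x)) = (-1) ^ m" by simp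
    then show ?thesis using IH True by (simp add: algebra_simps)
  next
    case False
    then have "x < X m" using Suc.prems(2)[of m] by force
    then show ?thesis using IH by simp
  qed
qed simp

lemma truncated_linear_DERIV:
  fixes c x :: real
  assumes "x \<noteq> c"
  shows "DERIV (\<lambda>x. max 0 (x - c)) x :> of_bool (c < x)"
proof (cases "x < c")
  case True
  have "\<forall>\<^sub>F y in nhds x. (0::real) = max 0 (y - c)"
    using eventually_nhds_in_open[of "{..<c}" x] True by (auto elim!: eventually_mono)
  moreover have "DERIV (\<lambda>x. 0) x :> (0::real)" by simp
  ultimately have "DERIV (\<lambda>x. max 0 (x - c)) x :> 0" by (simp only: DERIV_cong_ev[OF refl _ refl])
  then show ?thesis using True by simp
next
  case False
  then have "\<forall>\<^sub>F y in nhds x. y - c = max 0 (y - c)"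
    using eventually_nhds_in_open[of "{c<..}" x] assms by (auto elim!: eventually_mono)
  moreover have "DERIV (\<lambda>x. x - c) x :> 1" by (rule derivative_eq_intros refl | simp)+
  ultimately have "DERIV (\<lambda>x. max 0 (x - c)) x :> 1" by (simp only: DERIV_cong_ev[OF refl _ refl])
  then show ?thesis using False assms by simp
qed

lemma truncated_power_DERIV:
  fixes c x :: real
  shows "DERIV (\<lambda>x. max 0 (x - c) ^ Suc (Suc j)) x :> real (Suc (Suc j)) * max 0 (x - c) ^ Suc j"
proof (cases "x = c")
  case True
  have "\<exists>g. (\<forall>z. max 0 (z - c) ^ Suc (Suc j) - max 0 (x - c) ^ Suc (Suc j) = g z * (z - x)) \<and> isCont g x
     \<and> g x = real (Suc (Suc j)) * max 0 (x - c) ^ Suc j"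
  proof (intro exI[of _ "\<lambda>z. max 0 (z - c) ^ Suc j"] conjI allI)
    show "max 0 (z - c) ^ Suc (Suc j) - max 0 (x - c) ^ Suc (Suc j) = max 0 (z - c) ^ Suc j * (z - x)" for z
      using True by (cases "z \<le> c") (auto simp: max_def)
    show "isCont (\<lambda>z. max 0 (z - c) ^ Suc j) x" by (intro continuous_intros)
  qed (use True in auto)
  then show ?thesis by (simp add: CARAT_DERIV)
next
  case False
  have "of_bool (c < x) * max 0 (x - c) ^ Suc j = max 0 (x - c) ^ Suc j"
    using False by (cases "c < x") (simp_all add: max_def)
  then show ?thesis
    using DERIV_power[OF truncated_linear_DERIV[OF False], of "Suc (Suc j)"]
    by (simp only: diff_Suc_Suc diff_zero)
qed

text \<open>For \<open>j > 0\<close> this is the \<open>j\<close>-fold integral from \<open>0\<close> of the step function that starts at \<open>1\<close> and changes sign at every knot.\<close>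

definition spline :: "nat \<Rightarrow> real \<Rightarrow> nat \<Rightarrow> real \<Rightarrow> real" where
  "spline n t j x = (x ^ j + 2 * (\<Sum>i\<le>n. (-1) ^ Suc i * max 0 (x - knot n i t) ^ j)) / fact j"

text \<open>Up to the sign \<open>(-1)\<^sup>k\<close> this is the value at the \<open>k\<close>-th knot of the first integral of that step function.\<close>

definition peak :: "nat \<Rightarrow> nat \<Rightarrow> real \<Rightarrow> real" where
  "peak n k t = knot n k t + 2 * (\<Sum>i<k. (-1) ^ (k + i) * knot n i t)"

lemma spline_DERIV:
  assumes "j > 0"
  shows "DERIV (spline n t (Suc j)) x :> spline n t j x"
proof -
  obtain m where m: "j = Suc m" using assms by (cases j) auto
  have "DERIV (\<lambda>x. (x ^ Suc j + 2 * (\<Sum>i\<le>n. (-1) ^ Suc i * max 0 (x - knot n i t) ^ Suc j)) / fact (Suc j)) x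
    :> (real (Suc j) * x ^ j + 2 * (\<Sum>i\<le>n. (-1) ^ Suc i * (real (Suc j) * max 0 (x - knot n i t) ^ j))) / fact (Suc j)"
  proof -
    have 1: "DERIV (\<lambda>x. x ^ Suc j) x :> real (Suc j) * x ^ j"
      using DERIV_pow[of "Suc j" x] by simp
    show ?thesis
      by (intro DERIV_cdivide DERIV_add 1 DERIV_cmult DERIV_sum)
         (simp only: m truncated_power_DERIV)
  qed
  moreover have "(real (Suc j) * x ^ j + 2 * (\<Sum>i\<le>n. (-1) ^ Suc i * (real (Suc j) * max 0 (x - knot n i t) ^ j))) / fact (Suc j)
     = spline n t j x"
  proof -
    have "(\<Sum>i\<le>n. (-1) ^ Suc i * (real (Suc j) * max 0 (x - knot n i t) ^ j))
      = real (Suc j) * (\<Sum>i\<le>n. (-1) ^ Suc i * max 0 (x - knot n i t) ^ j)"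
      unfolding sum_distrib_left by (rule sum.cong) (simp_all only: mult_ac)
    then have "(real (Suc j) * x ^ j + 2 * (\<Sum>i\<le>n. (-1) ^ Suc i * (real (Suc j) * max 0 (x - knot n i t) ^ j)))
      = real (Suc j) * (x ^ j + 2 * (\<Sum>i\<le>n. (-1) ^ Suc i * max 0 (x - knot n i t) ^ j))"
      by (simp only: distrib_left mult.left_commute)
    moreover have "fact (Suc j) = real (Suc j) * fact j" by (simp only: fact_Suc of_nat_mult of_nat_fact) 
    ultimately show ?thesis unfolding spline_def by (simp only: mult_divide_mult_cancel_left of_nat_eq_0_iff nat.simps simp_thms)
  qed
  ultimately show ?thesis unfolding spline_def[abs_def] by simp
qed

lemma spline_1_DERIV:
  assumes t: "t > 0" and x: "\<And>i. i \<le> n \<Longrightarrow> x \<noteq> knot n i t"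
  shows "DERIV (spline n t 1) x :> (\<Prod>i\<le>n. sgn (knot n i t - x))"
proof -
  have "DERIV (\<lambda>x. x + 2 * (\<Sum>i\<le>n. (-1) ^ Suc i * max 0 (x - knot n i t))) x
    :> 1 + 2 * (\<Sum>i\<le>n. (-1) ^ Suc i * of_bool (knot n i t < x))"
    by (intro DERIV_add DERIV_cmult DERIV_sum truncated_linear_DERIV DERIV_ident) (use x in auto)
  also have "1 + 2 * (\<Sum>i\<le>n. (-1) ^ Suc i * of_bool (knot n i t < x)) = (\<Prod>i\<le>n. sgn (knot n i t - x))"
    using alternating_step[of "Suc n" "\<lambda>i. knot n i t" x] knot_strict_mono[OF t, of _ _ n] x
    by (simp add: lessThan_Suc_atMost less_Suc_eq_le)
  finally show ?thesis unfolding spline_def[abs_def] by simp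
qed

lemma ac_cong: "(\<And>x. x \<in> {a..b} \<Longrightarrow> f x = g x) \<Longrightarrow>
    absolutely_continuous_on {a..b} f \<Longrightarrow> absolutely_continuous_on {a..b} g"
  using ac_add[of "{a..b}" f "\<lambda>x. g x - f x"] lipschitz_imp_ac[of "{a..b}" "\<lambda>x. g x - f x" 0] by simp

lemma ac_const: "absolutely_continuous_on S (\<lambda>x. c)"
  by (rule lipschitz_imp_ac[of _ _ 0]) simp

lemma ac_power: "absolutely_continuous_on {a..b} f \<Longrightarrow> absolutely_continuous_on {a..b} (\<lambda>x. f x ^ m)"
  by (induction m) (auto intro: ac_const ac_mult)

lemma ac_sum: "finite I \<Longrightarrow> (\<And>i. i \<in> I \<Longrightarrow> absolutely_continuous_on S (f i)) \<Longrightarrow>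
    absolutely_continuous_on S (\<lambda>x. \<Sum>i\<in>I. f i x)"
  by (induction I rule: finite_induct) (auto intro: ac_const ac_add)

lemma ac_spline: "absolutely_continuous_on {a..b} (spline n t j)"
proof -
  have 1: "absolutely_continuous_on {a..b} (\<lambda>x. max 0 (x - c))" for c
    by (rule lipschitz_imp_ac[of _ _ 1]) auto
  have 2: "absolutely_continuous_on {a..b} (\<lambda>x. x)" by (rule lipschitz_imp_ac[of _ _ 1]) simp
  have "absolutely_continuous_on {a..b} (\<lambda>x. (x ^ j + 2 * (\<Sum>i\<le>n. (-1) ^ Suc i * max 0 (x - knot n i t) ^ j)) * (1 / fact j))"
    by (intro ac_mult ac_add ac_power ac_const ac_sum 1 2) auto
  then show ?thesis unfolding spline_def[abs_def] by simp
qed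

lemma spline_0: assumes "t > 0" "j > 0" shows "spline n t j 0 = 0"
proof -
  have "(\<Sum>i\<le>n. (-1) ^ Suc i * max 0 (0 - knot n i t) ^ j) = 0"
  proof (rule sum.neutral, rule ballI)
    fix i assume "i \<in> {..n}"
    then have "max 0 (0 - knot n i t) = 0" using knot_range(1)[OF assms(1), of i n] by simp
    then show "(-1) ^ Suc i * max 0 (0 - knot n i t) ^ j = 0" using assms(2) by (simp only: power_0_left) simp
  qed
  then show ?thesis unfolding spline_def using assms(2) by (simp only: power_0_left) simp
qed

text \<open>The boundary condition at \<open>1\<close> is orthogonality to \<open>(1 - x)\<^sup>j\<^sup>-\<^sup>1\<close>.\<close>

lemma spline_1: assumes "t > 0" "0 < j" "j \<le> n" shows "spline n t j 1 = 0"
proof -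
  have "degree ([:1, -1::real:] ^ j) \<le> n" using degree_power_le[of "[:1, -1::real:]" j] assms(3) by simp
  from knot_orthogonal[OF assms(1) this]
  have "2 * (\<Sum>i\<le>n. (-1) ^ i * (1 - knot n i t) ^ j) = 1" using assms(2) by (simp add: power_0_left)
  moreover have "(\<Sum>i\<le>n. (-1) ^ Suc i * max 0 (1 - knot n i t) ^ j) = - (\<Sum>i\<le>n. (-1) ^ i * (1 - knot n i t) ^ j)"
    unfolding sum_negf[symmetric] 
  proof (rule sum.cong)
    fix i assume "i \<in> {..n}"
    then have "max 0 (1 - knot n i t) = 1 - knot n i t" using knot_range(2)[OF assms(1), of i n] by simp
    then show "(-1) ^ Suc i * max 0 (1 - knot n i t) ^ j = - ((-1) ^ i * (1 - knot n i t) ^ j)" by simp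
  qed simp
  ultimately show ?thesis unfolding spline_def by simp
qed

lemma alternating_ones: "1 + 2 * (\<Sum>i<k. (-1) ^ Suc i) = ((-1) ^ k :: real)"
  by (induction k) (simp_all add: algebra_simps)

lemma spline_peak:
  assumes t: "t > 0" and k: "k \<le> n"
  shows "spline n t 1 (knot n k t) = (-1) ^ k * peak n k t"
proof -
  let ?X = "\<lambda>i. knot n i t"
  have "(\<Sum>i\<le>n. (-1) ^ Suc i * max 0 (?X k - ?X i)) = (\<Sum>i<k. (-1) ^ Suc i * (?X k - ?X i))"
  proof (rule sum.mono_neutral_cong_right)
    show "\<forall>i\<in>{..n} - {..<k}. (- 1) ^ Suc i * max 0 (?X k - ?X i) = 0"
    proof
      fix i assume "i \<in> {..n} - {..<k}"
      then have "?X k \<le> ?X i" using knot_strict_mono[OF t, of k i n] by (cases "i = k") auto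
      then show "(- 1) ^ Suc i * max 0 (?X k - ?X i) = 0" by simp
    qed
    show "(- 1) ^ Suc i * max 0 (?X k - ?X i) = (- 1) ^ Suc i * (?X k - ?X i)" if "i \<in> {..<k}" for i
      using knot_strict_mono[OF t, of i k n] that k by (simp add: max_def)
  qed (use k in auto)
  also have "\<dots> = (\<Sum>i<k. (-1) ^ Suc i) * ?X k + (\<Sum>i<k. (-1) ^ i * ?X i)"
    unfolding sum_distrib_right sum.distrib[symmetric] by (rule sum.cong) (auto simp: algebra_simps)
  finally have "spline n t 1 (?X k) = (1 + 2 * (\<Sum>i<k. (-1) ^ Suc i)) * ?X k + 2 * (\<Sum>i<k. (-1) ^ i * ?X i)"
    by (simp add: spline_def algebra_simps)
  also have "\<dots> = (-1) ^ k * (?X k + 2 * ((-1) ^ k * (\<Sum>i<k. (-1) ^ i * ?X i)))"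
    unfolding alternating_ones by (simp add: algebra_simps flip: power_mult_distrib)
  finally show ?thesis by (simp add: peak_def sum_distrib_left power_add mult_ac)
qed

lemma der_spline:
  assumes "j < n" "x \<in> {0..1}"
  shows "der j (spline n t n) x = spline n t (n - j) x"
  using assms
proof (induction j arbitrary: x)
  case 0 then show ?case by (simp add: der_def)
next
  case (Suc j)
  have eq: "n - j = Suc (n - Suc j)" using Suc.prems by simp
  have "(spline n t (n - j) has_vector_derivative spline n t (n - Suc j) x) (at x within {0..1})"
    unfolding eq has_real_derivative_iff_has_vector_derivative[symmetric]
    by (rule has_field_derivative_at_within[OF spline_DERIV]) (use Suc.prems in simp)
  then have "(der j (spline n t n) has_vector_derivative spline n t (n - Suc j) x) (at x within {0..1})"
    by (rule has_vector_derivative_transform[rotated 2]) (use Suc in auto)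
  then show ?case unfolding der_Suc
    by (rule vector_derivative_within_closed_interval[rotated 2]) (use Suc.prems in auto)
qed

lemma finite_null_sets: "finite N \<Longrightarrow> N \<inter> {0..1} \<in> null_sets (lebesgue_on {0..1::real})"
  using negligible_finite[of "N \<inter> {0..1}"] by (simp add: null_sets_restrict_space negligible_iff_null_sets)

lemma Linf_norm_unimodular:
  assumes f: "f \<in> borel_measurable (lebesgue_on {0..1::real})"
    and N: "finite N" and v: "\<And>x. x \<in> {0..1} - N \<Longrightarrow> \<bar>f x\<bar> = 1"
  shows "Linf_norm f = 1"
proof -
  have "N \<inter> {0..1} \<in> null_sets (lebesgue_on {0..1})" by (rule finite_null_sets[OF N])
  then have ae: "AE x in lebesgue_on {0..1}. ereal \<bar>f x\<bar> = 1"
    by (rule AE_I') (use v in auto)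
  have "Linf_norm f = esssup (lebesgue_on {0..1::real}) (\<lambda>x. 1)"
    unfolding Linf_norm_def by (rule esssup_AE_cong) (use f ae in auto)
  also have "\<dots> = 1" by (rule esssup_const) (simp add: space_restrict_space emeasure_restrict_space)
  finally show ?thesis .
qed

text \<open>The perfect spline with the knots as break points is the extremal function for each of its knots.\<close>

lemma extremal_spline:
  assumes t: "t > 0" and n: "n \<ge> 1"
  defines "y \<equiv> spline n t n"
  shows "y \<in> sobolev0 n" "Linf_norm (der n y) = 1"
    "\<And>k. k \<le> n \<Longrightarrow> der (n - 1) y (knot n k t) = (-1) ^ k * peak n k t"
    "\<And>x. x \<in> {0..1} \<Longrightarrow> (\<And>i. i \<le> n \<Longrightarrow> x \<noteq> knot n i t) \<Longrightarrow> der n y x = (\<Prod>i\<le>n. sgn (knot n i t - x))"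
proof -
  let ?K = "(\<lambda>i. knot n i t) ` {..n}"
  have d: "der j y x = spline n t (n - j) x" if "j < n" "x \<in> {0..1}" for j x
    unfolding y_def by (rule der_spline[OF that])
  have hv: "(der (n - 1) y has_vector_derivative (\<Prod>i\<le>n. sgn (knot n i t - x))) (at x within {0..1})"
    if "x \<in> {0..1}" "x \<notin> ?K" for x
  proof -
    have "(spline n t 1 has_vector_derivative (\<Prod>i\<le>n. sgn (knot n i t - x))) (at x within {0..1})"
      unfolding has_real_derivative_iff_has_vector_derivative[symmetric]
      by (rule has_field_derivative_at_within[OF spline_1_DERIV[OF t]]) (use that in auto)
    then show ?thesis
      by (rule has_vector_derivative_transform[rotated 2]) (use d[of "n - 1"] n that in auto)
  qed
  show last: "der n y x = (\<Prod>i\<le>n. sgn (knot n i t - x))"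
    if "x \<in> {0..1}" "\<And>i. i \<le> n \<Longrightarrow> x \<noteq> knot n i t" for x
  proof -
    have "n = Suc (n - 1)" using n by simp
    then have "der n y x = vector_derivative (der (n - 1) y) (at x within {0..1})" using der_Suc by metis
    also have "\<dots> = (\<Prod>i\<le>n. sgn (knot n i t - x))"
      by (rule vector_derivative_within_closed_interval[OF _ _ hv]) (use that in auto)
    finally show ?thesis .
  qed
  show "der (n - 1) y (knot n k t) = (-1) ^ k * peak n k t" if "k \<le> n" for k
    using d[of "n - 1" "knot n k t"] n spline_peak[OF t that] knot_range[OF t that] by simp
  have meas: "der n y \<in> borel_measurable (lebesgue_on {0..1})"
  proof (rule measurable_discrete_difference[where X = "?K \<inter> {0..1}"])
    show "(\<lambda>x. \<Prod>i\<le>n. sgn (knot n i t - x)) \<in> borel_measurable (lebesgue_on {0..1})"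
      by (intro borel_measurable_if_D measurable_completion borel_measurable_prod measurable_restrict_space1)
         (auto intro!: measurable_completion)
    show "countable (?K \<inter> {0..1})" by (intro countable_finite) auto
    show "{x} \<in> sets (lebesgue_on {0..1})" if "x \<in> ?K \<inter> {0..1}" for x
      using that by (auto simp: sets_restrict_space_iff)
    show "(\<Prod>i\<le>n. sgn (knot n i t - x)) = der n y x"
      if "x \<in> space (lebesgue_on {0..1})" "x \<notin> ?K \<inter> {0..1}" for x
      using last[of x] that by (fastforce simp: space_restrict_space)
  qed simp
  show L: "Linf_norm (der n y) = 1"
  proof (rule Linf_norm_unimodular[OF meas, of ?K])
    fix x assume x: "x \<in> {0..1} - ?K"
    then have "der n y x = (\<Prod>i\<le>n. sgn (knot n i t - x))" using last by auto
    moreover have "\<bar>\<Prod>i\<le>n. sgn (knot n i t - x)\<bar> = (\<Prod>i\<le>n. 1)"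
      unfolding abs_prod by (rule prod.cong) (use x in \<open>auto simp: abs_sgn_eq\<close>)
    ultimately show "\<bar>der n y x\<bar> = 1" by simp
  qed simp
  show "y \<in> sobolev0 n" unfolding sobolev0_def
  proof (intro CollectI conjI allI impI)
    fix j assume j: "Suc j < n"
    show "der j y differentiable_on {0..1}" unfolding differentiable_on_def
    proof
      fix x :: real assume x: "x \<in> {0..1}"
      have "n - j = Suc (n - Suc j)" "n - Suc j > 0" using j by auto
      then have "(spline n t (n - j) has_vector_derivative spline n t (n - Suc j) x) (at x within {0..1})"
        unfolding has_real_derivative_iff_has_vector_derivative[symmetric]
        using has_field_derivative_at_within[OF spline_DERIV[of "n - Suc j" n t x]] by simp
      then have "(der j y has_vector_derivative spline n t (n - Suc j) x) (at x within {0..1})"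
        by (rule has_vector_derivative_transform[rotated 2]) (use d j x in auto)
      then show "der j y differentiable at x within {0..1}"
        by (rule differentiableI_vector)
    qed
  next
    fix j assume j: "j < n"
    show "absolutely_continuous_on {0..1} (der j y)"
      by (rule ac_cong[OF _ ac_spline[of 0 1 n t "n - j"]]) (use d j in auto)
    show "der j y 0 = 0" using d[of j 0] j spline_0[OF t] by simp
    show "der j y 1 = 0" using d[of j 1] j spline_1[OF t] by simp
  next
    have "?K \<inter> {0..1} \<in> null_sets (lebesgue_on {0..1})" by (rule finite_null_sets) simp
    then show "AE x in lebesgue_on {0..1}. der (n - 1) y differentiable at x within {0..1}"
      by (rule AE_I') (use hv differentiableI_vector in fastforce)
  qed (use meas L in auto)
qed

section \<open>The sharp constant at a knot\<close>

lemma sgn_mult_nonneg: "z * P \<ge> 0 \<Longrightarrow> sgn P * z \<ge> (0::real)"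
  by (cases P "0::real" rule: linorder_cases) (auto simp: mult_le_0_iff zero_le_mult_iff)

lemma sgn_prod_real: "sgn (\<Prod>i\<in>I. f i) = (\<Prod>i\<in>I. sgn (f i :: real))"
  by (induction I rule: infinite_finite_induct) (auto simp: sgn_mult)

text \<open>The dual certificate: a polynomial that approximates the indicator of \<open>[0, x\<^sub>k]\<close> with an error that has the
  sign of the extremal \<open>n\<close>-th derivative. It interpolates the indicator at the other \<open>n\<close> knots. For
  \<open>k = 0\<close> and \<open>k = n\<close> it is constant.\<close>

lemma knot_certificate:
  assumes t: "t > 0" and n: "n \<ge> 1" and k: "k \<le> n"
  obtains p where "degree p < n"
    "\<And>i. i < k \<Longrightarrow> poly p (knot n i t) = 1"
    "\<And>i. k < i \<Longrightarrow> i \<le> n \<Longrightarrow> poly p (knot n i t) = 0"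
    "\<And>x. (\<And>i. i \<le> n \<Longrightarrow> x \<noteq> knot n i t) \<Longrightarrow>
       (-1) ^ k * (\<Prod>i\<le>n. sgn (knot n i t - x)) * ((if x \<le> knot n k t then 1 else 0) - poly p x) \<ge> 0"
    "0 < k \<Longrightarrow> k < n \<Longrightarrow>
       step_interpolant ((\<lambda>i. knot n i t) ` {..<k}) ((\<lambda>i. knot n i t) ` {k<..n}) p"
proof -
  let ?X = "\<lambda>i. knot n i t"
  let ?A = "?X ` {..<k}" and ?C = "?X ` {k<..n}"
  have lt: "?X i < ?X j" if "i < j" "j \<le> n" for i j using knot_strict_mono[OF t that] .
  have inj: "inj_on ?X {..n}" by (rule knot_inj[OF t])
  have cA: "card ?A = k" and cC: "card ?C = n - k"
    using k by (subst card_image; force intro: inj_on_subset[OF inj])+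
  have prodA: "(\<Prod>a\<in>?A. f a) = (\<Prod>i<k. f (?X i))" for f :: "real \<Rightarrow> real"
    by (subst prod.reindex) (use k in \<open>auto intro: inj_on_subset[OF inj]\<close>)
  have prodC: "(\<Prod>a\<in>?C. f a) = (\<Prod>i\<in>{k<..n}. f (?X i))" for f :: "real \<Rightarrow> real"
    by (subst prod.reindex) (auto intro: inj_on_subset[OF inj])
  have "\<exists>p. degree p < n \<and> (\<forall>i<k. poly p (?X i) = 1) \<and> (\<forall>i. k < i \<and> i \<le> n \<longrightarrow> poly p (?X i) = 0) \<and>
     (\<forall>x. x \<le> ?X k \<longrightarrow> (1 - poly p x) * (\<Prod>i<k. x - ?X i) \<ge> 0) \<and>
     (\<forall>x. ?X k \<le> x \<longrightarrow> poly p x * (\<Prod>i\<in>{k<..n}. ?X i - x) \<ge> 0) \<and>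
     (0 < k \<and> k < n \<longrightarrow> step_interpolant ?A ?C p)"
  proof -
    consider "k = 0" | "k = n" | "0 < k" "k < n" using k by linarith
    then show ?thesis
    proof cases
      case 1
      show ?thesis by (rule exI[of _ 0]) (use 1 n in auto)
    next
      case 2
      show ?thesis by (rule exI[of _ 1]) (use 2 n in auto)
    next
      case 3
      obtain p where p: "degree p \<le> card (?A \<union> ?C) - 1"
        "\<And>x. x \<in> ?A \<union> ?C \<Longrightarrow> poly p x = (if x \<in> ?A then 1 else 0)"
        using interpolation_exists[of "?A \<union> ?C" "\<lambda>x. if x \<in> ?A then 1 else 0"] by auto
      have less: "a < c" if "a \<in> ?A" "c \<in> ?C" for a c using that lt k by auto
      have notA: "c \<notin> ?A" if "c \<in> ?C" for c using less[of c c] that by auto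
      have "card (?A \<union> ?C) = n" using cA cC k notA by (subst card_Un_disjoint) auto
      then have dp: "degree p \<le> n - 1" using p(1) by simp
      have S: "step_interpolant ?A ?C p"
      proof
        show "degree p \<le> card ?A + card ?C - 1" using dp cA cC k by simp
        show "poly p c = 0" if "c \<in> ?C" for c using p(2)[of c] that notA[OF that] by simp
        show "poly p a = 1" if "a \<in> ?A" for a using p(2)[of a] that by simp
      qed (use 3 less in auto)
      interpret step_interpolant ?A ?C p by (rule S)
      show ?thesis
      proof (intro exI[of _ p] conjI allI impI)
        show "degree p < n" using dp n by simp
        show "poly p (?X i) = 1" if "i < k" for i using pA that by auto
        show "poly p (?X i) = 0" if "k < i \<and> i \<le> n" for i using pB that by auto
        show "0 \<le> (1 - poly p x) * (\<Prod>i<k. x - ?X i)" if "x \<le> ?X k" for x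
          using left_sign[of x] lt that unfolding prodA by force
        show "0 \<le> poly p x * (\<Prod>i\<in>{k<..n}. ?X i - x)" if "?X k \<le> x" for x
          using right_sign[of x] lt[of _ k] k that unfolding prodC by force
      qed (rule S)
    qed
  qed
  then obtain p where p: "degree p < n" "\<And>i. i < k \<Longrightarrow> poly p (?X i) = 1"
    "\<And>i. k < i \<Longrightarrow> i \<le> n \<Longrightarrow> poly p (?X i) = 0"
    and L: "\<And>x. x \<le> ?X k \<Longrightarrow> (1 - poly p x) * (\<Prod>i<k. x - ?X i) \<ge> 0"
    and R: "\<And>x. ?X k \<le> x \<Longrightarrow> poly p x * (\<Prod>i\<in>{k<..n}. ?X i - x) \<ge> 0"
    and S: "0 < k \<and> k < n \<longrightarrow> step_interpolant ?A ?C p" by blast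
  have "(-1) ^ k * (\<Prod>i\<le>n. sgn (?X i - x)) * ((if x \<le> ?X k then 1 else 0) - poly p x) \<ge> 0"
    if x: "\<And>i. i \<le> n \<Longrightarrow> x \<noteq> ?X i" for x
  proof (cases "x \<le> ?X k")
    case True
    then have xk: "x < ?X k" using x[OF k] by force
    have "{..n} = {..<k} \<union> {k..n}" using k by auto
    then have "(\<Prod>i\<le>n. sgn (?X i - x)) = (\<Prod>i<k. sgn (?X i - x)) * (\<Prod>i=k..n. sgn (?X i - x))"
      by (simp only:) (rule prod.union_disjoint, auto)
    also have "(\<Prod>i=k..n. sgn (?X i - x)) = 1"
      by (rule prod.neutral) (use lt[of k] xk in \<open>force simp: sgn_if le_less\<close>)
    also have "(\<Prod>i<k. sgn (?X i - x)) = (\<Prod>i<k. (-1) * sgn (x - ?X i))"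
      by (rule prod.cong) (auto simp: sgn_if)
    also have "\<dots> = (-1) ^ k * sgn (\<Prod>i<k. x - ?X i)"
      unfolding prod.distrib by (simp add: sgn_prod_real)
    finally have "(-1) ^ k * (\<Prod>i\<le>n. sgn (?X i - x)) = ((-1) ^ k * (-1) ^ k) * sgn (\<Prod>i<k. x - ?X i)" by simp
    also have "((-1) ^ k * (-1) ^ k) = (1::real)" by (simp flip: power_mult_distrib)
    finally show ?thesis using True sgn_mult_nonneg[OF L[OF True]] by simp
  next
    case False
    then have xk: "?X k < x" by simp
    have "{..n} = {..k} \<union> {k<..n}" using k by auto
    then have "(\<Prod>i\<le>n. sgn (?X i - x)) = (\<Prod>i\<le>k. sgn (?X i - x)) * (\<Prod>i\<in>{k<..n}. sgn (?X i - x))"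
      by (simp only:) (rule prod.union_disjoint, auto)
    also have "(\<Prod>i\<le>k. sgn (?X i - x)) = (\<Prod>i\<le>k. -1)"
      by (rule prod.cong) (use lt[of _ k] k xk in \<open>force simp: sgn_if le_less\<close>)+
    finally have "(-1) ^ k * (\<Prod>i\<le>n. sgn (?X i - x)) = - ((-1) ^ k * (-1) ^ k) * sgn (\<Prod>i\<in>{k<..n}. ?X i - x)"
      by (simp add: sgn_prod_real)
    also have "((-1) ^ k * (-1) ^ k) = (1::real)" by (simp flip: power_mult_distrib)
    finally show ?thesis using False sgn_mult_nonneg[OF R[of x]] xk by simp
  qed
  then show thesis using that[of p] p S by blast
qed

lemma has_integral_step_minus_poly:
  assumes z: "z \<in> sobolev0 n" and n: "n \<ge> 1" and a: "a \<in> {0..1}" and p: "degree p < n"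
  shows "((\<lambda>x. der n z x * ((if x \<le> a then 1 else 0) - poly p x)) has_integral der (n - 1) z a) {0..1}"
proof -
  have n': "Suc (n - 1) = n" "n - 1 < n" using n by auto
  have "(der n z has_integral (der (n - 1) z a - der (n - 1) z 0)) {0..a}"
    using sobolev0_has_integral[OF z n'(2), of 0 a] a n' by simp
  moreover have "der (n - 1) z 0 = 0" using z n' by (auto simp: sobolev0_def)
  ultimately have "(der n z has_integral der (n - 1) z a) {0..a}" by simp
  then have "((\<lambda>x. if x \<in> {0..a} then der n z x else 0) has_integral der (n - 1) z a) {0..1}"
    using a by (subst has_integral_restrict) auto
  from has_integral_diff[OF this sobolev0_orthogonal[OF z order_refl p]]
  have "((\<lambda>x. (if x \<in> {0..a} then der n z x else 0) - der n z x * poly p x) has_integral der (n - 1) z a) {0..1}"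
    by simp
  then show ?thesis by (rule has_integral_eq[rotated]) (auto simp: algebra_simps)
qed

text \<open>Subtracting the certificate from the indicator changes neither integral, by orthogonality; then the
  integrand for the spline is the absolute value of the error and dominates the one for \<open>z\<close>.\<close>

lemma peak_upper_bound:
  assumes t: "t > 0" and n: "n \<ge> 1" and k: "k \<le> n"
    and z: "z \<in> sobolev0 n" and L: "Linf_norm (der n z) \<le> 1"
  shows "\<bar>der (n - 1) z (knot n k t)\<bar> \<le> peak n k t"
proof -
  obtain p where p: "degree p < n" and sg: "\<And>x. (\<And>i. i \<le> n \<Longrightarrow> x \<noteq> knot n i t) \<Longrightarrow>
       (-1) ^ k * (\<Prod>i\<le>n. sgn (knot n i t - x)) * ((if x \<le> knot n k t then 1 else 0) - poly p x) \<ge> 0"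
    using knot_certificate[OF t n k] by metis
  define h where "h x = (if x \<le> knot n k t then 1 else 0) - poly p x" for x
  define y where "y = spline n t n"
  note y = extremal_spline[OF t n, folded y_def]
  have a: "knot n k t \<in> {0..1}" using knot_range[OF t k] by simp
  obtain N where N: "negligible N" "\<And>x. x \<in> {0..1} - N \<Longrightarrow> \<bar>der n z x\<bar> \<le> 1"
    using Linf_norm_le_negligible[of "der n z" 1] L by (auto simp: one_ereal_def)
  let ?K = "(\<lambda>i. knot n i t) ` {..n}"
  have N': "negligible (N \<union> ?K)" using negligible_Un[OF N(1) negligible_finite[of ?K]] by simp
  have Iy: "((\<lambda>x. (-1) ^ k * (der n y x * h x)) has_integral peak n k t) {0..1}"
    using has_integral_mult_right[OF has_integral_step_minus_poly[OF y(1) n a p], of "(-1) ^ k"]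
    unfolding y(3)[OF k] h_def by (simp add: mult.assoc[symmetric] flip: power_mult_distrib)
  have "s * der (n - 1) z (knot n k t) \<le> peak n k t" if s: "\<bar>s\<bar> = 1" for s
  proof -
    have Iz: "((\<lambda>x. s * (der n z x * h x)) has_integral s * der (n - 1) z (knot n k t)) {0..1}"
      unfolding h_def by (rule has_integral_mult_right[OF has_integral_step_minus_poly[OF z n a p]])
    have pw: "s * (der n z x * h x) \<le> (-1) ^ k * (der n y x * h x)" if x: "x \<in> {0..1} - (N \<union> ?K)" for x
    proof -
      have nk: "\<And>i. i \<le> n \<Longrightarrow> x \<noteq> knot n i t" using x by auto
      have "(-1) ^ k * (der n y x * h x) \<ge> 0"
        using sg[OF nk] y(4)[OF _ nk] x unfolding h_def by (simp add: mult_ac)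
      moreover have "\<bar>(-1) ^ k * (der n y x * h x)\<bar> = \<bar>h x\<bar>"
      proof -
        have "\<bar>\<Prod>i\<le>n. sgn (knot n i t - x)\<bar> = (\<Prod>i\<le>n. 1)"
          unfolding abs_prod by (rule prod.cong) (use nk in \<open>auto simp: abs_sgn_eq\<close>)
        then show ?thesis using y(4)[OF _ nk] x by (simp add: abs_mult power_abs)
      qed
      ultimately have "(-1) ^ k * (der n y x * h x) = \<bar>h x\<bar>" by simp
      moreover have "s * (der n z x * h x) \<le> \<bar>s\<bar> * (\<bar>der n z x\<bar> * \<bar>h x\<bar>)"
        by (metis abs_ge_self abs_mult)
      moreover have "\<bar>der n z x\<bar> * \<bar>h x\<bar> \<le> 1 * \<bar>h x\<bar>" using N(2)[of x] x by (intro mult_right_mono) auto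
      ultimately show ?thesis using s by simp
    qed
    \<comment> \<open>The pointwise bound holds off a null set, so both integrands are set to \<open>0\<close> there.\<close>
    define f1 where "f1 x = (if x \<in> N \<union> ?K then 0 else s * (der n z x * h x))" for x
    define f2 where "f2 x = (if x \<in> N \<union> ?K then 0 else (-1) ^ k * (der n y x * h x))" for x
    have e1: "f1 x = s * (der n z x * h x)" if "x \<in> {0..1} - (N \<union> ?K)" for x
      using that by (simp add: f1_def)
    have e2: "f2 x = (-1) ^ k * (der n y x * h x)" if "x \<in> {0..1} - (N \<union> ?K)" for x
      using that by (simp add: f2_def)
    show ?thesis
    proof (rule has_integral_le[OF has_integral_spike[OF N' e1 Iz] has_integral_spike[OF N' e2 Iy]])
      fix x :: real assume x: "x \<in> {0..1}"
      show "f1 x \<le> f2 x" using pw[of x] x by (auto simp: f1_def f2_def)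
    qed
  qed
  from this[of 1] this[of "-1"] show ?thesis by simp
qed

lemma der_lipschitz:
  assumes z: "z \<in> sobolev0 n" and n: "n \<ge> 1" and L: "Linf_norm (der n z) \<le> 1"
    and ab: "a \<in> {0..1}" "b \<in> {0..1}"
  shows "\<bar>der (n - 1) z a - der (n - 1) z b\<bar> \<le> \<bar>a - b\<bar>"
proof -
  obtain N where N: "negligible N" "\<And>x. x \<in> {0..1} - N \<Longrightarrow> \<bar>der n z x\<bar> \<le> 1"
    using Linf_norm_le_negligible[of "der n z" 1] L by (auto simp: one_ereal_def)
  have main: "\<bar>der (n - 1) z d - der (n - 1) z c\<bar> \<le> d - c" if cd: "0 \<le> c" "c \<le> d" "d \<le> 1" for c d
  proof -
    have I: "(der n z has_integral (der (n - 1) z d - der (n - 1) z c)) {c..d}"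
      using sobolev0_has_integral[OF z, of "n - 1" c d] n cd by simp
    define f where "f x = (if x \<in> N then 0 else der n z x)" for x
    have e: "f x = der n z x" if "x \<in> {c..d} - N" for x using that by (simp add: f_def)
    have "norm (der (n - 1) z d - der (n - 1) z c) \<le> 1 * measure lborel {c..d}"
    proof (rule has_integral_bound_real[OF _ _ has_integral_spike[OF N(1) e I]])
      show "norm (f x) \<le> 1" if "x \<in> {c..d} - {}" for x using N(2)[of x] that cd by (simp add: f_def)
    qed auto
    then show ?thesis using cd by simp
  qed
  show ?thesis
    using main[of a b] main[of b a] ab by (cases "a \<le> b") (auto simp: abs_minus_commute)
qed

text \<open>The sharp constant is finite on \<open>[0,1]\<close>, where \<open>sharp_const_eq\<close> justifies this conversion.\<close>

definition sharp_val :: "nat \<Rightarrow> real \<Rightarrow> real" where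
  "sharp_val n a = real_of_ereal (sharp_const n (n - 1) a)"

lemma sharp_const_le: 
  assumes "\<And>z. z \<in> sobolev0 n \<Longrightarrow> Linf_norm (der n z) = 1 \<Longrightarrow> \<bar>der (n - 1) z a\<bar> \<le> c"
  shows "sharp_const n (n - 1) a \<le> ereal c"
  unfolding sharp_const_def by (rule SUP_least) (use assms in auto)

lemma sharp_const_ge:
  assumes "z \<in> sobolev0 n" "Linf_norm (der n z) = 1"
  shows "ereal \<bar>der (n - 1) z a\<bar> \<le> sharp_const n (n - 1) a"
  unfolding sharp_const_def by (rule SUP_upper) (use assms in auto)

lemma sharp_const_eq:
  assumes n: "n \<ge> 1" and a: "a \<in> {0..1}"
  shows "sharp_const n (n - 1) a = ereal (sharp_val n a)"
proof -
  have "\<bar>der (n - 1) z a\<bar> \<le> 1" if "z \<in> sobolev0 n" "Linf_norm (der n z) = 1" for z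
  proof -
    have "der (n - 1) z 0 = 0" using that n by (auto simp: sobolev0_def)
    then show ?thesis using der_lipschitz[of z n a 0] that n a by simp
  qed
  then have "sharp_const n (n - 1) a \<le> ereal 1" by (rule sharp_const_le)
  moreover have "0 \<le> sharp_const n (n - 1) a"
    using sharp_const_ge[OF extremal_spline(1,2)[of 1 n], of a] n by (rule_tac order_trans) auto
  ultimately show ?thesis unfolding sharp_val_def by (cases "sharp_const n (n - 1) a") auto
qed

lemma sharp_val_bound:
  assumes "n \<ge> 1" "a \<in> {0..1}" "z \<in> sobolev0 n" "Linf_norm (der n z) = 1"
  shows "\<bar>der (n - 1) z a\<bar> \<le> sharp_val n a"
  using sharp_const_ge[OF assms(3,4), of a] sharp_const_eq[OF assms(1,2)] by simp

lemma sharp_val_le: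
  assumes "n \<ge> 1" "a \<in> {0..1}"
    "\<And>z. z \<in> sobolev0 n \<Longrightarrow> Linf_norm (der n z) = 1 \<Longrightarrow> \<bar>der (n - 1) z a\<bar> \<le> c"
  shows "sharp_val n a \<le> c"
  using sharp_const_le[OF assms(3)] sharp_const_eq[OF assms(1,2)] by simp

lemma sharp_val_nonneg: "n \<ge> 1 \<Longrightarrow> a \<in> {0..1} \<Longrightarrow> sharp_val n a \<ge> 0"
  using sharp_val_bound[OF _ _ extremal_spline(1,2)[of 1 n], of a] by linarith

lemma sharp_val_lipschitz:
  assumes n: "n \<ge> 1" and a: "a \<in> {0..1}" and b: "b \<in> {0..1}"
  shows "\<bar>sharp_val n a - sharp_val n b\<bar> \<le> \<bar>a - b\<bar>"
proof -
  have main: "sharp_val n a \<le> sharp_val n b + \<bar>a - b\<bar>" if ab: "a \<in> {0..1}" "b \<in> {0..1}" for a b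
  proof (rule sharp_val_le[OF n ab(1)])
    fix z assume z: "z \<in> sobolev0 n" "Linf_norm (der n z) = 1"
    show "\<bar>der (n - 1) z a\<bar> \<le> sharp_val n b + \<bar>a - b\<bar>"
      using sharp_val_bound[OF n ab(2) z] der_lipschitz[OF z(1) n _ ab] z(2) by simp
  qed
  show ?thesis using main[OF a b] main[OF b a] by (simp add: abs_minus_commute)
qed

lemma sharp_val_endpoints: assumes n: "n \<ge> 1" shows "sharp_val n 0 = 0" "sharp_val n 1 = 0"
proof -
  have "sharp_val n a \<le> 0" if "a = 0 \<or> a = 1" for a
    by (rule sharp_val_le) (use that n in \<open>auto simp: sobolev0_def\<close>)
  then show "sharp_val n 0 = 0" "sharp_val n 1 = 0"
    using sharp_val_nonneg[OF n, of 0] sharp_val_nonneg[OF n, of 1] by (auto intro: antisym)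
qed

lemma sharp_val_knot:
  assumes t: "t > 0" and n: "n \<ge> 1" and k: "k \<le> n"
  shows "sharp_val n (knot n k t) = peak n k t"
proof (rule antisym)
  have a: "knot n k t \<in> {0..1}" using knot_range[OF t k] by simp
  show "sharp_val n (knot n k t) \<le> peak n k t"
    by (rule sharp_val_le[OF n a]) (use peak_upper_bound[OF t n k] in auto)
  have "\<bar>der (n - 1) (spline n t n) (knot n k t)\<bar> \<le> sharp_val n (knot n k t)"
    by (rule sharp_val_bound[OF n a extremal_spline(1,2)[OF t n]])
  then show "peak n k t \<le> sharp_val n (knot n k t)"
    unfolding extremal_spline(3)[OF t n k] by (simp add: abs_mult power_abs)
qed

section \<open>No local maximum between the nodes\<close>

text \<open>Put \<open>Q = 2 x (1 - x) p'\<close>, so that \<open>p' v = Q / l\<close> with the affine function \<open>l = vden n t\<close>. The sum is a signed divided difference of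
  \<open>Q / l\<close>. Write \<open>Q = l r + c M\<close> with \<open>deg r < n\<close> and \<open>M\<close> the product of the linear factors at the
  knots other than \<open>x\<^sub>k\<close>: the part \<open>r\<close> contributes nothing, and of \<open>c M / l\<close> only the term at \<open>x\<^sub>k\<close>
  remains. So only the sign of \<open>c\<close> matters. It is determined by comparing \<open>Q\<close> and \<open>M\<close> at the root of
  \<open>l\<close>, which lies outside \<open>[0,1]\<close>, or at infinity when \<open>l\<close> is constant.\<close>

lemma critical_curvature:
  assumes t: "t > 0" and k: "0 < k" "k < n"
    and S: "step_interpolant ((\<lambda>i. knot n i t) ` {..<k}) ((\<lambda>i. knot n i t) ` {k<..n}) p"
    and degp: "degree p < n"
  shows "(\<Sum>i\<le>n. (-1) ^ (k + i) * poly (pderiv p) (knot n i t) * (vel n t (knot n i t))\<^sup>2) < 0"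
proof -
  let ?X = "\<lambda>i. knot n i t"
  let ?A = "?X ` {..<k}" and ?C = "?X ` {k<..n}"
  interpret step_interpolant ?A ?C p by (rule S)
  have inj: "inj_on ?X {..n}" by (rule knot_inj[OF t])
  have cA: "card ?A = k" and cC: "card ?C = n - k"
    using k by (subst card_image; force intro: inj_on_subset[OF inj])+
  have par: "(-1) ^ (n - k) = ((-1) ^ (n + k) :: real)" using k by (simp add: minus_one_power_iff)
  have X01: "0 < ?X i" "?X i < 1" if "i \<le> n" for i using knot_range[OF t that] by auto
  define N where "N = real n + 1"
  have N: "N > 0" by (simp add: N_def)
  define l0 where "l0 = t + N * t\<^sup>2"
  define l1 where "l1 = N * (1 - t\<^sup>2)"
  have l0: "l0 > 0" using t N by (auto simp: l0_def intro!: add_pos_pos mult_pos_pos)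
  have l01: "l0 + l1 > 0" using t N by (simp add: l0_def l1_def algebra_simps)
  have vd: "vden n t x = l0 + l1 * x" for x by (simp add: vden_def l0_def l1_def N_def algebra_simps)
  define Q where "Q = [:0, 2, -2:] * pderiv p"
  have dp': "degree (pderiv p) \<le> n - 2" using degp by (simp add: degree_pderiv)
  have dQ: "degree Q \<le> n"
  proof -
    have "degree Q \<le> degree [:0, 2, -2::real:] + degree (pderiv p)" unfolding Q_def by (rule degree_mult_le)
    then show ?thesis using dp' k by simp
  qed
  have Qx: "poly Q x = 2 * x * (1 - x) * poly (pderiv p) x" for x by (simp add: Q_def algebra_simps)
  define M where "M = (\<Prod>i\<in>{..n}-{k}. [:- ?X i, 1:])"
  have Mx: "poly M x = (\<Prod>i\<in>{..n}-{k}. x - ?X i)" for x by (simp add: M_def poly_prod)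
  have cardn: "card ({..n} - {k}) = n" using k by simp
  have dM: "degree M = n" unfolding M_def by (subst degree_prod_eq_sum_degree) (use cardn in auto)
  have lM: "coeff M n = 1" unfolding dM[symmetric] by (simp add: M_def lead_coeff_prod)
  have "\<exists>c r. degree r < n \<and> (\<forall>x. poly Q x = (l0 + l1 * x) * poly r x + c * poly M x) \<and> (-1) ^ (n + k) * c < 0"
  proof (cases "l1 = 0")
    case True
    define c where "c = coeff Q n"
    define r where "r = smult (1 / l0) (Q - smult c M)"
    have "coeff r n = 0" using lM by (simp add: r_def c_def)
    moreover have "degree (Q - smult c M) \<le> n"
      by (rule degree_diff_le) (use dQ dM degree_smult_le[of c M] in auto)
    then have "degree r \<le> n" unfolding r_def using degree_smult_le order_trans by blast
    ultimately have "degree r < n" using k by (metis eq_zero_or_degree_less less_trans degree_0)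
    moreover have "poly Q x = (l0 + l1 * x) * poly r x + c * poly M x" for x
      using l0 True by (simp add: r_def)
    moreover have "(-1) ^ (n + k) * c < 0"
    proof -
      obtain m where m: "n = Suc (Suc m)" using k by (cases n; cases "n - 1") auto
      have "coeff (pderiv p) (Suc m) = 0" using dp' m by (intro coeff_eq_0) simp
      then have "c = -2 * coeff (pderiv p) (n - 2)" unfolding c_def Q_def by (simp add: m)
      moreover have "(-1) ^ (n + k) * coeff (pderiv p) (n - 2) > 0"
        using lead_coeff_sign cA cC k par by simp
      ultimately show ?thesis by simp
    qed
    ultimately show ?thesis by blast
  next
    case False
    \<comment> \<open>The pole of \<open>Q / l\<close>.\<close>
    define s where "s = - l0 / l1"
    have s0: "l0 + l1 * s = 0" using False by (simp add: s_def)
    have lin: "l0 + l1 * x = l1 * (x - s)" for x using False by (simp add: s_def algebra_simps)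
    have sg: "poly M s \<noteq> 0 \<and> (-1) ^ (n + k) * (poly Q s / poly M s) < 0"
    proof (cases "l1 > 0")
      case True
      then have s: "s < 0" using l0 by (simp add: s_def)
      have 1: "(-1) ^ k * poly (pderiv p) s > 0"
      proof -
        have "s \<le> a" if aA: "a \<in> ?A" for a
        proof -
          obtain i where "i < k" "a = ?X i" using aA by auto
          then show ?thesis using X01(1)[of i] s k by linarith
        qed
        then show ?thesis using left_pderiv_sign[of s] cA by simp
      qed
      define P where "P = (\<Prod>i\<in>{..n}-{k}. ?X i - s)"
      have M: "poly M s = (-1) ^ n * P" unfolding Mx P_def prod_diff_swap[of s] cardn ..
      have P: "P > 0" unfolding P_def by (rule prod_pos) (use X01 s in force)
      have "(-1) ^ (n + k) * (poly Q s / poly M s) = ((-1) ^ k * poly (pderiv p) s) * (2 * s * (1 - s)) / P"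
        unfolding Qx M by (simp add: power_add minus_one_power_iff)
      moreover have "\<dots> < 0"
        by (rule divide_neg_pos[OF mult_pos_neg[OF 1] P], rule mult_neg_pos) (use s in auto)
      ultimately show ?thesis using P M by simp
    next
      case False
      then have "l1 < 0" using \<open>l1 \<noteq> 0\<close> by simp
      then have s: "s > 1" using l01 by (simp add: s_def field_simps)
      have "(-1) ^ (n - k) * poly (pderiv p) s > 0"
      proof -
        have "c \<le> s" if cC: "c \<in> ?C" for c
        proof -
          obtain i where "i \<le> n" "c = ?X i" using cC by auto
          then show ?thesis using X01(2)[of i] s by linarith
        qed
        then show ?thesis using right_pderiv_sign[of s] cC by simp
      qed
      then have 1: "(-1) ^ (n + k) * poly (pderiv p) s > 0" unfolding par .
      have P: "poly M s > 0" unfolding Mx by (rule prod_pos) (use X01 s in force)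
      have "(-1) ^ (n + k) * (poly Q s / poly M s) = ((-1) ^ (n + k) * poly (pderiv p) s) * (2 * s * (1 - s)) / poly M s"
        unfolding Qx by simp
      moreover have "\<dots> < 0"
        by (rule divide_neg_pos[OF mult_pos_neg[OF 1] P], rule mult_pos_neg) (use s in auto)
      ultimately show ?thesis using P by simp
    qed
    define c where "c = poly Q s / poly M s"
    have "poly (Q - smult c M) s = 0" using sg by (simp add: c_def)
    then obtain r' where r': "Q - smult c M = [:-s, 1:] * r'" unfolding poly_eq_0_iff_dvd by (elim dvdE)
    have dd: "degree (Q - smult c M) \<le> n"
      by (rule degree_diff_le) (use dQ dM degree_smult_le[of c M] in auto)
    have "degree r' < n"
    proof (cases "r' = 0")
      case False
      have "degree ([:-s, 1:] * r') = 1 + degree r'" using False by (subst degree_mult_eq) auto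
      then show ?thesis using dd r' by simp
    qed (use k in simp)
    then have "degree (smult (1 / l1) r') < n" using degree_smult_le le_less_trans by blast
    moreover have "poly Q x = (l0 + l1 * x) * poly (smult (1 / l1) r') x + c * poly M x" for x
    proof -
      have "poly Q x = poly (Q - smult c M) x + c * poly M x" by simp
      also have "poly (Q - smult c M) x = (x - s) * poly r' x" unfolding r' by (simp add: algebra_simps)
      finally show ?thesis unfolding lin using \<open>l1 \<noteq> 0\<close> by simp
    qed
    ultimately show ?thesis using sg c_def by blast
  qed
  then obtain c r where r: "degree r < n" "\<And>x. poly Q x = (l0 + l1 * x) * poly r x + c * poly M x"
    and c: "(-1) ^ (n + k) * c < 0" by blast
  show ?thesis
  proof (rule knot_weights[OF t, where n = n])
    fix w assume w: "(-1) ^ n * w > 0"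
      and wk: "\<And>k. k \<le> n \<Longrightarrow> (-1) ^ k * vel n t (?X k) * (\<Prod>i\<in>{..n}-{k}. ?X k - ?X i) = 1 / w"
    have vp: "vden n t (?X i) > 0" if "i \<le> n" for i using vden_pos[OF t, of "?X i" n] X01[OF that] by simp
    have summand: "vel n t (?X i) * poly (pderiv p) (?X i) = poly r (?X i) + c * poly M (?X i) / vden n t (?X i)"
      if "i \<le> n" for i
    proof -
      have "vel n t (?X i) * poly (pderiv p) (?X i) = poly Q (?X i) / vden n t (?X i)"
        unfolding vel_def Qx by simp
      also have "\<dots> = (vden n t (?X i) * poly r (?X i) + c * poly M (?X i)) / vden n t (?X i)"
        unfolding r(2) vd ..
      finally show ?thesis using vp[OF that] by (simp add: add_divide_distrib)
    qed
    have M0: "poly M (?X i) = 0" if "i \<le> n" "i \<noteq> k" for i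
      unfolding Mx by (rule prod_zero) (use that in auto)
    have "(\<Sum>i\<le>n. (-1) ^ (k + i) * poly (pderiv p) (?X i) * (vel n t (?X i))\<^sup>2)
      = (-1) ^ k * (\<Sum>i\<le>n. (-1) ^ i * vel n t (?X i) * (vel n t (?X i) * poly (pderiv p) (?X i)))"
      unfolding sum_distrib_left by (rule sum.cong) (auto simp: power_add power2_eq_square)
    also have "(\<Sum>i\<le>n. (-1) ^ i * vel n t (?X i) * (vel n t (?X i) * poly (pderiv p) (?X i)))
       = (\<Sum>i\<le>n. (-1) ^ i * vel n t (?X i) * poly r (?X i))
         + (\<Sum>i\<le>n. (-1) ^ i * vel n t (?X i) * (c * poly M (?X i) / vden n t (?X i)))"
      unfolding sum.distrib[symmetric] by (rule sum.cong) (simp_all add: summand distrib_left)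
    also have "(\<Sum>i\<le>n. (-1) ^ i * vel n t (?X i) * poly r (?X i)) = 0"
      by (rule knot_weights_vanish[OF t r(1)])
    also have "(\<Sum>i\<le>n. (-1) ^ i * vel n t (?X i) * (c * poly M (?X i) / vden n t (?X i)))
       = (\<Sum>i\<in>{k}. (-1) ^ i * vel n t (?X i) * (c * poly M (?X i) / vden n t (?X i)))"
      by (rule sum.mono_neutral_right) (use k M0 in auto)
    also have "\<dots> = c / (w * vden n t (?X k))"
      using wk[of k] k by (simp add: Mx mult_ac)
    finally have eq: "(\<Sum>i\<le>n. (-1) ^ (k + i) * poly (pderiv p) (?X i) * (vel n t (?X i))\<^sup>2)
       = (-1) ^ k * (c / (w * vden n t (?X k)))" by simp
    also have "\<dots> = ((-1) ^ (n + k) * c) / (((-1) ^ n * w) * vden n t (?X k))"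
      by (simp add: power_add minus_one_power_iff)
    also have "\<dots> < 0" using vp[of k] k by (intro divide_neg_pos[OF c] mult_pos_pos[OF w]) auto
    finally show ?thesis .
  qed
qed

definition dpeak :: "nat \<Rightarrow> nat \<Rightarrow> real \<Rightarrow> real" where
  "dpeak n k t = vel n t (knot n k t) + 2 * (\<Sum>i<k. (-1) ^ (k + i) * vel n t (knot n i t))"

lemma peak_DERIV: "t > 0 \<Longrightarrow> k \<le> n \<Longrightarrow> DERIV (peak n k) t :> dpeak n k t"
  unfolding peak_def[abs_def] dpeak_def
  by (intro DERIV_add DERIV_cmult DERIV_sum knot_DERIV) auto

lemma split_at_index:
  fixes f :: "nat \<Rightarrow> real"
  assumes "k \<le> n"
  shows "(\<Sum>i\<le>n. f i) = (\<Sum>i<k. f i) + f k + (\<Sum>i\<in>{k<..n}. f i)"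
proof -
  have "{..n} = insert k ({..<k} \<union> {k<..n})" using assms by auto
  then have "(\<Sum>i\<le>n. f i) = f k + (\<Sum>i\<in>{..<k} \<union> {k<..n}. f i)" by simp
  also have "(\<Sum>i\<in>{..<k} \<union> {k<..n}. f i) = (\<Sum>i<k. f i) + (\<Sum>i\<in>{k<..n}. f i)"
    by (rule sum.union_disjoint) auto
  finally show ?thesis by simp
qed

lemma knot_weights_vanish_signed:
  assumes t: "t > 0" and q: "degree q < n"
  shows "(\<Sum>i\<le>n. (-1) ^ (k + i) * vel n t (knot n i t) * poly q (knot n i t)) = 0"
proof -
  have "(\<Sum>i\<le>n. (-1) ^ (k + i) * vel n t (knot n i t) * poly q (knot n i t))
    = (-1) ^ k * (\<Sum>i\<le>n. (-1) ^ i * vel n t (knot n i t) * poly q (knot n i t))"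
    unfolding sum_distrib_left by (rule sum.cong) (auto simp: power_add)
  then show ?thesis using knot_weights_vanish[OF t q] by simp
qed

text \<open>Since the signed velocities sum to zero, the derivative can be computed from the knots on either side. The sum over the
  later knots avoids the knot of index \<open>0\<close>, whose velocity near \<open>t = 0\<close> is not given by the formula of \<open>vel_at_0\<close>.\<close>

lemma dpeak_tail:
  assumes t: "t > 0" and n: "n \<ge> 1" and k: "k \<le> n"
  shows "dpeak n k t = - (vel n t (knot n k t) + 2 * (\<Sum>i\<in>{k<..n}. (-1) ^ (k + i) * vel n t (knot n i t)))"
proof -
  have "(\<Sum>i\<le>n. (-1) ^ (k + i) * vel n t (knot n i t) * poly 1 (knot n i t)) = 0"
    by (rule knot_weights_vanish_signed[OF t]) (use n in simp)
  then have "(\<Sum>i<k. (-1) ^ (k + i) * vel n t (knot n i t)) + vel n t (knot n k t)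
     + (\<Sum>i\<in>{k<..n}. (-1) ^ (k + i) * vel n t (knot n i t)) = 0"
    unfolding split_at_index[OF k] by (simp flip: power2_eq_square mult_2)
  then show ?thesis unfolding dpeak_def by simp
qed

lemma knot_isCont: "t > 0 \<Longrightarrow> i \<le> n \<Longrightarrow> isCont (knot n i) t"
  using knot_DERIV DERIV_isCont by blast

text \<open>At a critical point the interpolant has the value \<open>1/2\<close> at \<open>x\<^sub>k\<close>. Its values at the knots at time \<open>t0\<close> are then half the
  coefficients of the derivative of \<open>peak\<close>. Subtracting the relation that the interpolant satisfies at
  the moved knots makes the derivative a sum of increments, whose first order term is
  given by \<open>critical_curvature\<close>. So \<open>peak\<close> increases strictly to the right of \<open>t0\<close>.\<close>

lemma not_local_max_between_nodes:
  assumes t0: "t0 > 0" and n: "n \<ge> 1" and k: "k \<le> n"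
    and max: "\<forall>\<^sub>F t in at t0. peak n k t \<le> peak n k t0"
  shows False
proof -
  obtain d where d: "d > 0" "\<And>t. t \<noteq> t0 \<Longrightarrow> \<bar>t - t0\<bar> < d \<Longrightarrow> peak n k t \<le> peak n k t0"
    using max unfolding eventually_at dist_real_def by blast
  have "dpeak n k t0 = 0"
  proof (rule DERIV_local_max[OF peak_DERIV[OF t0 k] d(1)])
    show "\<forall>y. \<bar>t0 - y\<bar> < d \<longrightarrow> peak n k y \<le> peak n k t0"
      using d(2) by (metis abs_minus_commute order_refl)
  qed
  note crit = this
  let ?X = "\<lambda>i. knot n i t0"
  obtain p where p: "degree p < n" and p1: "\<And>i. i < k \<Longrightarrow> poly p (?X i) = 1"
    and p0: "\<And>i. k < i \<Longrightarrow> i \<le> n \<Longrightarrow> poly p (?X i) = 0"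
    and S: "0 < k \<Longrightarrow> k < n \<Longrightarrow> step_interpolant (?X ` {..<k}) (?X ` {k<..n}) p"
    using knot_certificate[OF t0 n k] by metis
  have vk: "vel n t0 (?X k) > 0" by (rule vel_pos[OF t0 k])
  have k0: "0 < k"
  proof (rule ccontr)
    assume "\<not> 0 < k"
    then have "dpeak n k t0 = vel n t0 (?X k)" by (simp add: dpeak_def)
    then show False using crit vk by simp
  qed
  have kn: "k < n"
  proof (rule ccontr)
    assume "\<not> k < n"
    then have "k = n" using k by simp
    then have "dpeak n k t0 = - vel n t0 (?X k)" using dpeak_tail[OF t0 n k] by simp
    then show False using crit vk by simp
  qed
  have "(\<Sum>i\<le>n. (-1) ^ (k + i) * vel n t0 (?X i) * poly p (?X i)) = 0"
    by (rule knot_weights_vanish_signed[OF t0 p])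
  moreover have "(\<Sum>i<k. (-1) ^ (k + i) * vel n t0 (?X i) * poly p (?X i)) = (\<Sum>i<k. (-1) ^ (k + i) * vel n t0 (?X i))"
    by (rule sum.cong) (use p1 in auto)
  moreover have "(\<Sum>i\<in>{k<..n}. (-1) ^ (k + i) * vel n t0 (?X i) * poly p (?X i)) = 0"
    by (rule sum.neutral) (use p0 in auto)
  ultimately have "(\<Sum>i<k. (-1) ^ (k + i) * vel n t0 (?X i)) + vel n t0 (?X k) * poly p (?X k) = 0"
    unfolding split_at_index[OF k] by (simp flip: power2_eq_square mult_2)
  then have "dpeak n k t0 = vel n t0 (?X k) * (1 - 2 * poly p (?X k))"
    unfolding dpeak_def by (simp add: algebra_simps)
  then have half: "poly p (?X k) = 1 / 2" using crit vk by simp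
  have form: "dpeak n k t = - 2 * (\<Sum>i\<le>n. (-1) ^ (k + i) * (poly p (knot n i t) - poly p (?X i)) * vel n t (knot n i t))"
    if t: "t > 0" for t
  proof -
    have "(\<Sum>i<k. (-1) ^ (k + i) * vel n t (knot n i t) * poly p (?X i)) = (\<Sum>i<k. (-1) ^ (k + i) * vel n t (knot n i t))"
      by (rule sum.cong) (use p1 in auto)
    moreover have "(\<Sum>i\<in>{k<..n}. (-1) ^ (k + i) * vel n t (knot n i t) * poly p (?X i)) = 0"
      by (rule sum.neutral) (use p0 in auto)
    ultimately have "dpeak n k t = 2 * (\<Sum>i\<le>n. (-1) ^ (k + i) * vel n t (knot n i t) * poly p (?X i))"
      unfolding split_at_index[OF k] dpeak_def using half by (simp flip: power2_eq_square mult_2)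
    also have "\<dots> = 2 * (\<Sum>i\<le>n. (-1) ^ (k + i) * vel n t (knot n i t) * poly p (?X i))
       - 2 * (\<Sum>i\<le>n. (-1) ^ (k + i) * vel n t (knot n i t) * poly p (knot n i t))"
      using knot_weights_vanish_signed[OF t p, of k] by simp
    also have "\<dots> = - 2 * (\<Sum>i\<le>n. (-1) ^ (k + i) * (poly p (knot n i t) - poly p (?X i)) * vel n t (knot n i t))"
      unfolding right_diff_distrib[symmetric] sum_subtractf[symmetric] sum_distrib_left
      by (rule sum.cong) (auto simp: algebra_simps)
    finally show ?thesis .
  qed
  \<comment> \<open>The limit of \<open>dpeak n k t / (t - t0)\<close>, that is, the second derivative of \<open>peak n k\<close> at \<open>t0\<close>.\<close>
  define \<kappa> where "\<kappa> = - 2 * (\<Sum>i\<le>n. (-1) ^ (k + i) * (poly (pderiv p) (?X i) * vel n t0 (?X i)) * vel n t0 (?X i))"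
  have "\<kappa> > 0"
    using critical_curvature[OF t0 k0 kn S[OF k0 kn] p] unfolding \<kappa>_def
    by (simp add: power2_eq_square mult.assoc)
  have velc: "((\<lambda>t. vel n t (knot n i t)) \<longlongrightarrow> vel n t0 (?X i)) (at t0)" if "i \<le> n" for i
  proof -
    have kc: "(knot n i \<longlongrightarrow> ?X i) (at t0)" using knot_isCont[OF t0 that] by (simp add: isCont_def)
    have "vden n t0 (?X i) \<noteq> 0" using vden_pos[OF t0, of "?X i" n] knot_range[OF t0 that] by simp
    then show ?thesis unfolding vel_def vden_def by (intro tendsto_intros kc)
  qed
  have quot: "((\<lambda>t. (poly p (knot n i t) - poly p (?X i)) / (t - t0)) \<longlongrightarrow> poly (pderiv p) (?X i) * vel n t0 (?X i)) (at t0)"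
    if "i \<le> n" for i
    using DERIV_chain2[OF poly_DERIV knot_DERIV[OF t0 that], of p] by (simp add: has_field_derivative_iff)
  have "((\<lambda>t. - 2 * (\<Sum>i\<le>n. (-1) ^ (k + i) * ((poly p (knot n i t) - poly p (?X i)) / (t - t0)) * vel n t (knot n i t))) \<longlongrightarrow> \<kappa>) (at t0)"
    unfolding \<kappa>_def by (intro tendsto_mult tendsto_const tendsto_sum quot velc) auto
  then have "\<forall>\<^sub>F t in at t0. - 2 * (\<Sum>i\<le>n. (-1) ^ (k + i) * ((poly p (knot n i t) - poly p (?X i)) / (t - t0)) * vel n t (knot n i t)) > 0"
    using \<open>\<kappa> > 0\<close> by (rule order_tendstoD)
  then obtain e where e: "e > 0" "\<And>t. t \<noteq> t0 \<Longrightarrow> \<bar>t - t0\<bar> < e \<Longrightarrow>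
     - 2 * (\<Sum>i\<le>n. (-1) ^ (k + i) * ((poly p (knot n i t) - poly p (?X i)) / (t - t0)) * vel n t (knot n i t)) > 0"
    unfolding eventually_at dist_real_def by blast
  have dpos: "dpeak n k t > 0" if t: "t0 < t" "t < t0 + e" for t
  proof -
    have "dpeak n k t = (t - t0) * (- 2 * (\<Sum>i\<le>n. (-1) ^ (k + i) * ((poly p (knot n i t) - poly p (?X i)) / (t - t0)) * vel n t (knot n i t)))"
    proof -
      have "(\<Sum>i\<le>n. (-1) ^ (k + i) * (poly p (knot n i t) - poly p (?X i)) * vel n t (knot n i t))
        = (t - t0) * (\<Sum>i\<le>n. (-1) ^ (k + i) * ((poly p (knot n i t) - poly p (?X i)) / (t - t0)) * vel n t (knot n i t))"
        unfolding sum_distrib_left by (rule sum.cong) (use t in \<open>auto simp: field_simps\<close>)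
      then show ?thesis using form[of t] t t0 by (simp add: mult_ac)
    qed
    also have "\<dots> > 0" by (rule mult_pos_pos) (use t e(2)[of t] in auto)
    finally show ?thesis .
  qed
  define t1 where "t1 = t0 + min d e / 2"
  have t1: "t0 < t1" "t1 < t0 + d" "t1 < t0 + e" using d(1) e(1) by (auto simp: t1_def min_def)
  have "peak n k t0 < peak n k t1"
  proof (rule DERIV_pos_imp_increasing_open[OF t1(1)])
    show "\<exists>y. DERIV (peak n k) x :> y \<and> y > 0" if "t0 < x" "x < t1" for x
      using peak_DERIV[of x k n] dpos[of x] that t0 t1 k by auto
    show "continuous_on {t0..t1} (peak n k)"
      by (intro continuous_at_imp_continuous_on ballI DERIV_isCont[OF peak_DERIV]) (use t0 k in auto)
  qed
  then show False using d(2)[of t1] t1 by auto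
qed

section \<open>Values and slopes at the nodes\<close>

text \<open>The limit of \<open>peak n k\<close> at \<open>0\<close>, and the limit of \<open>peak n (k - 1)\<close> at infinity.\<close>

definition alt_nodes :: "nat \<Rightarrow> nat \<Rightarrow> real" where
  "alt_nodes n k = node n k + 2 * (\<Sum>i<k. (-1) ^ (k + i) * node n i)"

lemma alt_nodes_Suc: "alt_nodes n (Suc k) + alt_nodes n k = node n (Suc k) - node n k"
proof -
  have "(\<Sum>i<k. (-1) ^ (Suc k + i) * node n i) = - (\<Sum>i<k. (-1) ^ (k + i) * node n i)"
    unfolding sum_negf[symmetric] by (rule sum.cong) auto
  then show ?thesis by (simp add: alt_nodes_def algebra_simps flip: mult_2)
qed

definition half_step :: "nat \<Rightarrow> real" where "half_step n = pi / (2 * (real n + 1))"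

lemma half_step: "0 < half_step n" "(real n + 1) * half_step n = pi / 2"
  by (auto simp: half_step_def field_simps)

lemma node_half_step: "node n j = (sin (real j * half_step n))\<^sup>2"
  by (simp add: node_def half_step_def mult_ac)

lemma half_step_less: assumes "n \<ge> 1" shows "half_step n < pi / 2"
proof -
  have "2 * half_step n \<le> (real n + 1) * half_step n"
    using half_step(1)[of n] assms by (intro mult_right_mono) auto
  then show ?thesis using half_step[of n] by linarith
qed

lemma node_diff:
  assumes "n \<ge> 1"
  shows "node n (Suc k) - node n k
     = tan (half_step n) / 2 * (sin (2 * (real (Suc k) * half_step n)) + sin (2 * (real k * half_step n)))"
proof -
  define h where "h = half_step n"
  define a where "a = real k * h + h / 2"
  have c: "cos h > 0" using half_step[of n] half_step_less[OF assms] by (auto simp: h_def intro!: cos_gt_zero)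
  have 1: "real (Suc k) * h = a + h / 2" "real k * h = a - h / 2" by (simp_all add: a_def algebra_simps)
  have "(sin (a + h / 2))\<^sup>2 - (sin (a - h / 2))\<^sup>2 = (cos (2 * (a - h / 2)) - cos (2 * (a + h / 2))) / 2"
    by (simp only: cos_double_sin) simp
  also have "2 * (a - h / 2) = 2 * a - h" by simp
  also have "2 * (a + h / 2) = 2 * a + h" by simp
  also have "(cos (2 * a - h) - cos (2 * a + h)) / 2 = sin (2 * a) * sin h" by (simp add: cos_add cos_diff)
  finally have l: "(sin (a + h / 2))\<^sup>2 - (sin (a - h / 2))\<^sup>2 = sin (2 * a) * sin h" .
  have e: "2 * (a + h / 2) = 2 * a + h" "2 * (a - h / 2) = 2 * a - h" by simp_all
  have "tan h / 2 * (sin (2 * (a + h / 2)) + sin (2 * (a - h / 2))) = tan h * sin (2 * a) * cos h"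
    unfolding e by (simp add: sin_add sin_diff algebra_simps)
  also have "\<dots> = sin (2 * a) * sin h" using c by (simp add: tan_def)
  finally show ?thesis unfolding node_half_step h_def[symmetric] 1 using l by simp
qed

text \<open>Neighbouring alternating sums add up to a difference of nodes, and so do the neighbouring sines on the right.\<close>

lemma alt_nodes_eq:
  assumes "n \<ge> 1"
  shows "alt_nodes n k = tan (half_step n) / 2 * sin (2 * (real k * half_step n))"
proof (induction k)
  case 0 show ?case by (simp add: alt_nodes_def)
next
  case (Suc k)
  show ?case using alt_nodes_Suc[of n k] node_diff[OF assms, of k] Suc by (simp add: distrib_left)
qed

lemma half_step_range:
  assumes "1 \<le> k" "k \<le> n"
  shows "0 < real k * half_step n" "real k * half_step n < pi / 2"
proof -
  show "0 < real k * half_step n" using half_step(1) assms by simp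
  have "real k * half_step n < (real n + 1) * half_step n"
    using half_step(1) assms by (intro mult_strict_right_mono) auto
  then show "real k * half_step n < pi / 2" using half_step(2) by simp
qed

lemma tan_half_step_pos: "n \<ge> 1 \<Longrightarrow> tan (half_step n) > 0"
  using half_step(1) half_step_less tan_gt_zero by blast

lemma alt_nodes_pos: assumes "1 \<le> k" "k \<le> n" shows "alt_nodes n k > 0"
proof -
  have n: "n \<ge> 1" using assms by simp
  have "sin (2 * (real k * half_step n)) > 0"
    using half_step_range[OF assms] by (intro sin_gt_zero) auto
  then show ?thesis unfolding alt_nodes_eq[OF n] using tan_half_step_pos[OF n] by simp
qed

lemma alt_nodes_B:
  assumes "1 \<le> k" "k \<le> n"
  shows "alt_nodes n k = B n (node n k)"
proof -
  define u where "u = real k * half_step n"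
  have u: "0 < u" "u < pi / 2" using half_step_range[OF assms] by (auto simp: u_def)
  have sc: "sin u > 0" "cos u > 0" using u sin_gt_zero2 cos_gt_zero by blast+
  have "node n k - (node n k)\<^sup>2 = (sin u)\<^sup>2 * (1 - (sin u)\<^sup>2)"
    unfolding node_half_step u_def[symmetric] by (simp add: power2_eq_square algebra_simps)
  also have "\<dots> = (sin u * cos u)\<^sup>2" by (simp add: power_mult_distrib cos_squared_eq)
  finally have "sqrt (node n k - (node n k)\<^sup>2) = sin u * cos u" using sc by simp
  then have "B n (node n k) = tan (half_step n) * (sin u * cos u)" by (simp add: B_def half_step_def)
  moreover have "alt_nodes n k = tan (half_step n) / 2 * sin (2 * u)"
    unfolding u_def by (rule alt_nodes_eq) (use assms in simp)
  ultimately show ?thesis by (simp add: sin_double)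
qed

lemma peak_at_0: "k \<le> n \<Longrightarrow> (peak n k \<longlongrightarrow> alt_nodes n k) (at_right 0)"
  unfolding peak_def[abs_def] alt_nodes_def by (intro tendsto_intros knot_at_0) auto

lemma peak_at_top: 
  assumes "k \<le> n"
  shows "(peak n k \<longlongrightarrow> alt_nodes n (Suc k)) at_top"
proof -
  have "(peak n k \<longlongrightarrow> node n (Suc k) + 2 * (\<Sum>i<k. (-1) ^ (k + i) * node n (Suc i))) at_top"
    unfolding peak_def[abs_def] by (intro tendsto_intros knot_at_top) (use assms in auto)
  moreover have "(\<Sum>i<Suc k. (-1) ^ (Suc k + i) * node n i) = (\<Sum>i<k. (-1) ^ (k + i) * node n (Suc i))"
    unfolding sum.lessThan_Suc_shift by simp
  ultimately show ?thesis unfolding alt_nodes_def by simp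
qed

lemma sharp_val_tendsto:
  assumes n: "n \<ge> 1" and l: "l \<in> {0..1}" and f: "(f \<longlongrightarrow> l) F" and ev: "\<forall>\<^sub>F t in F. f t \<in> {0..1}"
  shows "((\<lambda>t. sharp_val n (f t)) \<longlongrightarrow> sharp_val n l) F"
proof (rule LIM_zero_cancel, rule Lim_null_comparison)
  show "\<forall>\<^sub>F t in F. norm (sharp_val n (f t) - sharp_val n l) \<le> \<bar>f t - l\<bar>"
    using ev by eventually_elim (use sharp_val_lipschitz[OF n _ l] in auto)
  show "((\<lambda>t. \<bar>f t - l\<bar>) \<longlongrightarrow> 0) F" using f by (intro tendsto_rabs_zero LIM_zero)
qed

lemma node_range: "j \<le> Suc n \<Longrightarrow> node n j \<in> {0..1}"
  by (simp add: node_def abs_square_le_1)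

text \<open>The sharp constant is continuous and known at the knots, which tend to the node.\<close>

lemma sharp_val_node:
  assumes n: "n \<ge> 1" and k: "k \<le> n"
  shows "sharp_val n (node n k) = alt_nodes n k"
proof (rule tendsto_unique[OF trivial_limit_at_right_real _ peak_at_0[OF k]])
  have pos: "\<forall>\<^sub>F t in at_right 0. (t::real) > 0" by (simp add: eventually_at_right_less)
  have "((\<lambda>t. sharp_val n (knot n k t)) \<longlongrightarrow> sharp_val n (node n k)) (at_right 0)"
    by (rule sharp_val_tendsto[OF n _ knot_at_0[OF k]])
       (use node_range k pos in \<open>auto elim!: eventually_mono intro: less_imp_le knot_range\<close>)
  then show "(peak n k \<longlongrightarrow> sharp_val n (node n k)) (at_right 0)"
    by (rule Lim_transform_eventually) (use pos in \<open>eventually_elim, use sharp_val_knot[OF _ n k] in auto\<close>)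
qed

lemma vel_at_0:
  assumes i: "1 \<le> i" "i \<le> n"
  shows "((\<lambda>t. vel n t (knot n i t)) \<longlongrightarrow> 2 * (1 - node n i) / (real n + 1)) (at_right 0)"
proof -
  have x: "node n i > 0" using node_strict_mono[of 0 i n] i by simp
  have id: "((\<lambda>t. t) \<longlongrightarrow> (0::real)) (at_right 0)" by (rule tendsto_ident_at)
  have "((\<lambda>t. vel n t (knot n i t)) \<longlongrightarrow> 2 * node n i * (1 - node n i) /
      (0 + (real n + 1) * (node n i + 0\<^sup>2 * (1 - node n i)))) (at_right 0)"
    unfolding vel_def vden_def
    by (intro tendsto_intros knot_at_0 id) (use i x in auto)
  moreover have "2 * node n i * (1 - node n i) / (0 + (real n + 1) * (node n i + 0\<^sup>2 * (1 - node n i)))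
     = 2 * (1 - node n i) / (real n + 1)" using x by simp
  ultimately show ?thesis by simp
qed

lemma vel_at_top:
  assumes i: "i < n"
  shows "((\<lambda>t. t\<^sup>2 * vel n t (knot n i t)) \<longlongrightarrow> 2 * node n (Suc i) / (real n + 1)) at_top"
proof -
  have x: "node n (Suc i) < 1" using node_strict_mono[of "Suc i" "Suc n" n] i by simp
  have kt: "(knot n i \<longlongrightarrow> node n (Suc i)) at_top" using knot_at_top i by simp
  have inv: "((\<lambda>t. 1 / t) \<longlongrightarrow> (0::real)) at_top"
    using tendsto_inverse_0_at_top[OF filterlim_ident] by (simp add: inverse_eq_divide)
  have "((\<lambda>t. 2 * knot n i t * (1 - knot n i t) / (1 / t + (real n + 1) * ((1 / t)\<^sup>2 * knot n i t + (1 - knot n i t))))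
      \<longlongrightarrow> 2 * node n (Suc i) * (1 - node n (Suc i)) /
      (0 + (real n + 1) * (0\<^sup>2 * node n (Suc i) + (1 - node n (Suc i))))) at_top"
    by (intro tendsto_intros kt inv) (use x in auto)
  moreover have "2 * node n (Suc i) * (1 - node n (Suc i)) /
      (0 + (real n + 1) * (0\<^sup>2 * node n (Suc i) + (1 - node n (Suc i)))) = 2 * node n (Suc i) / (real n + 1)"
    using x by simp
  ultimately have L: "((\<lambda>t. 2 * knot n i t * (1 - knot n i t) / (1 / t + (real n + 1) * ((1 / t)\<^sup>2 * knot n i t + (1 - knot n i t))))
      \<longlongrightarrow> 2 * node n (Suc i) / (real n + 1)) at_top" by simp
  show ?thesis
  proof (rule Lim_transform_eventually[OF L])
    show "\<forall>\<^sub>F t in at_top. 2 * knot n i t * (1 - knot n i t) / (1 / t + (real n + 1) * ((1 / t)\<^sup>2 * knot n i t + (1 - knot n i t)))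
       = t\<^sup>2 * vel n t (knot n i t)"
      using eventually_gt_at_top[of 0]
    proof eventually_elim
      case (elim t)
      have "vden n t (knot n i t) = t\<^sup>2 * (1 / t + (real n + 1) * ((1 / t)\<^sup>2 * knot n i t + (1 - knot n i t)))"
        using elim by (simp add: vden_def field_simps power2_eq_square)
      then show ?case using elim by (simp add: vel_def)
    qed
  qed
qed

text \<open>The alternating sum over the later nodes, measured from the endpoint \<open>1\<close>, satisfies the same recursion as
  \<open>alt_nodes\<close>, and both vanish at the last node.\<close>

lemma alt_nodes_tail:
  assumes n: "n \<ge> 1" and k: "k \<le> Suc n"
  shows "alt_nodes n k = (1 - node n k) + 2 * (\<Sum>i\<in>{k<..n}. (-1) ^ (k + i) * (1 - node n i))"
  using k
proof (induction k rule: inc_induct)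
  case base
  have "2 * (real (Suc n) * half_step n) = pi" using half_step(2)[of n] by (simp add: add.commute)
  then show ?case unfolding alt_nodes_eq[OF n] by simp
next
  case (step k)
  have "(\<Sum>i\<in>{k<..n}. (-1) ^ (k + i) * (1 - node n i))
     = - (1 - node n (Suc k)) - (\<Sum>i\<in>{Suc k<..n}. (-1) ^ (Suc k + i) * (1 - node n i))"
  proof (cases "k = n")
    case True then show ?thesis by simp
  next
    case False
    then have "{k<..n} = insert (Suc k) {Suc k<..n}" using step.hyps by auto
    then show ?thesis by (simp add: sum_negf[symmetric])
  qed
  then show ?case using step.IH alt_nodes_Suc[of n k] by simp
qed

text \<open>For indices \<open>i > 0\<close> the velocities tend to multiples of \<open>1 - node n i\<close>, so the formula of \<open>dpeak_tail\<close> leads to \<open>alt_nodes_tail\<close>.\<close>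

lemma dpeak_at_0:
  assumes k: "1 \<le> k" "k \<le> n"
  shows "(dpeak n k \<longlongrightarrow> - (2 / (real n + 1) * alt_nodes n k)) (at_right 0)"
proof -
  have n: "n \<ge> 1" using k by simp
  have "((\<lambda>t. - (vel n t (knot n k t) + 2 * (\<Sum>i\<in>{k<..n}. (-1) ^ (k + i) * vel n t (knot n i t))))
     \<longlongrightarrow> - (2 * (1 - node n k) / (real n + 1) + 2 * (\<Sum>i\<in>{k<..n}. (-1) ^ (k + i) * (2 * (1 - node n i) / (real n + 1))))) (at_right 0)"
    by (intro tendsto_intros vel_at_0) (use k in auto)
  also have "2 * (1 - node n k) / (real n + 1) + 2 * (\<Sum>i\<in>{k<..n}. (-1) ^ (k + i) * (2 * (1 - node n i) / (real n + 1)))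
     = 2 / (real n + 1) * alt_nodes n k"
  proof -
    have "(\<Sum>i\<in>{k<..n}. (-1) ^ (k + i) * (2 * (1 - node n i) / (real n + 1)))
      = 2 / (real n + 1) * (\<Sum>i\<in>{k<..n}. (-1) ^ (k + i) * (1 - node n i))"
      unfolding sum_distrib_left by (rule sum.cong) simp_all
    then show ?thesis using alt_nodes_tail[OF n, of k] k by (simp add: distrib_left)
  qed
  finally show ?thesis
    by (rule Lim_transform_eventually)
       (use eventually_at_right_less[of 0] in \<open>eventually_elim, use dpeak_tail[OF _ n k(2)] in auto\<close>)
qed

text \<open>The factor \<open>t\<^sup>2\<close> compensates for the knots slowing down.\<close>

lemma dpeak_at_top:
  assumes k: "k < n"
  shows "((\<lambda>t. t\<^sup>2 * dpeak n k t) \<longlongrightarrow> 2 / (real n + 1) * alt_nodes n (Suc k)) at_top"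
proof -
  have "((\<lambda>t. t\<^sup>2 * vel n t (knot n k t) + 2 * (\<Sum>i<k. (-1) ^ (k + i) * (t\<^sup>2 * vel n t (knot n i t))))
     \<longlongrightarrow> 2 * node n (Suc k) / (real n + 1) + 2 * (\<Sum>i<k. (-1) ^ (k + i) * (2 * node n (Suc i) / (real n + 1)))) at_top"
    by (intro tendsto_intros vel_at_top) (use k in auto)
  moreover have "(\<Sum>i<Suc k. (-1) ^ (Suc k + i) * node n i) = (\<Sum>i<k. (-1) ^ (k + i) * node n (Suc i))"
    unfolding sum.lessThan_Suc_shift by simp
  then have "2 * node n (Suc k) / (real n + 1) + 2 * (\<Sum>i<k. (-1) ^ (k + i) * (2 * node n (Suc i) / (real n + 1)))
     = 2 / (real n + 1) * alt_nodes n (Suc k)"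
    unfolding alt_nodes_def by (simp add: distrib_left sum_distrib_left mult_ac)
  moreover have "(\<lambda>t. t\<^sup>2 * vel n t (knot n k t) + 2 * (\<Sum>i<k. (-1) ^ (k + i) * (t\<^sup>2 * vel n t (knot n i t))))
     = (\<lambda>t. t\<^sup>2 * dpeak n k t)"
    by (simp add: fun_eq_iff dpeak_def distrib_left sum_distrib_left mult_ac)
  ultimately show ?thesis by simp
qed

section \<open>Local and global maxima\<close>

lemma knot_increasing:
  assumes "0 < s" "s < t" "i \<le> n" shows "knot n i s < knot n i t"
proof (rule DERIV_pos_imp_increasing[OF assms(2)])
  fix x assume "s \<le> x" "x \<le> t"
  then have "x > 0" using assms(1) by simp
  then show "\<exists>y. DERIV (knot n i) x :> y \<and> y > 0"
    using knot_DERIV[of x i n] vel_pos[of x i n] assms(3) by blast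
qed

lemma peak_le_alt_nodes_at_0:
  assumes k: "1 \<le> k" "k \<le> n"
  obtains \<delta> where "\<delta> > 0" "\<And>t. 0 < t \<Longrightarrow> t < \<delta> \<Longrightarrow> peak n k t \<le> alt_nodes n k"
proof -
  have "- (2 / (real n + 1) * alt_nodes n k) < 0" using alt_nodes_pos[OF k] by simp
  from order_tendstoD(2)[OF dpeak_at_0[OF k] this]
  obtain \<delta> where d: "\<delta> > 0" "\<And>t. 0 < t \<Longrightarrow> t < \<delta> \<Longrightarrow> dpeak n k t < 0"
    unfolding eventually_at_right_field by auto
  have "peak n k t \<le> alt_nodes n k" if t: "0 < t" "t < \<delta>" for t
  proof (rule tendsto_lowerbound[OF peak_at_0[OF k(2)]])
    have "\<forall>\<^sub>F s in at_right 0. s \<in> {0<..<t}" by (rule eventually_at_right_real[OF t(1)])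
    then show "\<forall>\<^sub>F s in at_right 0. peak n k t \<le> peak n k s"
    proof eventually_elim
      case (elim s)
      have "peak n k s > peak n k t"
      proof (rule DERIV_neg_imp_decreasing[where f = "peak n k" and a = s and b = t])
        show "s < t" using elim by simp
        show "\<exists>y. DERIV (peak n k) x :> y \<and> y < 0" if "s \<le> x" "x \<le> t" for x
          using peak_DERIV[of x k n] d(2)[of x] k t elim that by auto
      qed
      then show ?case by simp
    qed
  qed simp
  then show thesis using that d(1) by blast
qed

lemma peak_le_alt_nodes_at_top:
  assumes k: "k < n"
  obtains T where "T > 0" "\<And>t. T < t \<Longrightarrow> peak n k t \<le> alt_nodes n (Suc k)"
proof -
  have "2 / (real n + 1) * alt_nodes n (Suc k) > 0" using alt_nodes_pos[of "Suc k" n] k by simp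
  from order_tendstoD(1)[OF dpeak_at_top[OF k] this]
  obtain T0 where T0: "\<And>t. T0 \<le> t \<Longrightarrow> 0 < t\<^sup>2 * dpeak n k t"
    unfolding eventually_at_top_linorder by auto
  define T where "T = max T0 1"
  have dp: "dpeak n k t > 0" if "T \<le> t" for t
    using T0[of t] that by (simp add: T_def zero_less_mult_iff)
  have T: "T > 0" by (simp add: T_def)
  have "peak n k t \<le> alt_nodes n (Suc k)" if t: "T < t" for t
  proof (rule tendsto_lowerbound[OF peak_at_top])
    show "k \<le> n" using k by simp
    show "\<forall>\<^sub>F s in at_top. peak n k t \<le> peak n k s"
      using eventually_gt_at_top[of t]
    proof eventually_elim
      case (elim s)
      have "peak n k t < peak n k s"
      proof (rule DERIV_pos_imp_increasing[OF elim])
        show "\<exists>y. DERIV (peak n k) x :> y \<and> y > 0" if "t \<le> x" "x \<le> s" for x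
          using peak_DERIV[of x k n] dp[of x] k t T that by auto
      qed
      then show ?case by simp
    qed
  qed simp
  then show thesis using that T by blast
qed

text \<open>To the right of the node lie knots of index \<open>k\<close> at small times, where \<open>peak\<close> decreases from its limit; to the left lie
  knots of index \<open>k - 1\<close> at large times, where \<open>peak\<close> increases to the same limit.\<close>

lemma node_local_max:
  assumes k: "1 \<le> k" "k \<le> n"
  obtains l r where "l < node n k" "node n k < r" "\<And>x. l < x \<Longrightarrow> x < r \<Longrightarrow> sharp_val n x \<le> sharp_val n (node n k)"
proof -
  have n: "n \<ge> 1" using k by simp
  have val: "sharp_val n (node n k) = alt_nodes n k" by (rule sharp_val_node[OF n k(2)])
  obtain \<delta> where d: "\<delta> > 0" "\<And>t. 0 < t \<Longrightarrow> t < \<delta> \<Longrightarrow> peak n k t \<le> alt_nodes n k"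
    using peak_le_alt_nodes_at_0[OF k] by blast
  define m where "m = k - 1"
  have m: "m < n" "m \<le> n" "Suc m = k" using k by (auto simp: m_def)
  obtain T where T: "T > 0" "\<And>t. T < t \<Longrightarrow> peak n m t \<le> alt_nodes n k"
    using peak_le_alt_nodes_at_top[OF m(1)] m(3) by metis
  define r where "r = knot n k \<delta>"
  define l where "l = knot n m T"
  have r: "node n k < r" "r < node n (Suc k)" using knot_between_nodes[OF d(1) k(2)] by (auto simp: r_def)
  have l: "node n m < l" "l < node n k" using knot_between_nodes[OF T(1) m(2)] m(3) by (auto simp: l_def)
  have "sharp_val n x \<le> sharp_val n (node n k)" if x: "l < x" "x < r" for x
  proof (cases x "node n k" rule: linorder_cases)
    case less
    obtain t where t: "t > 0" "knot n m t = x" using knot_surj[OF m(2), of x] less l x m(3) by auto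
    have "T < t" using knot_increasing[of t T m n] t x(1) m(2) unfolding l_def
      by (cases t T rule: linorder_cases) auto
    then show ?thesis using T(2)[of t] sharp_val_knot[OF t(1) n m(2)] t(2) val by simp
  next
    case greater
    obtain t where t: "t > 0" "knot n k t = x" using knot_surj[OF k(2), of x] greater r x by auto
    have "t < \<delta>" using knot_increasing[of \<delta> t k n] t x(2) k(2) d(1) unfolding r_def
      by (cases t \<delta> rule: linorder_cases) auto
    then show ?thesis using d(2)[of t] sharp_val_knot[OF t(1) n k(2)] t val by simp
  qed simp
  then show thesis using that l(2) r(1) by blast
qed

abbreviation local_maxima :: "nat \<Rightarrow> real set" where
  "local_maxima n \<equiv> local_max_points {0..1} (sharp_const n (n - 1))"

abbreviation global_maxima :: "nat \<Rightarrow> real set" where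
  "global_maxima n \<equiv> global_max_points {0..1} (sharp_const n (n - 1))"

lemma local_max_sharp_iff:
  assumes n: "n \<ge> 1"
  shows "a \<in> local_maxima n \<longleftrightarrow>
    a \<in> {0..1} \<and> (\<exists>d>0. \<forall>x\<in>{0..1}. \<bar>x - a\<bar> < d \<longrightarrow> sharp_val n x \<le> sharp_val n a)"
proof -
  have "(\<forall>\<^sub>F x in at a within {0..1}. sharp_const n (n - 1) x \<le> sharp_const n (n - 1) a) \<longleftrightarrow>
     (\<exists>d>0. \<forall>x\<in>{0..1}. \<bar>x - a\<bar> < d \<longrightarrow> sharp_val n x \<le> sharp_val n a)" if a: "a \<in> {0..1}"
  proof -
    have "(\<forall>\<^sub>F x in at a within {0..1}. sharp_const n (n - 1) x \<le> sharp_const n (n - 1) a) \<longleftrightarrow>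
     (\<exists>d>0. \<forall>x\<in>{0..1}. x \<noteq> a \<and> dist x a < d \<longrightarrow> sharp_const n (n - 1) x \<le> sharp_const n (n - 1) a)"
      by (rule eventually_at)
    also have "\<dots> \<longleftrightarrow> (\<exists>d>0. \<forall>x\<in>{0..1}. \<bar>x - a\<bar> < d \<longrightarrow> sharp_val n x \<le> sharp_val n a)"
    proof (rule ex_cong1, rule conj_cong[OF refl], rule ball_cong[OF refl])
      fix d x :: real assume "x \<in> {0..1}"
      then show "(x \<noteq> a \<and> dist x a < d \<longrightarrow> sharp_const n (n - 1) x \<le> sharp_const n (n - 1) a) \<longleftrightarrow>
          (\<bar>x - a\<bar> < d \<longrightarrow> sharp_val n x \<le> sharp_val n a)"
        using sharp_const_eq[OF n, of x] sharp_const_eq[OF n a] by (auto simp: dist_real_def)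
    qed
    finally show ?thesis .
  qed
  then show ?thesis unfolding local_max_points_def by blast
qed

lemma between_nodes:
  assumes n: "n \<ge> 1" and a: "0 < a" "a < 1" "a \<notin> node n ` {1..n}"
  obtains k where "k \<le> n" "node n k < a" "a < node n (Suc k)"
proof -
  define k where "k = (GREATEST j. j \<le> n \<and> node n j \<le> a)"
  have k: "k \<le> n \<and> node n k \<le> a"
    unfolding k_def by (rule GreatestI_nat[of _ 0 n]) (use a in auto)
  have mx: "j \<le> k" if "j \<le> n" "node n j \<le> a" for j
    unfolding k_def by (rule Greatest_le_nat[of _ _ n]) (use that in auto)
  have "node n k \<noteq> a" using a k by (cases "k = 0") auto
  moreover have "a < node n (Suc k)"
    using mx[of "Suc k"] k a(2) by (cases "k = n") (auto simp: not_le[symmetric])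
  ultimately show thesis using that k by force
qed

text \<open>The endpoints are excluded because the sharp constant vanishes there and is positive nearby.\<close>

lemma local_max_imp_node:
  assumes n: "n \<ge> 1" and a: "a \<in> local_maxima n"
  shows "a \<in> node n ` {1..n}"
proof (rule ccontr)
  assume na: "a \<notin> node n ` {1..n}"
  obtain d where a01: "a \<in> {0..1}" and d: "d > 0"
    "\<And>x. x \<in> {0..1} \<Longrightarrow> \<bar>x - a\<bar> < d \<Longrightarrow> sharp_val n x \<le> sharp_val n a"
    using a unfolding local_max_sharp_iff[OF n] by blast
  consider "a = 0" | "a = 1" | "0 < a" "a < 1" using a01 by fastforce
  then show False
  proof cases
    case 1
    have "\<forall>\<^sub>F t in at_right 0. knot n 0 t < d"
      using order_tendstoD(2)[OF knot_at_0[of 0 n]] d(1) by simp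
    then have "\<forall>\<^sub>F t in at_right 0. knot n 0 t < d \<and> t > 0"
      using eventually_at_right_less by (rule eventually_conj)
    then obtain t where t: "knot n 0 t < d" "t > 0"
      using eventually_happens[of _ "at_right (0::real)"] by auto
    have x: "0 < knot n 0 t" "knot n 0 t < 1" using knot_range[OF t(2), of 0 n] by auto
    then have "sharp_val n (knot n 0 t) \<le> 0" using d(2)[of "knot n 0 t"] 1 t(1) sharp_val_endpoints(1)[OF n] by simp
    moreover have "sharp_val n (knot n 0 t) = knot n 0 t"
      using sharp_val_knot[OF t(2) n, of 0] by (simp add: peak_def)
    ultimately show False using x by simp
  next
    case 2
    have "\<forall>\<^sub>F t in at_top. 1 - d < knot n n t"
      using order_tendstoD(1)[OF knot_at_top[of n n]] d(1) by simp
    then have "\<forall>\<^sub>F t in at_top. 1 - d < knot n n t \<and> t > 0"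
      using eventually_gt_at_top by (rule eventually_conj)
    then obtain t where t: "1 - d < knot n n t" "t > 0"
      using eventually_happens[of _ "at_top :: real filter"] by auto
    have x: "0 < knot n n t" "knot n n t < 1" using knot_range[OF t(2), of n n] by auto
    have "sharp_val n (knot n n t) \<le> 0" using d(2)[of "knot n n t"] 2 t(1) x sharp_val_endpoints(2)[OF n] by simp
    then have "peak n n t \<le> 0" using sharp_val_knot[OF t(2) n order_refl] by simp
    moreover have "peak n n (t + 1) < peak n n t"
    proof (rule DERIV_neg_imp_decreasing[where f = "peak n n" and a = t and b = "t + 1"])
      show "\<exists>y. DERIV (peak n n) x :> y \<and> y < 0" if "t \<le> x" "x \<le> t + 1" for x
        using peak_DERIV[of x n n] dpeak_tail[of x n n] vel_pos[of x n n] n t(2) that by auto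
    qed simp
    moreover have "peak n n (t + 1) \<ge> 0"
      using sharp_val_knot[of "t + 1" n n] sharp_val_nonneg[OF n, of "knot n n (t + 1)"]
        knot_range[of "t + 1" n n] n t(2) by simp
    ultimately show False by simp
  next
    case 3
    obtain k where k: "k \<le> n" "node n k < a" "a < node n (Suc k)" using between_nodes[OF n 3 na] .
    obtain t0 where t0: "t0 > 0" "knot n k t0 = a" using knot_surj[OF k] .
    have "(knot n k \<longlongrightarrow> a) (at t0)" using knot_isCont[OF t0(1) k(1)] t0(2) by (simp add: isCont_def)
    then have "\<forall>\<^sub>F t in at t0. dist (knot n k t) a < d" using d(1) by (rule tendstoD)
    moreover have "\<forall>\<^sub>F t in at t0. t > 0" using order_tendstoD(1)[OF tendsto_ident_at t0(1)] .
    ultimately have "\<forall>\<^sub>F t in at t0. peak n k t \<le> peak n k t0"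
    proof eventually_elim
      case (elim t)
      have "knot n k t \<in> {0..1}" using knot_range[OF elim(2) k(1)] by simp
      then have "sharp_val n (knot n k t) \<le> sharp_val n a" using d(2) elim(1) by (simp add: dist_real_def)
      then show ?case using sharp_val_knot[OF elim(2) n k(1)] sharp_val_knot[OF t0(1) n k(1)] t0(2) by simp
    qed
    then show False by (rule not_local_max_between_nodes[OF t0(1) n k(1)])
  qed
qed

lemma local_max_points_sharp:
  assumes n: "n \<ge> 1"
  shows "local_maxima n = node n ` {1..n}"
proof
  show "local_maxima n \<subseteq> node n ` {1..n}"
    using local_max_imp_node[OF n] by blast
  show "node n ` {1..n} \<subseteq> local_maxima n"
  proof safe
    fix k assume "k \<in> {1..n}"
    then have k: "1 \<le> k" "k \<le> n" by auto
    obtain l r where lr: "l < node n k" "node n k < r"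
      "\<And>x. l < x \<Longrightarrow> x < r \<Longrightarrow> sharp_val n x \<le> sharp_val n (node n k)"
      using node_local_max[OF k] by blast
    have "sharp_val n x \<le> sharp_val n (node n k)" if "\<bar>x - node n k\<bar> < min (node n k - l) (r - node n k)" for x
      using that by (intro lr(3)) auto
    then show "node n k \<in> local_maxima n"
      unfolding local_max_sharp_iff[OF n] using node_range[of k n] k lr(1,2)
      by (auto intro!: exI[of _ "min (node n k - l) (r - node n k)"])
  qed
qed

lemma global_max_sharp_iff:
  assumes n: "n \<ge> 1"
  shows "a \<in> global_maxima n \<longleftrightarrow>
    a \<in> {0..1} \<and> (\<forall>x\<in>{0..1}. sharp_val n x \<le> sharp_val n a)"
  unfolding global_max_points_def is_arg_max_def
  using sharp_const_eq[OF n] by (auto simp: not_less)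

lemma sharp_val_nodes: "1 \<le> j \<Longrightarrow> j \<le> n \<Longrightarrow> sharp_val n (node n j) = B n (node n j)"
  using sharp_val_node[of n j] alt_nodes_B[of j n] by simp

text \<open>Because \<open>a - a\<^sup>2 = 1/4 - (a - 1/2)\<^sup>2\<close>, larger values of \<open>B\<close> belong to points closer to \<open>1/2\<close>.\<close>

lemma B_le_iff:
  assumes n: "n \<ge> 1" and a: "a \<in> {0..1}" and b: "b \<in> {0..1}"
  shows "B n a \<le> B n b \<longleftrightarrow> \<bar>b - 1 / 2\<bar> \<le> \<bar>a - 1 / 2\<bar>"
proof -
  have t: "tan (pi / (2 * (real n + 1))) > 0" using tan_half_step_pos[OF n] by (simp add: half_step_def)
  have e: "x - x\<^sup>2 = 1 / 4 - \<bar>x - 1 / 2\<bar>\<^sup>2" for x :: real by (simp add: power2_eq_square algebra_simps)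
  have "B n a \<le> B n b \<longleftrightarrow> a - a\<^sup>2 \<le> b - b\<^sup>2" unfolding B_def using t by simp
  also have "\<dots> \<longleftrightarrow> \<bar>b - 1 / 2\<bar>\<^sup>2 \<le> \<bar>a - 1 / 2\<bar>\<^sup>2" unfolding e by simp
  also have "\<dots> \<longleftrightarrow> \<bar>b - 1 / 2\<bar> \<le> \<bar>a - 1 / 2\<bar>" by (simp add: abs_le_square_iff)
  finally show ?thesis .
qed

text \<open>A maximiser exists by compactness, and it is a local maximum, hence a node; it remains to compare the nodes.\<close>

lemma global_max_points_sharp:
  assumes n: "n \<ge> 1"
  shows "global_maxima n =
    {a \<in> node n ` {1..n}. \<forall>b \<in> node n ` {1..n}. \<bar>a - 1 / 2\<bar> \<le> \<bar>b - 1 / 2\<bar>}"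
proof -
  let ?V = "node n ` {1..n}"
  have V01: "b \<in> {0..1}" if "b \<in> ?V" for b using that node_range[of _ n] by auto
  have VB: "sharp_val n b = B n b" if "b \<in> ?V" for b using that sharp_val_nodes by auto
  have gl: "a \<in> ?V" if "a \<in> {0..1}" "\<And>x. x \<in> {0..1} \<Longrightarrow> sharp_val n x \<le> sharp_val n a" for a
  proof -
    have "a \<in> local_maxima n"
      unfolding local_max_sharp_iff[OF n] using that by (auto intro!: exI[of _ 1])
    then show ?thesis by (rule local_max_imp_node[OF n])
  qed
  have "continuous_on {0..1} (sharp_val n)"
    unfolding continuous_on_iff
  proof (intro ballI allI impI)
    fix x e :: real assume "x \<in> {0..1}" "e > 0"
    then show "\<exists>d>0. \<forall>x'\<in>{0..1}. dist x' x < d \<longrightarrow> dist (sharp_val n x') (sharp_val n x) < e"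
      using sharp_val_lipschitz[OF n, of _ x] by (intro exI[of _ e]) (force simp: dist_real_def)
  qed
  then obtain m where m: "m \<in> {0..1}" "\<And>x. x \<in> {0..1} \<Longrightarrow> sharp_val n x \<le> sharp_val n m"
    using continuous_attains_sup[of "{0..1::real}" "sharp_val n"] by auto
  have mV: "m \<in> ?V" by (rule gl[OF m])
  show ?thesis
  proof (intro set_eqI iffI)
    fix a assume "a \<in> global_maxima n"
    then have a: "a \<in> {0..1}" "\<And>x. x \<in> {0..1} \<Longrightarrow> sharp_val n x \<le> sharp_val n a"
      unfolding global_max_sharp_iff[OF n] by auto
    have aV: "a \<in> ?V" by (rule gl[OF a])
    have "\<bar>a - 1 / 2\<bar> \<le> \<bar>b - 1 / 2\<bar>" if "b \<in> ?V" for b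
      using a(2)[OF V01[OF that]] VB[OF that] VB[OF aV] B_le_iff[OF n V01[OF that] a(1)] by simp
    then show "a \<in> {a \<in> ?V. \<forall>b \<in> ?V. \<bar>a - 1 / 2\<bar> \<le> \<bar>b - 1 / 2\<bar>}" using aV by blast
  next
    fix a assume "a \<in> {a \<in> ?V. \<forall>b \<in> ?V. \<bar>a - 1 / 2\<bar> \<le> \<bar>b - 1 / 2\<bar>}"
    then have aV: "a \<in> ?V" and min: "\<bar>a - 1 / 2\<bar> \<le> \<bar>m - 1 / 2\<bar>" using mV by auto
    have "sharp_val n m \<le> sharp_val n a"
      using min B_le_iff[OF n V01[OF mV] V01[OF aV]] VB[OF mV] VB[OF aV] by simp
    then show "a \<in> global_maxima n"
      unfolding global_max_sharp_iff[OF n] using V01[OF aV] m(2) order_trans by blast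
  qed
qed

lemma node_reflect:
  assumes "i + j = n + 1" shows "node n i + node n j = 1"
proof -
  have "(real i + real j) * half_step n = pi / 2" using half_step(2)[of n] assms
    by (metis of_nat_1 of_nat_add)
  then have "real j * half_step n = pi / 2 - real i * half_step n" by (simp add: algebra_simps)
  then have "sin (real j * half_step n) = cos (real i * half_step n)" by (simp add: sin_diff)
  then show ?thesis by (simp add: node_half_step)
qed

text \<open>For a continuous function a strict inequality at one point persists on an interval, which is not negligible.\<close>

lemma abs_le_Linf_norm:
  assumes c: "continuous_on {0..1} f" and x: "x \<in> {0..1}"
  shows "ereal \<bar>f x\<bar> \<le> Linf_norm f"
proof (rule ccontr)
  assume "\<not> ereal \<bar>f x\<bar> \<le> Linf_norm f"
  then have lt: "Linf_norm f < ereal \<bar>f x\<bar>" by simp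
  have "AE y in lebesgue_on {0..1}. ereal \<bar>f y\<bar> \<le> Linf_norm f"
    unfolding Linf_norm_def by (rule esssup_AE)
  then obtain N where N: "negligible N" "\<And>y. y \<in> {0..1} - N \<Longrightarrow> ereal \<bar>f y\<bar> \<le> Linf_norm f"
    using AE_unit_interval_negligible by blast
  have "(f \<longlongrightarrow> f x) (at x within {0..1})" using c x by (simp add: continuous_on)
  then have "((\<lambda>y. ereal \<bar>f y\<bar>) \<longlongrightarrow> ereal \<bar>f x\<bar>) (at x within {0..1})" by (intro tendsto_intros)
  from order_tendstoD(1)[OF this lt]
  obtain d where d: "d > 0" "\<And>y. y \<in> {0..1} \<Longrightarrow> y \<noteq> x \<Longrightarrow> dist y x < d \<Longrightarrow> Linf_norm f < ereal \<bar>f y\<bar>"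
    unfolding eventually_at by blast
  have "{max 0 (x - d / 2)..min 1 (x + d / 2)} \<subseteq> N"
  proof
    fix y assume y: "y \<in> {max 0 (x - d / 2)..min 1 (x + d / 2)}"
    then have "y \<in> {0..1}" "dist y x < d" using d(1) by (auto simp: dist_real_def)
    then have "Linf_norm f < ereal \<bar>f y\<bar>" using d(2)[of y] lt by (cases "y = x") auto
    then show "y \<in> N" using N(2)[of y] \<open>y \<in> {0..1}\<close> by (auto simp: not_le[symmetric])
  qed
  then have neg: "negligible (cbox (max 0 (x - d / 2)) (min 1 (x + d / 2)))"
    using negligible_subset[OF N(1)] by simp
  have "max 0 (x - d / 2) < min 1 (x + d / 2)" using x d(1) by (auto simp: max_def min_def)
  then show False using neg unfolding negligible_interval(1) box_real(1) greaterThanLessThan_empty_iff by linarith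
qed

lemma embedding_const_eq:
  assumes n: "n \<ge> 1" and m: "m \<in> {0..1}" "\<And>x. x \<in> {0..1} \<Longrightarrow> sharp_val n x \<le> sharp_val n m"
  shows "embedding_const n (n - 1) = ereal (sharp_val n m)"
proof (rule antisym)
  have cont: "continuous_on {0..1} (der (n - 1) z)" if "z \<in> sobolev0 n" for z
    using that n by (intro ac_imp_continuous_on) (auto simp: sobolev0_def)
  show "embedding_const n (n - 1) \<le> ereal (sharp_val n m)"
    unfolding embedding_const_def
  proof (rule SUP_least)
    fix z assume z: "z \<in> {y \<in> sobolev0 n. Linf_norm (der n y) = 1}"
    have "der (n - 1) z \<in> borel_measurable (lebesgue_on {0..1})"
      using cont z by (intro continuous_imp_measurable_on_sets_lebesgue) auto
    then show "Linf_norm (der (n - 1) z) \<le> ereal (sharp_val n m)"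
      unfolding Linf_norm_def
    proof (intro esssup_I AE_I2)
      fix x assume "x \<in> space (lebesgue_on {0..1::real})"
      then have x: "x \<in> {0..1}" by (simp add: space_restrict_space)
      show "ereal \<bar>der (n - 1) z x\<bar> \<le> ereal (sharp_val n m)"
        using sharp_val_bound[OF n x, of z] m(2)[OF x] z by simp
    qed simp
  qed
  have "sharp_const n (n - 1) m \<le> embedding_const n (n - 1)"
    unfolding sharp_const_def embedding_const_def
    by (rule SUP_mono) (use abs_le_Linf_norm[OF cont m(1)] in blast)
  then show "ereal (sharp_val n m) \<le> embedding_const n (n - 1)"
    using sharp_const_eq[OF n m(1)] by simp
qed

lemma embedding_const_global_max:
  assumes n: "n \<ge> 1" and m: "m \<in> global_maxima n"
  shows "embedding_const n (n - 1) = ereal (B n m)"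
proof -
  have "m \<in> node n ` {1..n}" using m unfolding global_max_points_sharp[OF n] by blast
  then have "sharp_val n m = B n m" using sharp_val_nodes by auto
  then show ?thesis using embedding_const_eq[OF n, of m] m unfolding global_max_sharp_iff[OF n] by simp
qed

lemma global_max_odd:
  assumes n: "odd n"
  shows "global_maxima n = {1 / 2}"
proof -
  have n1: "n \<ge> 1" using n by (cases n) auto
  obtain m where m: "n = 2 * m + 1" using n by (elim oddE)
  have "node n (m + 1) = 1 / 2" using node_reflect[of "m + 1" "m + 1" n] m by simp
  then have "1 / 2 \<in> node n ` {1..n}" using m by (intro image_eqI[of _ _ "m + 1"]) auto
  then show ?thesis unfolding global_max_points_sharp[OF n1] by force
qed

lemma global_max_even:
  assumes n: "n \<ge> 1" and m: "n = 2 * m"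
  shows "global_maxima n = {node n m, node n (m + 1)}"
proof -
  have s: "node n m + node n (m + 1) = 1" by (rule node_reflect) (use m in simp)
  have lt: "node n m < node n (m + 1)" by (rule node_strict_mono) (use m n in auto)
  have far: "\<bar>node n m - 1 / 2\<bar> < \<bar>node n j - 1 / 2\<bar>" if "j \<in> {1..n}" "j \<noteq> m" "j \<noteq> m + 1" for j
  proof (cases "j < m")
    case True
    then have "node n j < node n m" by (rule node_strict_mono) (use m in simp)
    then show ?thesis using s lt by linarith
  next
    case False
    then have "node n (m + 1) < node n j" by (intro node_strict_mono) (use that in auto)
    then show ?thesis using s lt by linarith
  qed
  have eq: "\<bar>node n (m + 1) - 1 / 2\<bar> = \<bar>node n m - 1 / 2\<bar>" using s by linarith
  have near: "\<bar>node n m - 1 / 2\<bar> \<le> \<bar>node n j - 1 / 2\<bar>" if "j \<in> {1..n}" for j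
    using far[OF that] eq by (cases "j = m"; cases "j = m + 1") auto
  have in_range: "m \<in> {1..n}" "m + 1 \<in> {1..n}" using m n by auto
  show ?thesis unfolding global_max_points_sharp[OF n]
  proof (intro set_eqI iffI)
    fix a assume "a \<in> {a \<in> node n ` {1..n}. \<forall>b\<in>node n ` {1..n}. \<bar>a - 1 / 2\<bar> \<le> \<bar>b - 1 / 2\<bar>}"
    then obtain j where j: "j \<in> {1..n}" "a = node n j" "\<bar>node n j - 1 / 2\<bar> \<le> \<bar>node n m - 1 / 2\<bar>"
      using in_range by blast
    then have "j = m \<or> j = m + 1" using far[of j] by force
    then show "a \<in> {node n m, node n (m + 1)}" using j by blast
  next
    fix a assume "a \<in> {node n m, node n (m + 1)}"
    then show "a \<in> {a \<in> node n ` {1..n}. \<forall>b\<in>node n ` {1..n}. \<bar>a - 1 / 2\<bar> \<le> \<bar>b - 1 / 2\<bar>}"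
      using in_range near eq by auto
  qed
qed

theorem mainTheorem3:
  fixes n :: nat
  assumes "n \<ge> 1"
  shows "local_max_points {0..1} (sharp_const n (n - 1)) = node n ` {1..n}
    \<and> (\<forall>j\<in>{1..n}. sharp_const n (n - 1) (node n j) = ereal (B n (node n j)))
    \<and> (even (n - 1) \<longrightarrow> global_max_points {0..1} (sharp_const n (n - 1)) = {1 / 2})
    \<and> (odd (n - 1) \<longrightarrow>
         global_max_points {0..1} (sharp_const n (n - 1)) =
           {a. is_arg_min (\<lambda>a. \<bar>a - 1 / 2\<bar>)
                 (\<lambda>a. a \<in> local_max_points {0..1} (sharp_const n (n - 1))) a}
       \<and> global_max_points {0..1} (sharp_const n (n - 1)) =
           {(sin (pi * real n / (4 * (real n + 1))))\<^sup>2,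
            (sin (pi * (real n + 2) / (4 * (real n + 1))))\<^sup>2})
    \<and> (odd n \<longrightarrow> embedding_const n (n - 1) = ereal (1 / 2 * tan (pi / (2 * (real n + 1)))))
    \<and> (even n \<longrightarrow> embedding_const n (n - 1) =
         ereal (1 / 2 * tan (pi / (2 * (real n + 1))) * sin (pi * real n / (2 * (real n + 1)))))"
proof (intro conjI ballI impI)
  show "local_max_points {0..1} (sharp_const n (n - 1)) = node n ` {1..n}"
    by (rule local_max_points_sharp[OF assms])
  show "sharp_const n (n - 1) (node n j) = ereal (B n (node n j))" if "j \<in> {1..n}" for j
    using sharp_const_eq[OF assms node_range[of j n]] sharp_val_nodes[of j n] that by simp
  show "global_max_points {0..1} (sharp_const n (n - 1)) = {1 / 2}" if "even (n - 1)"
    using global_max_odd that assms by simp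
  show "global_max_points {0..1} (sharp_const n (n - 1)) =
           {a. is_arg_min (\<lambda>a. \<bar>a - 1 / 2\<bar>)
                 (\<lambda>a. a \<in> local_max_points {0..1} (sharp_const n (n - 1))) a}"
    unfolding global_max_points_sharp[OF assms] local_max_points_sharp[OF assms] is_arg_min_def
    by (auto simp: not_less)
  show "global_max_points {0..1} (sharp_const n (n - 1)) =
           {(sin (pi * real n / (4 * (real n + 1))))\<^sup>2,
            (sin (pi * (real n + 2) / (4 * (real n + 1))))\<^sup>2}" if "odd (n - 1)"
  proof -
    have "even n" using that assms by simp
    then obtain m where m: "n = 2 * m" by (elim evenE)
    have "node n m = (sin (pi * real n / (4 * (real n + 1))))\<^sup>2"
    proof -
      have "pi * real m / (2 * (real n + 1)) = pi * real n / (4 * (real n + 1))"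
        by (simp add: m divide_simps)
      then show ?thesis unfolding node_def by simp
    qed
    moreover have "pi * real (m + 1) / (2 * (real n + 1)) = pi * (real n + 2) / (4 * (real n + 1))"
      by (simp add: m divide_simps) (simp add: algebra_simps)
    then have "node n (m + 1) = (sin (pi * (real n + 2) / (4 * (real n + 1))))\<^sup>2"
      unfolding node_def by simp
    ultimately show ?thesis using global_max_even[OF assms m] by simp
  qed
  show "embedding_const n (n - 1) = ereal (1 / 2 * tan (pi / (2 * (real n + 1))))" if "odd n"
  proof -
    have "sqrt (1 / 2 - (1 / 2)\<^sup>2) = (1 / 2 :: real)"
      by (rule real_sqrt_unique) (simp_all add: power2_eq_square)
    then show ?thesis
      using embedding_const_global_max[OF assms, of "1 / 2"] global_max_odd[OF that] by (simp add: B_def)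
  qed
  show "embedding_const n (n - 1) =
         ereal (1 / 2 * tan (pi / (2 * (real n + 1))) * sin (pi * real n / (2 * (real n + 1))))" if "even n"
  proof -
    obtain m where m: "n = 2 * m" using \<open>even n\<close> by (elim evenE)
    have mr: "1 \<le> m" "m \<le> n" using assms m by auto
    have "embedding_const n (n - 1) = ereal (B n (node n m))"
      by (rule embedding_const_global_max[OF assms]) (use global_max_even[OF assms m] in simp)
    also have "B n (node n m) = tan (half_step n) / 2 * sin (2 * (real m * half_step n))"
      using alt_nodes_B[OF mr] alt_nodes_eq[OF assms, of m] by simp
    also have "2 * (real m * half_step n) = pi * real n / (2 * (real n + 1))"
      by (simp add: half_step_def m)
    finally show ?thesis by (simp add: half_step_def)
  qed
qed

end
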